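(* Let $\mathcal N_{X_1X_2\to B_2B_3}:(x_1,x_2)\mapsto\rho_{B_2B_3}^{(x_1x_2)}$ be a classical-quantum relay channel, let $p_{X_1X_2}$ be a probability distribution on $\mathcal X_1\times\mathcal X_2$, and let $$\rho_{X_1X_2B_2B_3}=\sum_{x_1,x_2}p_{X_1X_2}(x_1,x_2)|x_1x_2\rangle\langle x_1x_2|_{X_1X_2}\otimes\rho_{B_2B_3}^{(x_1x_2)} .$$ Given $R\in\mathbb R_{\ge0}$, $\varepsilon\in(0,1)$ and $b\in\mathbb N$, set $$\delta=b\Big[2f(2,\varepsilon)+4\Big(2^{R-D_H^\varepsilon\left(\rho_{X_1X_2B_3}\Vert\rho_{X_1X_2B_3}^{(\{X_1X_2,B_3\})}\right)}+2^{R-D_H^\varepsilon\left(\rho_{X_1X_2B_2}\Vert\rho_{X_1X_2B_2}^{(\{X_1,B_2\})}\right)}\Big)\Big].$$ If $\delta\in[0,1]$, then the triple $\left(\frac{b-1}{b}R,\,b,\,\delta\right)$ is achievable for $\mathcal N$.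
   Context: All alphabets are finite, all Hilbert spaces finite-dimensional, and $\log$ is base 2. Universal function: $f(k,\varepsilon)=\big(1+6\cdot2^{\frac{k+1}{2}}+4\cdot2^{2^{k+5}+k^2+2k}\big)\varepsilon^{1/3}$. Hypothesis-testing relative entropy: $D_H^\varepsilon(\rho\Vert\sigma)=\max_{0\le\Pi\le I,\ \mathrm{tr}(\Pi\rho)\ge1-\varepsilon}-\log\mathrm{tr}(\Pi\sigma)$ (with $-\log0=+\infty$). Conditional product states: for a classical-quantum state $\rho_{XB}=\sum_xp_X(x)|x\rangle\langle x|_X\otimes\rho_B^{(x)}$ with $X=(X_v)_{v\in V}$ and $S\subseteq V$, $\overline S=V\setminus S$, define $\rho_{XB}^{(\{X_S,B\})}=\sum_xp_X(x)|x\rangle\langle x|_X\otimes\rho_B^{(x_{\overline S})}$, where $\rho_B^{(x_{\overline S})}=\sum_{x_S}p_{X_S|X_{\overline S}}(x_S|x_{\overline S})\rho_B^{(x_S,x_{\overline S})}$. In particular $\rho_{X_1X_2B_3}^{(\{X_1X_2,B_3\})}=\rho_{X_1X_2}\otimes\rho_{B_3}$. States with fewer subscripts are reduced states (partial traces). Classical-quantum relay channel: a map $\mathcal N_{X_1X_2\to B_2B_3}$ assigning to each $(x_1,x_2)\in\mathcal X_1\times\mathcal X_2$ a quantum state $\rho_{B_2B_3}^{(x_1x_2)}$ on $\mathcal H_{B_2}\otimes\mathcal H_{B_3}$. The sender inputs $x_1$, the relay inputs $x_2$ and obtains $B_2$, the receiver obtains $B_3$. Code: an $(n,2^{nR})$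 code consists of (1) a message set $M$ with $|M|=2^{nR}$; (2) an encoding $x_1^n(m)\in\mathcal X_1^n$ for each $m\in M$; (3) relay operations (quantum channels) $\mathcal R_{(B_2)_{j-1}(B_2')_{j-1}\to(X_2)_j(B_2')_j}$, $j\in[n]$, where $(B_2)_j\cong B_2$, $(X_2)_j\cong X_2$ is classical, $(B_2')_j$ is an arbitrary quantum system, and $(B_2)_0(B_2')_0$ is trivial (dimension 1); (4) a receiver POVM $\{Q_{B_3^n}^{(m)}\}_{m\in M}$. In round $j$ the sender transmits $(x_1)_j(m)$, while the relay applies its $j$-th operation to $(B_2)_{j-1}(B_2')_{j-1}$, transmits $(X_2)_j$ and keeps $(B_2')_j$; the channel outputs $(B_2)_j$ to the relay and $(B_3)_j$ to the receiver. With $\rho_{B_3^n}(m)$ the receiver's final state, the average error probability is $p_e=\frac1{|M|}\sum_{m}\mathrm{tr}[(I-Q_{B_3^n}^{(m)})\rho_{B_3^n}(m)]$. Achievability: for $R\ge0$, $n\in\mathbb N$, $\delta\in[0,1]$, the triple $(R,n,\delta)$ is achievable if there is an $(n,2^{nR'})$ code with $R'\ge R$ and $p_e\le\delta$. *)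

theory Defs
  imports
    "HOL-Probability.Probability_Mass_Function"
    "Jordan_Normal_Form.Schur_Decomposition"
begin

text \<open>
  Conventions.  A \<open>d\<close>-dimensional Hilbert space is \<open>\<complex>\<^sup>d\<close> with basis \<open>0, \<dots>, d - 1\<close>, and an alphabet
  of size \<open>k\<close> is \<open>{..<k}\<close>.  The tensor product of spaces of dimensions \<open>a\<close> and \<open>c\<close> is \<open>\<complex>\<^sup>a\<^sup>c\<close>, where
  the pair \<open>(i, j)\<close> of basis labels is the basis label \<open>i * c + j\<close>; the tensor product is thereby
  strictly associative.
\<close>

section \<open>Operators\<close>

definition mtrace :: "complex mat \<Rightarrow> complex" where
  "mtrace A = (\<Sum>i<dim_row A. A $$ (i, i))"

definition psd :: "nat \<Rightarrow> complex mat \<Rightarrow> bool" where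
  "psd d A \<longleftrightarrow> A \<in> carrier_mat d d \<and> (\<forall>v\<in>carrier_vec d. 0 \<le> (A *\<^sub>v v) \<bullet>c v)"

definition density :: "nat \<Rightarrow> complex mat \<Rightarrow> bool" where
  "density d \<rho> \<longleftrightarrow> psd d \<rho> \<and> mtrace \<rho> = 1"

definition mat_sum :: "nat \<Rightarrow> ('a \<Rightarrow> complex mat) \<Rightarrow> 'a set \<Rightarrow> complex mat" where
  "mat_sum d f I = mat d d (\<lambda>(i, j). \<Sum>x\<in>I. f x $$ (i, j))"

definition kron :: "complex mat \<Rightarrow> complex mat \<Rightarrow> complex mat" where
  "kron A B = mat (dim_row A * dim_row B) (dim_col A * dim_col B)
     (\<lambda>(i, j). A $$ (i div dim_row B, j div dim_col B) * B $$ (i mod dim_row B, j mod dim_col B))"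

definition ketbra :: "nat \<Rightarrow> nat \<Rightarrow> complex mat" where
  "ketbra k x = mat k k (\<lambda>(i, j). if i = x \<and> j = x then 1 else 0)"

text \<open>Partial traces over the first, respectively second, factor of \<open>\<complex>\<^sup>a \<otimes> \<complex>\<^sup>c\<close>.\<close>

definition ptrace_fst :: "nat \<Rightarrow> nat \<Rightarrow> complex mat \<Rightarrow> complex mat" where
  "ptrace_fst a c A = mat c c (\<lambda>(i, j). \<Sum>u<a. A $$ (u * c + i, u * c + j))"

definition ptrace_snd :: "nat \<Rightarrow> nat \<Rightarrow> complex mat \<Rightarrow> complex mat" where
  "ptrace_snd a c A = mat a a (\<lambda>(i, j). \<Sum>u<c. A $$ (i * c + u, j * c + u))"

text \<open>
  \<open>id_tensor k a c \<Phi>\<close> is \<open>id \<otimes> \<Phi>\<close> from operators on \<open>\<complex>\<^sup>k \<otimes> \<complex>\<^sup>a\<close> to operators on \<open>\<complex>\<^sup>k \<otimes> \<complex>\<^sup>c\<close>: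
  the linear map \<open>\<Phi>\<close> is applied to each of the \<open>k * k\<close> blocks of size \<open>a \<times> a\<close>.
\<close>

definition id_tensor ::
  "nat \<Rightarrow> nat \<Rightarrow> nat \<Rightarrow> (complex mat \<Rightarrow> complex mat) \<Rightarrow> complex mat \<Rightarrow> complex mat" where
  "id_tensor k a c \<Phi> A = mat (k * c) (k * c) (\<lambda>(i, j).
     \<Phi> (mat a a (\<lambda>(r, s). A $$ ((i div c) * a + r, (j div c) * a + s))) $$ (i mod c, j mod c))"

definition quantum_channel :: "nat \<Rightarrow> nat \<Rightarrow> (complex mat \<Rightarrow> complex mat) \<Rightarrow> bool" where
  "quantum_channel a c \<Phi> \<longleftrightarrow>
     (\<forall>A\<in>carrier_mat a a. \<Phi> A \<in> carrier_mat c c) \<and>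
     (\<forall>A\<in>carrier_mat a a. \<forall>B\<in>carrier_mat a a. \<Phi> (A + B) = \<Phi> A + \<Phi> B) \<and>
     (\<forall>z. \<forall>A\<in>carrier_mat a a. \<Phi> (z \<cdot>\<^sub>m A) = z \<cdot>\<^sub>m \<Phi> A) \<and>
     (\<forall>A\<in>carrier_mat a a. mtrace (\<Phi> A) = mtrace A) \<and>
     (\<forall>k A. psd (k * a) A \<longrightarrow> psd (k * c) (id_tensor k a c \<Phi> A))"

text \<open>The factor \<open>\<complex>\<^sup>k\<close> of an operator on \<open>\<complex>\<^sup>k \<otimes> \<complex>\<^sup>c\<close> is classical: the operator is block diagonal.\<close>

definition classical_fst :: "nat \<Rightarrow> nat \<Rightarrow> complex mat \<Rightarrow> bool" where
  "classical_fst k c A \<longleftrightarrow> (\<forall>i<k * c. \<forall>j<k * c. i div c \<noteq> j div c \<longrightarrow> A $$ (i, j) = 0)"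

definition povm :: "nat \<Rightarrow> 'm set \<Rightarrow> ('m \<Rightarrow> complex mat) \<Rightarrow> bool" where
  "povm d M Q \<longleftrightarrow> (\<forall>m\<in>M. psd d (Q m)) \<and> mat_sum d Q M = 1\<^sub>m d"

section \<open>Hypothesis-testing relative entropy\<close>

definition neg_log2 :: "real \<Rightarrow> ereal" where
  "neg_log2 t = (if t = 0 then \<infinity> else ereal (- log 2 t))"

text \<open>
  The feasible tests form a compact set on which the objective is continuous into the extended
  reals, so the supremum is a maximum.
\<close>

definition D_H :: "nat \<Rightarrow> real \<Rightarrow> complex mat \<Rightarrow> complex mat \<Rightarrow> ereal" where
  "D_H d \<epsilon> \<rho> \<sigma> =
     (SUP T \<in> {T. psd d T \<and> psd d (1\<^sub>m d - T) \<and> Re (mtrace (T * \<rho>)) \<ge> 1 - \<epsilon>}.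
        neg_log2 (Re (mtrace (T * \<sigma>))))"

definition exp2 :: "ereal \<Rightarrow> ereal" where
  "exp2 t = (if t = \<infinity> then \<infinity> else if t = -\<infinity> then 0 else ereal (2 powr real_of_ereal t))"

definition universal_f :: "nat \<Rightarrow> real \<Rightarrow> real" where
  "universal_f k \<epsilon> =
     (1 + 6 * 2 powr ((real k + 1) / 2) + 4 * 2 ^ (2 ^ (k + 5) + k\<^sup>2 + 2 * k)) * \<epsilon> powr (1 / 3)"

section \<open>Classical-quantum states with two classical systems\<close>

definition cq_state ::
  "nat \<Rightarrow> nat \<Rightarrow> nat \<Rightarrow> (nat \<times> nat) pmf \<Rightarrow> (nat \<times> nat \<Rightarrow> complex mat) \<Rightarrow> complex mat" where
  "cq_state k1 k2 d p \<rho> = mat_sum (k1 * k2 * d)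
     (\<lambda>(x1, x2). complex_of_real (pmf p (x1, x2)) \<cdot>\<^sub>m
        kron (kron (ketbra k1 x1) (ketbra k2 x2)) (\<rho> (x1, x2)))
     ({..<k1} \<times> {..<k2})"

text \<open>
  For \<open>S \<subseteq> {1, 2}\<close>, \<open>fibre k1 k2 S x\<close> is the set of the pairs \<open>y\<close> with \<open>y\<^sub>v = x\<^sub>v\<close> for all \<open>v \<in> {1, 2} - S\<close>.
  The probability of \<open>x\<close> restricted to \<open>{1, 2} - S\<close> is the sum of \<open>p\<close> over this set; where it
  vanishes, the conditional state is multiplied by \<open>p x = 0\<close> in \<^emph>\<open>cond_prod_state\<close>.
\<close>

definition fibre :: "nat \<Rightarrow> nat \<Rightarrow> nat set \<Rightarrow> nat \<times> nat \<Rightarrow> (nat \<times> nat) set" where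
  "fibre k1 k2 S x = {y \<in> {..<k1} \<times> {..<k2}.
     (1 \<notin> S \<longrightarrow> fst y = fst x) \<and> (2 \<notin> S \<longrightarrow> snd y = snd x)}"

definition cond_output ::
  "nat \<Rightarrow> nat \<Rightarrow> nat \<Rightarrow> (nat \<times> nat) pmf \<Rightarrow> (nat \<times> nat \<Rightarrow> complex mat) \<Rightarrow> nat set
     \<Rightarrow> nat \<times> nat \<Rightarrow> complex mat" where
  "cond_output k1 k2 d p \<rho> S x = mat_sum d
     (\<lambda>y. complex_of_real (pmf p y / (\<Sum>z\<in>fibre k1 k2 S x. pmf p z)) \<cdot>\<^sub>m \<rho> y)
     (fibre k1 k2 S x)"

definition cond_prod_state ::
  "nat \<Rightarrow> nat \<Rightarrow> nat \<Rightarrow> (nat \<times> nat) pmf \<Rightarrow> (nat \<times> nat \<Rightarrow> complex mat) \<Rightarrow> nat set \<Rightarrow> complex mat" where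
  "cond_prod_state k1 k2 d p \<rho> S = cq_state k1 k2 d p (cond_output k1 k2 d p \<rho> S)"

section \<open>Relay channels and codes\<close>

text \<open>The output \<open>N (x1, x2)\<close> is a state on \<open>B\<^sub>2 \<otimes> B\<^sub>3\<close>, of dimensions \<open>d2\<close> and \<open>d3\<close>.\<close>

definition cq_relay_channel ::
  "nat \<Rightarrow> nat \<Rightarrow> nat \<Rightarrow> nat \<Rightarrow> (nat \<times> nat \<Rightarrow> complex mat) \<Rightarrow> bool" where
  "cq_relay_channel k1 k2 d2 d3 N \<longleftrightarrow> (\<forall>x\<in>{..<k1} \<times> {..<k2}. density (d2 * d3) (N x))"

text \<open>
  \<open>sender m j\<close> is the \<open>j\<close>-th input symbol for message \<open>m\<close>, and \<open>mem_dim j\<close> the dimension of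
  the relay memory \<open>(B\<^sub>2')\<^sub>j\<close>, for rounds \<open>j = 1, \<dots>, n\<close>.
\<close>

record relay_code =
  msgs :: "nat set"
  sender :: "nat \<Rightarrow> nat \<Rightarrow> nat"
  mem_dim :: "nat \<Rightarrow> nat"
  relay_op :: "nat \<Rightarrow> complex mat \<Rightarrow> complex mat"
  decoder :: "nat \<Rightarrow> complex mat"

text \<open>The dimension of \<open>(B\<^sub>2)\<^sub>j (B\<^sub>2')\<^sub>j\<close>, the system held by the relay after \<open>j\<close> rounds.\<close>

definition relay_dim :: "nat \<Rightarrow> relay_code \<Rightarrow> nat \<Rightarrow> nat" where
  "relay_dim d2 C j = (if j = 0 then 1 else d2 * mem_dim C j)"

definition is_relay_code ::
  "nat \<Rightarrow> nat \<Rightarrow> nat \<Rightarrow> nat \<Rightarrow> nat \<Rightarrow> real \<Rightarrow> relay_code \<Rightarrow> bool" where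
  "is_relay_code k1 k2 d2 d3 n R C \<longleftrightarrow>
     finite (msgs C) \<and> real (card (msgs C)) = 2 powr (real n * R) \<and>
     (\<forall>m\<in>msgs C. \<forall>j\<in>{1..n}. sender C m j < k1) \<and>
     (\<forall>j\<in>{1..n}.
        quantum_channel (relay_dim d2 C (j - 1)) (k2 * mem_dim C j) (relay_op C j) \<and>
        (\<forall>A\<in>carrier_mat (relay_dim d2 C (j - 1)) (relay_dim d2 C (j - 1)).
           classical_fst k2 (mem_dim C j) (relay_op C j A))) \<and>
     povm (d3 ^ n) (msgs C) (decoder C)"

text \<open>
  One use of the channel.  The argument \<open>\<sigma>\<close> is an operator on \<open>E \<otimes> X\<^sub>2 \<otimes> B\<^sub>2'\<close> (dimensions \<open>e, k2, q\<close>)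
  with \<open>X\<^sub>2\<close> classical, and \<open>\<rho> x2\<close> is the channel output on \<open>B\<^sub>2 \<otimes> B\<^sub>3\<close>.  The result is
  \<open>\<Sum>x2. \<langle>x2| \<sigma> |x2\<rangle> \<otimes> \<rho> x2\<close> with its factors arranged as \<open>E \<otimes> B\<^sub>3 \<otimes> B\<^sub>2 \<otimes> B\<^sub>2'\<close>, so that the receiver's
  systems stay to the left of those of the relay.
\<close>

definition split4 :: "nat \<Rightarrow> nat \<Rightarrow> nat \<Rightarrow> nat \<Rightarrow> nat \<times> nat \<times> nat \<times> nat" where
  "split4 d3 d2 q i =
     (i div (d3 * d2 * q), i div (d2 * q) mod d3, i div q mod d2, i mod q)"

definition channel_use ::
  "nat \<Rightarrow> nat \<Rightarrow> nat \<Rightarrow> nat \<Rightarrow> nat \<Rightarrow> (nat \<Rightarrow> complex mat) \<Rightarrow> complex mat \<Rightarrow> complex mat" where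
  "channel_use e k2 d2 d3 q \<rho> \<sigma> = mat (e * d3 * d2 * q) (e * d3 * d2 * q) (\<lambda>(i, j).
     case (split4 d3 d2 q i, split4 d3 d2 q j) of
       ((u, b3, b2, b), (v, c3, c2, c)) \<Rightarrow>
         \<Sum>x2<k2. \<sigma> $$ (u * (k2 * q) + x2 * q + b, v * (k2 * q) + x2 * q + c)
                  * \<rho> x2 $$ (b2 * d3 + b3, c2 * d3 + c3))"

text \<open>
  The joint state on \<open>(B\<^sub>3)\<^sub>1 \<dots> (B\<^sub>3)\<^sub>j (B\<^sub>2)\<^sub>j (B\<^sub>2')\<^sub>j\<close> after \<open>j\<close> rounds, when message \<open>m\<close> is sent.
\<close>

primrec joint_state ::
  "nat \<Rightarrow> nat \<Rightarrow> nat \<Rightarrow> (nat \<times> nat \<Rightarrow> complex mat) \<Rightarrow> relay_code \<Rightarrow> nat \<Rightarrow> nat \<Rightarrow> complex mat" where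
  "joint_state k2 d2 d3 N C m 0 = 1\<^sub>m 1"
| "joint_state k2 d2 d3 N C m (Suc j) =
     channel_use (d3 ^ j) k2 d2 d3 (mem_dim C (Suc j)) (\<lambda>x2. N (sender C m (Suc j), x2))
       (id_tensor (d3 ^ j) (relay_dim d2 C j) (k2 * mem_dim C (Suc j)) (relay_op C (Suc j))
          (joint_state k2 d2 d3 N C m j))"

definition receiver_state ::
  "nat \<Rightarrow> nat \<Rightarrow> nat \<Rightarrow> (nat \<times> nat \<Rightarrow> complex mat) \<Rightarrow> relay_code \<Rightarrow> nat \<Rightarrow> nat \<Rightarrow> complex mat" where
  "receiver_state k2 d2 d3 N C n m =
     ptrace_snd (d3 ^ n) (relay_dim d2 C n) (joint_state k2 d2 d3 N C m n)"

definition avg_error ::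
  "nat \<Rightarrow> nat \<Rightarrow> nat \<Rightarrow> (nat \<times> nat \<Rightarrow> complex mat) \<Rightarrow> relay_code \<Rightarrow> nat \<Rightarrow> real" where
  "avg_error k2 d2 d3 N C n = (1 / real (card (msgs C))) *
     (\<Sum>m\<in>msgs C.
        Re (mtrace ((1\<^sub>m (d3 ^ n) - decoder C m) * receiver_state k2 d2 d3 N C n m)))"

definition achievable ::
  "nat \<Rightarrow> nat \<Rightarrow> nat \<Rightarrow> nat \<Rightarrow> (nat \<times> nat \<Rightarrow> complex mat) \<Rightarrow> real \<Rightarrow> nat \<Rightarrow> real \<Rightarrow> bool" where
  "achievable k1 k2 d2 d3 N R n \<delta> \<longleftrightarrow>
     (\<exists>R' C. R' \<ge> R \<and> is_relay_code k1 k2 d2 d3 n R' C \<and> avg_error k2 d2 d3 N C n \<le> \<delta>)"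

end

theory Submission
  imports
    Defs
    "HOL-Probability.Product_PMF"
    "Jordan_Normal_Form.Spectral_Radius"
begin

text \<open>
  The code is block-Markov decode-and-forward with one channel use per block.  In block \<open>j\<close> the sender transmits
  \<open>x1(m', m)\<close> and the relay \<open>x2(m')\<close>, where \<open>m\<close> is the message of this block and \<open>m'\<close> that of the previous one; all blocks
  use the same codebook, drawn from \<open>p(x2) p(x1 | x2)\<close>.  The relay, knowing \<open>m'\<close>, decodes \<open>m\<close> from its output of the
  block, and the receiver works backwards: knowing \<open>m\<close> it decodes \<open>m'\<close> from its output.  Along the branch on which the relay
  has decoded correctly so far, the state is a product over the blocks, so the error is at most the sum over the
  blocks of the errors of the two measurements.  Each of these is a square-root measurement built from an optimal
  test of the hypothesis-testing relative entropy; by the Hayashi--Nagaoka inequality its expected error is at most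
  \<open>2 \<epsilon> + 4 (M - 1) 2\<^sup>-\<^sup>D\<close>, and \<open>M = \<lceil>2\<^sup>R\<rceil>\<close> satisfies \<open>M - 1 \<le> 2\<^sup>R\<close>.  The universal function exceeds \<open>2 \<epsilon>\<close> by
  far, which also absorbs that an almost optimal test is used in place of a maximiser.
\<close>

section \<open>The spectral theorem\<close>

text \<open>One codebook serves all blocks because only first moments are used: the bound for a
  block involves the transmitted pair and one competitor at a time, and the expectations for all
  blocks and messages are added without any independence between blocks. The relay's competitors lie
  in the row of the transmitted pair: they share its relay symbol and are conditionally independent
  of it given that symbol, which is where the state for \<open>{X1, B2}\<close> comes from. The
  receiver's competitors lie in other rows and are independent pairs, which gives the product state.
  The obstacle is that a wrong relay estimate changes all later inputs. Branches are therefore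
  indexed by the content of the relay's memory; only the correct one is estimated, and the others
  contribute nonnegative probabilities. Every output system is measured at most once, and relay and
  receiver measure different factors, so errors add up without a loss from disturbance. The analysis
  is valid for any pair of tests; the entropies enter only in the last proof.\<close>

declare minus_carrier_mat [simp]

definition adj :: "complex mat \<Rightarrow> complex mat" where
  "adj A = mat (dim_col A) (dim_row A) (\<lambda>(i, j). cnj (A $$ (j, i)))"

lemma adj_dim [simp]: "dim_row (adj A) = dim_col A" "dim_col (adj A) = dim_row A"
  by (simp_all add: adj_def)

lemma adj_carrier [simp, intro]: "A \<in> carrier_mat n m \<Longrightarrow> adj A \<in> carrier_mat m n"
  by (auto simp: adj_def)

lemma adj_index [simp]: "i < dim_col A \<Longrightarrow> j < dim_row A \<Longrightarrow> adj A $$ (i, j) = cnj (A $$ (j, i))"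
  by (simp add: adj_def)

lemma adj_adj [simp]: "adj (adj A) = A"
  by (rule eq_matI) auto

lemma adj_one [simp]: "adj (1\<^sub>m n) = 1\<^sub>m n"
  by (rule eq_matI) auto

lemma index_mult_sum:
  assumes "A \<in> carrier_mat n m" "B \<in> carrier_mat m k" "i < n" "j < k"
  shows "(A * B) $$ (i, j) = (\<Sum>l<m. A $$ (i, l) * B $$ (l, j))"
  using assms by (auto simp: scalar_prod_def atLeast0LessThan intro!: sum.cong)

lemma square_mult_carrier [simp, intro]:
  "A \<in> carrier_mat n n \<Longrightarrow> B \<in> carrier_mat n n \<Longrightarrow> A * B \<in> carrier_mat n n"
  by (rule mult_carrier_mat)

lemma assoc_square_mult:
  fixes A :: "'a :: semiring_0 mat"
  shows "A \<in> carrier_mat n n \<Longrightarrow> B \<in> carrier_mat n n \<Longrightarrow> C \<in> carrier_mat n n \<Longrightarrow> A * B * C = A * (B * C)"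
  by (rule assoc_mult_mat)

lemma adj_mult:
  assumes "A \<in> carrier_mat n m" "B \<in> carrier_mat m k"
  shows "adj (A * B) = adj B * adj A"
proof (rule eq_matI)
  fix i j assume "i < dim_row (adj B * adj A)" "j < dim_col (adj B * adj A)"
  then have ij: "i < k" "j < n" using assms by auto
  then have "adj (A * B) $$ (i, j) = cnj ((A * B) $$ (j, i))"
    using assms by simp
  also have "\<dots> = (\<Sum>l<m. adj B $$ (i, l) * adj A $$ (l, j))"
    using assms ij by (simp add: index_mult_sum[OF assms] mult.commute del: index_mult_mat(1))
  also have "\<dots> = (adj B * adj A) $$ (i, j)"
    using assms ij by (simp add: index_mult_sum[where n=k and m=m and k=n] del: index_mult_mat(1))
  finally show "adj (A * B) $$ (i, j) = (adj B * adj A) $$ (i, j)" .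
qed (use assms in auto)

definition diagm :: "nat \<Rightarrow> (nat \<Rightarrow> real) \<Rightarrow> complex mat" where
  "diagm n d = mat n n (\<lambda>(i, j). if i = j then complex_of_real (d i) else 0)"

lemma diagm_carrier [simp]: "diagm n d \<in> carrier_mat n n"
  by (simp add: diagm_def)

lemma diagm_dim [simp]: "dim_row (diagm n d) = n" "dim_col (diagm n d) = n"
  by (simp_all add: diagm_def)

lemma adj_diagm [simp]: "adj (diagm n d) = diagm n d"
  by (rule eq_matI) (auto simp: diagm_def)

lemma diagm_mult: "diagm n d * diagm n e = diagm n (\<lambda>i. d i * e i)"
proof (rule eq_matI)
  fix i j assume "i < dim_row (diagm n (\<lambda>i. d i * e i))" "j < dim_col (diagm n (\<lambda>i. d i * e i))"
  then have ij: "i < n" "j < n" by (auto simp: diagm_def)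
  then have "(diagm n d * diagm n e) $$ (i, j) = (\<Sum>l<n. diagm n d $$ (i, l) * diagm n e $$ (l, j))"
    by (simp add: index_mult_sum[where n=n and m=n and k=n] del: index_mult_mat(1))
  also have "\<dots> = (\<Sum>l<n. if l = i then complex_of_real (d i) * diagm n e $$ (i, j) else 0)"
    by (rule sum.cong) (use ij in \<open>auto simp: diagm_def\<close>)
  also have "\<dots> = complex_of_real (d i) * diagm n e $$ (i, j)"
    using ij by simp
  finally show "(diagm n d * diagm n e) $$ (i, j) = diagm n (\<lambda>i. d i * e i) $$ (i, j)"
    using ij by (simp add: diagm_def)
qed (auto simp: diagm_def)

definition unitary :: "nat \<Rightarrow> complex mat \<Rightarrow> bool" where
  "unitary n U \<longleftrightarrow> U \<in> carrier_mat n n \<and> adj U * U = 1\<^sub>m n \<and> U * adj U = 1\<^sub>m n"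

lemma unitaryI: "U \<in> carrier_mat n n \<Longrightarrow> adj U * U = 1\<^sub>m n \<Longrightarrow> unitary n U"
  unfolding unitary_def using mat_mult_left_right_inverse[of "adj U" n U] by auto

lemma unitary_mult:
  assumes "unitary n U" "unitary n V" shows "unitary n (U * V)"
proof (rule unitaryI)
  have [simp]: "U \<in> carrier_mat n n" "V \<in> carrier_mat n n"
    using assms by (auto simp: unitary_def)
  show "U * V \<in> carrier_mat n n" by simp
  have "adj (U * V) * (U * V) = adj V * ((adj U * U) * V)"
    by (simp add: adj_mult[where n=n and m=n and k=n] assoc_square_mult[where n=n])
  moreover have "1\<^sub>m n * V = V" by (rule left_mult_one_mat[where nc=n]) simp
  ultimately show "adj (U * V) * (U * V) = 1\<^sub>m n"
    using assms by (simp add: unitary_def)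
qed

text \<open>Gram--Schmidt keeps the first vector of a completed basis. It returns orthogonal vectors
  that need not have length 1, so each is divided by its norm \<open>r\<close>; this is the origin
  of the scalar \<open>c\<close>.\<close>

lemma unitary_first_column:
  fixes v :: "complex vec"
  assumes v: "v \<in> carrier_vec n" "v \<noteq> 0\<^sub>v n"
  shows "\<exists>U c. unitary n U \<and> col U 0 = c \<cdot>\<^sub>v v"
proof -
  interpret cof_vec_space n "TYPE(complex)" .
  have n: "n \<noteq> 0" using v by auto
  define b where "b = basis_completion v"
  define ws where "ws = gram_schmidt n b"
  from basis_completion[OF v, folded b_def]
  have dist_b: "distinct b" and indep: "\<not> lin_dep (set b)" and b: "set b \<subseteq> carrier_vec n"
    and hdb: "hd b = v" and len_b: "length b = n" by auto
  from hdb len_b n obtain vs where bv: "b = v # vs" by (cases b, auto)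
  from gram_schmidt_result[OF b dist_b indep refl, folded ws_def]
  have ws: "set ws \<subseteq> carrier_vec n" "corthogonal ws" "length ws = n"
    by (auto simp: len_b)
  from gram_schmidt_hd[OF v(1), of vs, folded bv] have hdws: "hd ws = v" unfolding ws_def .
  define r where "r i = sqrt (Re (ws ! i \<bullet>c ws ! i))" for i
  have pos: "ws ! i \<bullet>c ws ! i = complex_of_real (r i ^ 2) \<and> r i \<noteq> 0" if "i < n" for i
  proof -
    have ne: "ws ! i \<bullet>c ws ! i \<noteq> 0"
      using ws that corthogonalD[OF ws(2), of i i] by auto
    have ge: "ws ! i \<bullet>c ws ! i \<ge> 0"
      using conjugate_square_ge_0_vec by blast
    then have im: "Im (ws ! i \<bullet>c ws ! i) = 0" and re: "Re (ws ! i \<bullet>c ws ! i) \<ge> 0"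
      by (auto simp: less_eq_complex_def)
    moreover have "Re (ws ! i \<bullet>c ws ! i) \<noteq> 0" using ne im by (auto simp: complex_eq_iff)
    ultimately show ?thesis unfolding r_def by (auto simp: complex_eq_iff)
  qed
  define U where "U = mat n n (\<lambda>(i, j). ws ! j $ i / complex_of_real (r j))"
  have U: "U \<in> carrier_mat n n" by (simp add: U_def)
  have dimw: "dim_vec (ws ! i) = n" if "i < n" for i
    using ws that by (metis carrier_vecD nth_mem subsetD)
  have ip: "ws ! j \<bullet>c ws ! i = (\<Sum>l<n. cnj (ws ! i $ l) * ws ! j $ l)" if "i < n" "j < n" for i j
    using dimw[OF that(1)] dimw[OF that(2)]
    by (auto simp: scalar_prod_def atLeast0LessThan mult.commute intro!: sum.cong)
  have "adj U * U = 1\<^sub>m n"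
  proof (rule eq_matI)
    fix i j assume "i < dim_row (1\<^sub>m n)" "j < dim_col (1\<^sub>m n)"
    then have ij: "i < n" "j < n" by auto
    have "(adj U * U) $$ (i, j) = (\<Sum>l<n. adj U $$ (i, l) * U $$ (l, j))"
      using U ij by (simp add: index_mult_sum[where n=n and m=n and k=n] del: index_mult_mat(1))
    also have "\<dots> = (\<Sum>l<n. cnj (ws ! i $ l) * ws ! j $ l) / complex_of_real (r i * r j)"
      unfolding sum_divide_distrib using ij by (intro sum.cong) (auto simp: U_def)
    also have "\<dots> = (ws ! j \<bullet>c ws ! i) / complex_of_real (r i * r j)"
      using ip[OF ij] by simp
    also have "\<dots> = 1\<^sub>m n $$ (i, j)"
      using pos[OF ij(1)] ij corthogonalD[OF ws(2), of j i] ws(3)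
      by (cases "i = j") (auto simp: power2_eq_square)
    finally show "(adj U * U) $$ (i, j) = 1\<^sub>m n $$ (i, j)" .
  qed (use U in auto)
  then have "unitary n U" using U by (rule unitaryI[rotated])
  moreover have "col U 0 = (1 / complex_of_real (r 0)) \<cdot>\<^sub>v v"
  proof -
    have "ws ! 0 = v" using hdws ws n by (metis hd_conv_nth length_0_conv)
    then show ?thesis using n v by (intro eq_vecI) (auto simp: U_def)
  qed
  ultimately show ?thesis by blast
qed

definition hermitian :: "nat \<Rightarrow> complex mat \<Rightarrow> bool" where
  "hermitian n A \<longleftrightarrow> A \<in> carrier_mat n n \<and> adj A = A"

lemma eigenvector_exists:
  fixes A :: "complex mat"
  assumes "A \<in> carrier_mat n n" "n \<noteq> 0"
  obtains v e where "v \<in> carrier_vec n" "v \<noteq> 0\<^sub>v n" "A *\<^sub>v v = e \<cdot>\<^sub>v v"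
proof -
  from assms spectrum_non_empty[OF assms(1)] obtain e where "eigenvalue A e"
    by (auto simp: spectrum_def)
  then obtain v where "eigenvector A v e" by (auto simp: eigenvalue_def)
  then show ?thesis using that assms by (auto simp: eigenvector_def)
qed

lemma unitary_conj_cancel:
  assumes U: "unitary n U" and A: "A \<in> carrier_mat n n"
  shows "U * (adj U * A * U) * adj U = A"
proof -
  have [simp]: "U \<in> carrier_mat n n" using U by (auto simp: unitary_def)
  have "U * (adj U * A * U) * adj U = (U * adj U) * A * (U * adj U)"
    using A by (simp add: assoc_square_mult[where n=n])
  then show ?thesis using U A by (simp add: unitary_def)
qed

lemma block_diag_mult:
  fixes A :: "'a :: semiring_1 mat"
  assumes "A \<in> carrier_mat a a" "C \<in> carrier_mat a a" "B \<in> carrier_mat b b" "D \<in> carrier_mat b b"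
  shows "four_block_mat A (0\<^sub>m a b) (0\<^sub>m b a) B * four_block_mat C (0\<^sub>m a b) (0\<^sub>m b a) D
    = four_block_mat (A * C) (0\<^sub>m a b) (0\<^sub>m b a) (B * D)"
  using assms
  by (subst mult_four_block_mat[where ?nr1.0=a and ?nr2.0=b and ?n1.0=a and ?n2.0=b and ?nc1.0=a and ?nc2.0=b])
    (auto simp: left_mult_zero_mat[OF assms(3)] left_mult_zero_mat[OF assms(2)] left_mult_zero_mat[OF assms(4)]
      right_mult_zero_mat[OF assms(1)] right_mult_zero_mat[OF assms(3)]
      left_add_zero_mat[where nr=a and nc=a] left_add_zero_mat[where nr=b and nc=b]
      right_add_zero_mat[where nr=a and nc=a])

text \<open>Deflation: in a basis that starts with an eigenvector the first column is zero below the
  diagonal, and hermiticity clears the first row as well. A hermitian block of size \<open>n\<close>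
  remains for the induction hypothesis.\<close>

theorem spectral_theorem:
  assumes "hermitian n A"
  shows "\<exists>U d. unitary n U \<and> A = U * diagm n d * adj U"
  using assms
proof (induction n arbitrary: A)
  case 0
  then show ?case
    by (intro exI[of _ "1\<^sub>m 0"] exI[of _ "\<lambda>_. 0"]) (auto simp: unitary_def hermitian_def intro!: eq_matI)
next
  case (Suc n)
  let ?n = "Suc n"
  have A: "A \<in> carrier_mat ?n ?n" and hA: "adj A = A" using Suc.prems by (auto simp: hermitian_def)
  obtain v e where v: "v \<in> carrier_vec ?n" "v \<noteq> 0\<^sub>v ?n" "A *\<^sub>v v = e \<cdot>\<^sub>v v"
    using eigenvector_exists[OF A] by blast
  obtain W c where W: "unitary ?n W" and colW: "col W 0 = c \<cdot>\<^sub>v v"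
    using unitary_first_column[OF v(1,2)] by blast
  have Wc[simp]: "W \<in> carrier_mat ?n ?n" using W by (simp add: unitary_def)
  define A' where "A' = adj W * A * W"
  have A': "A' \<in> carrier_mat ?n ?n" using A by (auto simp: A'_def)
  note assoc = assoc_square_mult[where n="?n"]
  have hA': "adj A' = A'" unfolding A'_def using A hA
    by (simp add: adj_mult[where n="?n" and m="?n" and k="?n"] assoc)
  have AW: "(A * W) $$ (i, 0) = e * W $$ (i, 0)" if i: "i < ?n" for i
  proof -
    have "A *\<^sub>v col W 0 = c \<cdot>\<^sub>v (e \<cdot>\<^sub>v v)"
      unfolding colW using A v by (simp add: mult_mat_vec)
    also have "\<dots> = e \<cdot>\<^sub>v col W 0" unfolding colW by (simp add: smult_smult_assoc mult.commute)
    finally have "(A *\<^sub>v col W 0) $ i = (e \<cdot>\<^sub>v col W 0) $ i" by simp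
    moreover have "(A * W) $$ (i, 0) = (A *\<^sub>v col W 0) $ i"
      using A i Wc by (metis carrier_matD(1,2) index_mult_mat(1) index_mult_mat_vec zero_less_Suc)
    moreover have "col W 0 $ i = W $$ (i, 0)" and "i < dim_vec (col W 0)"
      using i carrier_matD[OF Wc] by auto
    ultimately show ?thesis by simp
  qed
  have col0: "A' $$ (i, 0) = (if i = 0 then e else 0)" if i: "i < ?n" for i
  proof -
    have "A' $$ (i, 0) = (adj W * (A * W)) $$ (i, 0)"
      unfolding A'_def using A by (simp add: assoc)
    also have "\<dots> = (\<Sum>l<?n. adj W $$ (i, l) * (A * W) $$ (l, 0))"
      by (rule index_mult_sum) (use A i in auto)
    also have "\<dots> = (\<Sum>l<?n. e * (adj W $$ (i, l) * W $$ (l, 0)))"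
      by (rule sum.cong) (use AW in auto)
    also have "\<dots> = e * (adj W * W) $$ (i, 0)"
      unfolding sum_distrib_left[symmetric]
      by (subst index_mult_sum[where n="?n" and m="?n" and k="?n"]) (use i in auto)
    also have "adj W * W = 1\<^sub>m ?n" using W by (simp add: unitary_def)
    finally show ?thesis using i by simp
  qed
  have row0: "A' $$ (0, i) = (if i = 0 then cnj e else 0)" if i: "i < ?n" for i
  proof -
    have "A' $$ (0, i) = cnj (A' $$ (i, 0))"
      using hA' A' i by (metis adj_index carrier_matD zero_less_Suc)
    then show ?thesis using col0[OF i] by auto
  qed
  \<comment> \<open>Both descriptions of the corner entry agree, so the eigenvalue is real, as the
    real diagonal of \<open>diagm\<close> requires.\<close>
  have e_cnj: "cnj e = e" using row0[of 0] col0[of 0] by simp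
  then have e_real: "e = complex_of_real (Re e)" by (simp add: complex_eq_iff)
  define A3 where "A3 = mat n n (\<lambda>(i, j). A' $$ (Suc i, Suc j))"
  have "hermitian n A3"
  proof -
    have "cnj (A' $$ (Suc j, Suc i)) = A' $$ (Suc i, Suc j)" if "i < n" "j < n" for i j
      using hA' A' that by (metis adj_index carrier_matD Suc_less_eq)
    then show ?thesis unfolding hermitian_def A3_def by (auto intro!: eq_matI)
  qed
  from Suc.IH[OF this] obtain P d where P: "unitary n P" and A3: "A3 = P * diagm n d * adj P" by blast
  have Pc[simp]: "P \<in> carrier_mat n n" using P by (simp add: unitary_def)
  define d' where "d' = case_nat (Re e) d"
  define Q where "Q = four_block_mat (1\<^sub>m 1) (0\<^sub>m 1 n) (0\<^sub>m n 1) P"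
  have Q: "Q \<in> carrier_mat ?n ?n" unfolding Q_def using four_block_carrier_mat[of "1\<^sub>m 1" 1 1 P n n] by simp
  have adjQ: "adj Q = four_block_mat (1\<^sub>m 1) (0\<^sub>m 1 n) (0\<^sub>m n 1) (adj P)"
    using carrier_matD[OF Pc] by (intro eq_matI) (auto simp: Q_def)
  have uQ: "unitary ?n Q"
  proof (rule unitaryI[OF Q])
    have "adj Q * Q = four_block_mat (1\<^sub>m 1) (0\<^sub>m 1 n) (0\<^sub>m n 1) (adj P * P)"
      unfolding adjQ unfolding Q_def
      by (subst block_diag_mult[where a=1 and b=n]) auto
    then show "adj Q * Q = 1\<^sub>m ?n" using P by (simp add: unitary_def)
  qed
  have D': "diagm ?n d' = four_block_mat (mat 1 1 (\<lambda>_. e)) (0\<^sub>m 1 n) (0\<^sub>m n 1) (diagm n d)"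
    using e_real by (intro eq_matI) (auto simp: diagm_def d'_def split: nat.splits)
  have A'eq: "A' = four_block_mat (mat 1 1 (\<lambda>_. e)) (0\<^sub>m 1 n) (0\<^sub>m n 1) A3"
    using A' col0 row0 e_cnj by (intro eq_matI) (auto simp: A3_def)
  have "Q * diagm ?n d' * adj Q = four_block_mat (mat 1 1 (\<lambda>_. e)) (0\<^sub>m 1 n) (0\<^sub>m n 1) (P * diagm n d * adj P)"
    unfolding adjQ unfolding Q_def D'
    by (subst block_diag_mult[where a=1 and b=n], auto, subst block_diag_mult[where a="Suc 0" and b=n], auto)
  then have A'Q: "A' = Q * diagm ?n d' * adj Q" using A'eq A3 by simp
  have "A = W * A' * adj W" unfolding A'_def using unitary_conj_cancel[OF W A] by simp
  also have "\<dots> = (W * Q) * diagm ?n d' * adj (W * Q)"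
    unfolding A'Q using Q by (simp add: adj_mult[where n="?n" and m="?n" and k="?n"] assoc)
  finally show ?case using unitary_mult[OF W uQ] by blast
qed

section \<open>Positive semidefinite matrices\<close>

text \<open>The vector is a function whose values from \<open>d\<close> on are ignored. Test vectors
  supported on two labels or on one block can then be written directly.\<close>

definition qf :: "nat \<Rightarrow> complex mat \<Rightarrow> (nat \<Rightarrow> complex) \<Rightarrow> complex" where
  "qf d A v = (\<Sum>i<d. \<Sum>j<d. cnj (v i) * A $$ (i, j) * v j)"

lemma qf_cong: "(\<And>i. i < d \<Longrightarrow> v i = w i) \<Longrightarrow> qf d A v = qf d A w"
  by (auto simp: qf_def intro!: sum.cong)

lemma psd_iff_qf: "psd d A \<longleftrightarrow> A \<in> carrier_mat d d \<and> (\<forall>v. 0 \<le> qf d A v)"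
proof -
  have eq: "(A *\<^sub>v v) \<bullet>c v = qf d A (\<lambda>i. v $ i)" if "A \<in> carrier_mat d d" "v \<in> carrier_vec d" for v
    using that by (auto simp: scalar_prod_def qf_def atLeast0LessThan sum_distrib_left sum_distrib_right
        mult_ac intro!: sum.cong)
  have eq': "qf d A v = (A *\<^sub>v vec d v) \<bullet>c vec d v" if "A \<in> carrier_mat d d" for v
    using eq[OF that, of "vec d v"] by (auto intro: qf_cong)
  show ?thesis unfolding psd_def using eq eq' by (metis vec_carrier)
qed

lemma psd_carrier [intro]: "psd d A \<Longrightarrow> A \<in> carrier_mat d d"
  by (simp add: psd_def)

lemma psd_qf_nonneg: "psd d A \<Longrightarrow> 0 \<le> qf d A v"
  by (simp add: psd_iff_qf)

lemma psd_diag_nonneg: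
  assumes "psd d A" "i < d" shows "0 \<le> A $$ (i, i)"
proof -
  have "qf d A (\<lambda>k. if k = i then 1 else 0) = (\<Sum>k<d. if k = i then A $$ (i, i) else 0)"
    unfolding qf_def
  proof (rule sum.cong[OF refl])
    fix k
    have "(\<Sum>j<d. cnj (if k = i then 1 else 0) * A $$ (k, j) * (if j = i then 1 else 0))
        = (\<Sum>j<d. if j = i then (if k = i then A $$ (i, i) else 0) else 0)"
      by (rule sum.cong) auto
    then show "(\<Sum>j<d. cnj (if k = i then 1 else 0) * A $$ (k, j) * (if j = i then 1 else 0))
        = (if k = i then A $$ (i, i) else 0)" using assms(2) by simp
  qed
  then show ?thesis using psd_qf_nonneg[OF assms(1), of "\<lambda>k. if k = i then 1 else 0"] assms(2) by simp
qed

lemma qf_two_points: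
  assumes "i < d" "j < d" "i \<noteq> j"
  shows "qf d A (\<lambda>k. if k = i then 1 else if k = j then z else 0)
    = A $$ (i, i) + A $$ (i, j) * z + cnj z * A $$ (j, i) + cnj z * A $$ (j, j) * z"
proof -
  let ?v = "\<lambda>k. if k = i then 1 else if k = j then z else 0"
  have two: "(\<Sum>k<d. f k) = f i + f j" if "\<And>k. k \<noteq> i \<Longrightarrow> k \<noteq> j \<Longrightarrow> f k = 0" for f :: "nat \<Rightarrow> complex"
  proof -
    have "(\<Sum>k<d. f k) = (\<Sum>k\<in>{i, j}. f k)"
      by (rule sum.mono_neutral_right) (use assms that in auto)
    then show ?thesis using assms by simp
  qed
  have "qf d A ?v = (\<Sum>k<d. cnj (?v k) * A $$ (k, i) + cnj (?v k) * A $$ (k, j) * z)"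
    unfolding qf_def by (intro sum.cong refl, subst two) (use assms in auto)
  also have "\<dots> = A $$ (i, i) + A $$ (i, j) * z + (cnj z * A $$ (j, i) + cnj z * A $$ (j, j) * z)"
    by (subst two) (use assms in auto)
  finally show ?thesis by (simp add: add.assoc)
qed

text \<open>Nonnegativity in the order of the complex numbers includes being real. Reality of the
  form at \<open>e_i + e_j\<close> and at \<open>e_i + \<i> e_j\<close> determines the imaginary and
  the real part of the entry \<open>(i, j)\<close> from those of \<open>(j, i)\<close>.\<close>

lemma psd_hermitian:
  assumes "psd d A" shows "hermitian d A"
proof -
  have A: "A \<in> carrier_mat d d" using assms by auto
  have "cnj (A $$ (j, i)) = A $$ (i, j)" if ij: "i < d" "j < d" for i j
  proof (cases "i = j")
    case True
    then show ?thesis using psd_diag_nonneg[OF assms ij(1)]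
      by (auto simp: less_eq_complex_def complex_eq_iff)
  next
    case False
    have d: "Im (A $$ (i, i)) = 0" "Im (A $$ (j, j)) = 0"
      using psd_diag_nonneg[OF assms] ij by (auto simp: less_eq_complex_def)
    from psd_qf_nonneg[OF assms, of "\<lambda>k. if k = i then 1 else if k = j then 1 else 0"]
    have 1: "Im (A $$ (i, j)) + Im (A $$ (j, i)) = 0"
      unfolding qf_two_points[OF ij False] using d by (auto simp: less_eq_complex_def)
    from psd_qf_nonneg[OF assms, of "\<lambda>k. if k = i then 1 else if k = j then \<i> else 0"]
    have 2: "Re (A $$ (i, j)) - Re (A $$ (j, i)) = 0"
      unfolding qf_two_points[OF ij False] using d by (auto simp: less_eq_complex_def)
    show ?thesis using 1 2 by (simp add: complex_eq_iff)
  qed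
  then have "adj A = A" using A by (intro eq_matI) auto
  then show ?thesis using A by (simp add: hermitian_def)
qed

lemma psd_one [simp]: "psd d (1\<^sub>m d)"
proof -
  have "qf d (1\<^sub>m d) v = (\<Sum>i<d. cnj (v i) * v i)" for v
    unfolding qf_def
  proof (rule sum.cong[OF refl])
    fix i assume i: "i \<in> {..<d}"
    have "(\<Sum>j<d. cnj (v i) * 1\<^sub>m d $$ (i, j) * v j) = (\<Sum>j<d. if j = i then cnj (v i) * v i else 0)"
      by (rule sum.cong) (use i in auto)
    then show "(\<Sum>j<d. cnj (v i) * 1\<^sub>m d $$ (i, j) * v j) = cnj (v i) * v i" using i by simp
  qed
  moreover have "0 \<le> (\<Sum>i<d. cnj (v i) * v i)" for v :: "nat \<Rightarrow> complex"
    by (rule sum_nonneg) (simp add: less_eq_complex_def)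
  ultimately show ?thesis by (simp add: psd_iff_qf)
qed

text \<open>This is the evaluation of the form of \<open>A\<close> at the vector \<open>X v\<close>;
  after the entries are expanded, only finite sums are interchanged.\<close>

lemma qf_congruence:
  assumes A: "A \<in> carrier_mat d d" and X: "X \<in> carrier_mat d k"
  shows "qf k (adj X * A * X) v = qf d A (\<lambda>l. \<Sum>j<k. X $$ (l, j) * v j)"
proof -
  have e: "(adj X * A * X) $$ (i, j) = (\<Sum>m<d. \<Sum>l<d. cnj (X $$ (l, i)) * A $$ (l, m) * X $$ (m, j))"
    if "i < k" "j < k" for i j
  proof -
    have "(adj X * A * X) $$ (i, j) = (\<Sum>m<d. (adj X * A) $$ (i, m) * X $$ (m, j))"
      by (rule index_mult_sum) (use A X that in auto)
    also have "\<dots> = (\<Sum>m<d. (\<Sum>l<d. adj X $$ (i, l) * A $$ (l, m)) * X $$ (m, j))"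
      using A X that by (intro sum.cong refl, subst index_mult_sum[where n=k and m=d and k=d]) auto
    finally show ?thesis using X that by (simp add: sum_distrib_right)
  qed
  have "qf k (adj X * A * X) v
    = (\<Sum>i<k. \<Sum>j<k. \<Sum>m<d. \<Sum>l<d. cnj (v i) * cnj (X $$ (l, i)) * A $$ (l, m) * X $$ (m, j) * v j)"
    unfolding qf_def
    by (intro sum.cong refl) (auto simp: e sum_distrib_left sum_distrib_right mult_ac)
  also have "\<dots> = (\<Sum>i<k. \<Sum>m<d. \<Sum>j<k. \<Sum>l<d. cnj (v i) * cnj (X $$ (l, i)) * A $$ (l, m) * X $$ (m, j) * v j)"
    by (rule sum.cong[OF refl], rule sum.swap)
  also have "\<dots> = (\<Sum>m<d. \<Sum>i<k. \<Sum>j<k. \<Sum>l<d. cnj (v i) * cnj (X $$ (l, i)) * A $$ (l, m) * X $$ (m, j) * v j)"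
    by (rule sum.swap)
  also have "\<dots> = (\<Sum>m<d. \<Sum>i<k. \<Sum>l<d. \<Sum>j<k. cnj (v i) * cnj (X $$ (l, i)) * A $$ (l, m) * X $$ (m, j) * v j)"
    by (intro sum.cong[OF refl], rule sum.swap)
  also have "\<dots> = (\<Sum>m<d. \<Sum>l<d. \<Sum>i<k. \<Sum>j<k. cnj (v i) * cnj (X $$ (l, i)) * A $$ (l, m) * X $$ (m, j) * v j)"
    by (intro sum.cong[OF refl], rule sum.swap)
  also have "\<dots> = (\<Sum>l<d. \<Sum>m<d. \<Sum>i<k. \<Sum>j<k. cnj (v i) * cnj (X $$ (l, i)) * A $$ (l, m) * X $$ (m, j) * v j)"
    by (rule sum.swap)
  also have "\<dots> = qf d A (\<lambda>l. \<Sum>j<k. X $$ (l, j) * v j)"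
    unfolding qf_def
    by (intro sum.cong refl) (simp add: sum_distrib_left sum_distrib_right mult_ac)
  finally show ?thesis .
qed

lemma psd_congruence:
  assumes A: "psd d A" and X: "X \<in> carrier_mat d k"
  shows "psd k (adj X * A * X)"
proof -
  have "adj X * A * X \<in> carrier_mat k k" using assms by (auto intro!: mult_carrier_mat)
  then show ?thesis using A psd_carrier[OF A] X by (simp add: psd_iff_qf qf_congruence)
qed

lemma psd_congruence_hermitian:
  assumes "psd d A" "hermitian d X" shows "psd d (X * A * X)"
  using psd_congruence[OF assms(1), of X d] assms(2) by (simp add: hermitian_def)

lemma psd_gram_intro: "G \<in> carrier_mat d k \<Longrightarrow> psd d (G * adj G)"
  using psd_congruence[OF psd_one, of "adj G" k d] by simp

lemma qf_add:
  "A \<in> carrier_mat d d \<Longrightarrow> B \<in> carrier_mat d d \<Longrightarrow> qf d (A + B) v = qf d A v + qf d B v"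
  unfolding qf_def sum.distrib[symmetric] by (intro sum.cong refl) (simp add: algebra_simps)

lemma psd_add: "psd d A \<Longrightarrow> psd d B \<Longrightarrow> psd d (A + B)"
  using psd_carrier[of d A] psd_carrier[of d B] by (auto simp: psd_iff_qf qf_add)

lemma qf_mat_sum: "qf d (mat_sum d f I) v = (\<Sum>x\<in>I. qf d (f x) v)"
proof -
  have "qf d (mat_sum d f I) v = (\<Sum>i<d. \<Sum>j<d. \<Sum>x\<in>I. cnj (v i) * f x $$ (i, j) * v j)"
    unfolding qf_def mat_sum_def by (simp add: sum_distrib_left sum_distrib_right mult_ac)
  also have "\<dots> = (\<Sum>i<d. \<Sum>x\<in>I. \<Sum>j<d. cnj (v i) * f x $$ (i, j) * v j)"
    by (intro sum.cong[OF refl], rule sum.swap)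
  also have "\<dots> = (\<Sum>x\<in>I. \<Sum>i<d. \<Sum>j<d. cnj (v i) * f x $$ (i, j) * v j)"
    by (rule sum.swap)
  finally show ?thesis by (simp add: qf_def)
qed

lemma mat_sum_carrier [simp, intro]: "mat_sum d f I \<in> carrier_mat d d"
  by (simp add: mat_sum_def)

lemma mat_sum_index [simp]: "i < d \<Longrightarrow> j < d \<Longrightarrow> mat_sum d f I $$ (i, j) = (\<Sum>x\<in>I. f x $$ (i, j))"
  by (simp add: mat_sum_def)

lemma psd_mat_sum: "(\<And>x. x \<in> I \<Longrightarrow> psd d (f x)) \<Longrightarrow> psd d (mat_sum d f I)"
  by (auto simp: psd_iff_qf qf_mat_sum intro!: sum_nonneg)

lemma qf_smult: "A \<in> carrier_mat d d \<Longrightarrow> qf d (c \<cdot>\<^sub>m A) v = c * qf d A v"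
  unfolding qf_def sum_distrib_left by (intro sum.cong refl) auto

lemma psd_smult: "psd d A \<Longrightarrow> 0 \<le> c \<Longrightarrow> psd d (c \<cdot>\<^sub>m A)"
  using psd_carrier[of d A] by (auto simp: psd_iff_qf qf_smult)

lemma psd_zero [simp]: "psd d (0\<^sub>m d d)"
  by (simp add: psd_iff_qf qf_def)

section \<open>Traces of products and of sums of operators\<close>

lemma mtrace_mult:
  assumes "A \<in> carrier_mat n m" "B \<in> carrier_mat m n"
  shows "mtrace (A * B) = (\<Sum>i<n. \<Sum>l<m. A $$ (i, l) * B $$ (l, i))"
  using assms unfolding mtrace_def by (auto simp: index_mult_sum[OF assms] simp del: index_mult_mat(1))

lemma mtrace_comm:
  assumes "A \<in> carrier_mat n m" "B \<in> carrier_mat m n"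
  shows "mtrace (A * B) = mtrace (B * A)"
  unfolding mtrace_mult[OF assms] mtrace_mult[OF assms(2,1)]
  by (subst sum.swap) (simp add: mult.commute)

lemma mtrace_add: "A \<in> carrier_mat d d \<Longrightarrow> B \<in> carrier_mat d d \<Longrightarrow> mtrace (A + B) = mtrace A + mtrace B"
  by (simp add: mtrace_def sum.distrib)

lemma mtrace_minus: "A \<in> carrier_mat d d \<Longrightarrow> B \<in> carrier_mat d d \<Longrightarrow> mtrace (A - B) = mtrace A - mtrace B"
  by (simp add: mtrace_def sum_subtractf)

lemma mtrace_smult: "A \<in> carrier_mat d d \<Longrightarrow> mtrace (c \<cdot>\<^sub>m A) = c * mtrace A"
  by (simp add: mtrace_def sum_distrib_left)

lemma mtrace_mat_sum: "mtrace (mat_sum d f I) = (\<Sum>x\<in>I. \<Sum>i<d. f x $$ (i, i))"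
  unfolding mtrace_def by (subst sum.swap) (simp add: mat_sum_def)

lemma mtrace_mat_sum_carrier:
  "(\<And>x. x \<in> I \<Longrightarrow> f x \<in> carrier_mat d d) \<Longrightarrow> mtrace (mat_sum d f I) = (\<Sum>x\<in>I. mtrace (f x))"
  unfolding mtrace_mat_sum by (rule sum.cong) (auto simp: mtrace_def)

lemma mat_sum_mult_left:
  assumes "B \<in> carrier_mat d d" "\<And>x. x \<in> I \<Longrightarrow> f x \<in> carrier_mat d d"
  shows "mat_sum d f I * B = mat_sum d (\<lambda>x. f x * B) I"
proof (rule eq_matI)
  fix i j assume "i < dim_row (mat_sum d (\<lambda>x. f x * B) I)" "j < dim_col (mat_sum d (\<lambda>x. f x * B) I)"
  then have ij: "i < d" "j < d" by (auto simp: mat_sum_def)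
  have "(mat_sum d f I * B) $$ (i, j) = (\<Sum>l<d. mat_sum d f I $$ (i, l) * B $$ (l, j))"
    by (rule index_mult_sum) (use assms ij in auto)
  also have "\<dots> = (\<Sum>x\<in>I. \<Sum>l<d. f x $$ (i, l) * B $$ (l, j))"
    using ij by (subst sum.swap) (simp add: sum_distrib_right)
  also have "\<dots> = (\<Sum>x\<in>I. (f x * B) $$ (i, j))"
    by (rule sum.cong[OF refl], rule index_mult_sum[symmetric]) (use assms ij in auto)
  finally show "(mat_sum d f I * B) $$ (i, j) = mat_sum d (\<lambda>x. f x * B) I $$ (i, j)" using ij by simp
qed (use assms in \<open>auto simp: mat_sum_def\<close>)

lemma mat_sum_mult_right:
  assumes "B \<in> carrier_mat d d" "\<And>x. x \<in> I \<Longrightarrow> f x \<in> carrier_mat d d"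
  shows "B * mat_sum d f I = mat_sum d (\<lambda>x. B * f x) I"
proof (rule eq_matI)
  fix i j assume "i < dim_row (mat_sum d (\<lambda>x. B * f x) I)" "j < dim_col (mat_sum d (\<lambda>x. B * f x) I)"
  then have ij: "i < d" "j < d" by (auto simp: mat_sum_def)
  have "(B * mat_sum d f I) $$ (i, j) = (\<Sum>l<d. B $$ (i, l) * mat_sum d f I $$ (l, j))"
    by (rule index_mult_sum) (use assms ij in auto)
  also have "\<dots> = (\<Sum>x\<in>I. \<Sum>l<d. B $$ (i, l) * f x $$ (l, j))"
    using ij by (subst sum.swap) (simp add: sum_distrib_left)
  also have "\<dots> = (\<Sum>x\<in>I. (B * f x) $$ (i, j))"
    by (rule sum.cong[OF refl], rule index_mult_sum[symmetric]) (use assms ij in auto)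
  finally show "(B * mat_sum d f I) $$ (i, j) = mat_sum d (\<lambda>x. B * f x) I $$ (i, j)" using ij by simp
qed (use assms in \<open>auto simp: mat_sum_def\<close>)

lemma psd_mtrace_nonneg: "psd d A \<Longrightarrow> 0 \<le> mtrace A"
  using psd_carrier[of d A] by (auto simp: mtrace_def intro!: sum_nonneg psd_diag_nonneg)

section \<open>Functional calculus\<close>

text \<open>The values are attached to the index of the eigenvector and not to the eigenvalue. For a
  fixed \<open>U\<close> products are then pointwise, and the square root, pseudo-inverse and
  support projection of one operator share an eigenbasis.\<close>

definition fcalc :: "nat \<Rightarrow> complex mat \<Rightarrow> (nat \<Rightarrow> real) \<Rightarrow> complex mat" where
  "fcalc n U f = U * diagm n f * adj U"

lemma fcalc_carrier [simp]: "unitary n U \<Longrightarrow> fcalc n U f \<in> carrier_mat n n"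
  by (simp add: fcalc_def unitary_def)

lemma fcalc_mult:
  assumes U: "unitary n U"
  shows "fcalc n U f * fcalc n U g = fcalc n U (\<lambda>i. f i * g i)"
proof -
  have [simp]: "U \<in> carrier_mat n n" and UU: "adj U * U = 1\<^sub>m n" using U by (auto simp: unitary_def)
  have "fcalc n U f * fcalc n U g = U * diagm n f * ((adj U * U) * (diagm n g * adj U))"
    by (simp add: fcalc_def assoc_square_mult[where n=n])
  also have "\<dots> = U * (diagm n f * diagm n g) * adj U"
    unfolding UU by (simp add: assoc_square_mult[where n=n])
  finally show ?thesis by (simp add: fcalc_def diagm_mult)
qed

lemma fcalc_hermitian: "unitary n U \<Longrightarrow> hermitian n (fcalc n U f)"
  unfolding hermitian_def fcalc_def unitary_def
  by (simp add: adj_mult[where n=n and m=n and k=n] assoc_square_mult[where n=n])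

lemma psd_fcalc:
  assumes U: "unitary n U" and f: "\<And>i. i < n \<Longrightarrow> 0 \<le> f i"
  shows "psd n (fcalc n U f)"
proof -
  have "fcalc n U f = fcalc n U (\<lambda>i. sqrt (f i)) * adj (fcalc n U (\<lambda>i. sqrt (f i)))"
  proof -
    have "diagm n f = diagm n (\<lambda>i. sqrt (f i) * sqrt (f i))"
      using f by (intro eq_matI) (auto simp: diagm_def)
    then show ?thesis using fcalc_hermitian[OF U] by (simp add: hermitian_def fcalc_mult[OF U]) (simp add: fcalc_def)
  qed
  then show ?thesis using psd_gram_intro[OF fcalc_carrier[OF U]] by simp
qed

lemma fcalc_one: "unitary n U \<Longrightarrow> (\<And>i. i < n \<Longrightarrow> f i = 1) \<Longrightarrow> fcalc n U f = 1\<^sub>m n"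
proof -
  assume U: "unitary n U" and f: "\<And>i. i < n \<Longrightarrow> f i = 1"
  have "diagm n f = 1\<^sub>m n" using f by (intro eq_matI) (auto simp: diagm_def)
  then show ?thesis using U right_mult_one_mat[of U n n] by (simp add: fcalc_def unitary_def)
qed

lemma fcalc_minus:
  assumes "unitary n U"
  shows "fcalc n U f - fcalc n U g = fcalc n U (\<lambda>i. f i - g i)"
proof -
  have [simp]: "U \<in> carrier_mat n n" using assms by (simp add: unitary_def)
  have "diagm n (\<lambda>i. f i - g i) = diagm n f - diagm n g"
    by (rule eq_matI) (auto simp: diagm_def)
  then show ?thesis unfolding fcalc_def
    by (simp add: mult_minus_distrib_mat[where nr=n and n=n and nc=n] minus_mult_distrib_mat[where nr=n and n=n and nc=n])
qed

lemma hermitian_fcalc: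
  assumes "hermitian n A"
  obtains U d where "unitary n U" "A = fcalc n U d"
  using spectral_theorem[OF assms] by (auto simp: fcalc_def)

text \<open>The values of a diagonalisation are recovered as quadratic forms at the columns of
  \<open>U\<close>; \<open>psd_fcalcD\<close> uses this to pass from a positive operator to
  nonnegative values.\<close>

lemma fcalc_eigenvalue:
  assumes U: "unitary n U" and i: "i < n"
  shows "fcalc n U d *\<^sub>v col U i = complex_of_real (d i) \<cdot>\<^sub>v col U i"
    and "(fcalc n U d *\<^sub>v col U i) \<bullet>c col U i = complex_of_real (d i)"
    and "col U i \<bullet>c col U i = 1"
proof -
  have [simp]: "U \<in> carrier_mat n n" and UU: "adj U * U = 1\<^sub>m n" using U by (auto simp: unitary_def)
  have "fcalc n U d * U = U * diagm n d * (adj U * U)"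
    by (simp add: fcalc_def assoc_square_mult[where n=n])
  also have "\<dots> = U * diagm n d" unfolding UU by simp
  finally have eq: "fcalc n U d * U = U * diagm n d" .
  have "fcalc n U d *\<^sub>v col U i = col (fcalc n U d * U) i"
    using U i by (subst col_mult2[where nr=n and n=n and nc=n]) auto
  also have "\<dots> = complex_of_real (d i) \<cdot>\<^sub>v col U i" unfolding eq
  proof (rule eq_vecI)
    fix l assume "l < dim_vec (complex_of_real (d i) \<cdot>\<^sub>v col U i)"
    then have l: "l < n" using carrier_matD[of U n n] by simp
    have "(U * diagm n d) $$ (l, i) = (\<Sum>m<n. U $$ (l, m) * diagm n d $$ (m, i))"
      by (rule index_mult_sum) (use l i in auto)
    also have "\<dots> = (\<Sum>m<n. if m = i then U $$ (l, i) * complex_of_real (d i) else 0)"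
      by (rule sum.cong) (use i in \<open>auto simp: diagm_def\<close>)
    also have "\<dots> = U $$ (l, i) * complex_of_real (d i)" using i by simp
    finally show "col (U * diagm n d) i $ l = (complex_of_real (d i) \<cdot>\<^sub>v col U i) $ l"
      using l i carrier_matD[of U n n] by (simp add: mult.commute del: index_mult_mat(1))
  qed (use i carrier_matD[of U n n] in auto)
  finally show ev: "fcalc n U d *\<^sub>v col U i = complex_of_real (d i) \<cdot>\<^sub>v col U i" .
  have "col U i \<bullet>c col U i = (adj U * U) $$ (i, i)"
    using i carrier_matD[of U n n] by (subst index_mult_sum[where n=n and m=n and k=n])
      (auto simp: scalar_prod_def atLeast0LessThan mult.commute intro!: sum.cong)
  then show n1: "col U i \<bullet>c col U i = 1" using UU i by simp
  show "(fcalc n U d *\<^sub>v col U i) \<bullet>c col U i = complex_of_real (d i)"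
    unfolding ev using n1 carrier_matD[of U n n] i by (simp add: smult_scalar_prod_distrib[where n=n])
qed

lemma psd_fcalcD:
  assumes U: "unitary n U" and "psd n (fcalc n U d)" and i: "i < n"
  shows "0 \<le> d i"
proof -
  have "col U i \<in> carrier_vec n" using U(1) by (auto simp: unitary_def)
  then have "0 \<le> complex_of_real (d i)"
    using assms(2) fcalc_eigenvalue(2)[OF U i, of d] unfolding psd_def by metis
  then show ?thesis by (simp add: less_eq_complex_def)
qed

lemma psd_fcalcE:
  assumes "psd n A"
  obtains U d where "unitary n U" "A = fcalc n U d" "\<And>i. i < n \<Longrightarrow> 0 \<le> d i"
  using hermitian_fcalc[OF psd_hermitian[OF assms]] psd_fcalcD assms by metis

lemma psd_gram:
  assumes "psd n A" obtains G where "G \<in> carrier_mat n n" "A = G * adj G"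
proof -
  from psd_fcalcE[OF assms] obtain U d where U: "unitary n U" "A = fcalc n U d" "\<And>i. i < n \<Longrightarrow> 0 \<le> d i" by blast
  let ?G = "fcalc n U (\<lambda>i. sqrt (d i))"
  have "diagm n (\<lambda>i. sqrt (d i) * sqrt (d i)) = diagm n d"
    using U(3) by (intro eq_matI) (auto simp: diagm_def)
  then have "?G * adj ?G = A"
    using fcalc_hermitian[OF U(1)] by (simp add: hermitian_def fcalc_mult[OF U(1)] U(2)) (simp add: fcalc_def)
  then show ?thesis using that fcalc_carrier[OF U(1)] by metis
qed

text \<open>The product itself need not be positive, but by cyclicity its trace is that of the
  congruence \<open>adj G * B * G\<close>.\<close>

lemma mtrace_psd_mult_nonneg:
  assumes "psd d A" "psd d B" shows "0 \<le> mtrace (A * B)"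
proof -
  from psd_gram[OF assms(1)] obtain G where G: "G \<in> carrier_mat d d" "A = G * adj G" .
  have B: "B \<in> carrier_mat d d" using assms by auto
  have "mtrace (A * B) = mtrace (G * (adj G * B))" using G B by (simp add: assoc_square_mult[where n=d])
  also have "\<dots> = mtrace (adj G * B * G)" using G B by (intro mtrace_comm) auto
  also have "0 \<le> \<dots>" using psd_mtrace_nonneg[OF psd_congruence[OF assms(2) G(1)]] .
  finally show ?thesis .
qed

section \<open>The Hayashi--Nagaoka inequality\<close>

lemma index_mult_diagm:
  assumes "A \<in> carrier_mat n n" "i < n" "j < n"
  shows "(A * diagm n d) $$ (i, j) = A $$ (i, j) * complex_of_real (d j)"
    and "(diagm n d * A) $$ (i, j) = complex_of_real (d i) * A $$ (i, j)"
proof -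
  have "(A * diagm n d) $$ (i, j) = (\<Sum>l<n. A $$ (i, l) * diagm n d $$ (l, j))"
    by (rule index_mult_sum) (use assms in auto)
  also have "\<dots> = (\<Sum>l<n. if l = j then A $$ (i, j) * complex_of_real (d j) else 0)"
    by (rule sum.cong) (use assms in \<open>auto simp: diagm_def\<close>)
  finally show "(A * diagm n d) $$ (i, j) = A $$ (i, j) * complex_of_real (d j)" using assms by simp
  have "(diagm n d * A) $$ (i, j) = (\<Sum>l<n. diagm n d $$ (i, l) * A $$ (l, j))"
    by (rule index_mult_sum) (use assms in auto)
  also have "\<dots> = (\<Sum>l<n. if l = i then complex_of_real (d i) * A $$ (i, j) else 0)"
    by (rule sum.cong) (use assms in \<open>auto simp: diagm_def\<close>)
  finally show "(diagm n d * A) $$ (i, j) = complex_of_real (d i) * A $$ (i, j)" using assms by simp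
qed

lemma unitary_conj_mult:
  assumes V: "unitary n V" and "A \<in> carrier_mat n n" "B \<in> carrier_mat n n"
  shows "adj V * (A * B) * V = (adj V * A * V) * (adj V * B * V)"
proof -
  have [simp]: "V \<in> carrier_mat n n" and VV: "V * adj V = 1\<^sub>m n" using V by (auto simp: unitary_def)
  have "(adj V * A * V) * (adj V * B * V) = adj V * A * ((V * adj V) * (B * V))"
    using assms by (simp add: assoc_square_mult[where n=n])
  also have "\<dots> = adj V * (A * B) * V"
    unfolding VV using assms left_mult_one_mat[of "B * V" n n] by (simp add: assoc_square_mult[where n=n])
  finally show ?thesis by simp
qed

lemma conj_minus:
  fixes A :: "complex mat"
  assumes "V \<in> carrier_mat n n" "W \<in> carrier_mat n n" "A \<in> carrier_mat n n" "B \<in> carrier_mat n n"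
  shows "W * (A - B) * V = W * A * V - W * B * V"
  using mult_minus_distrib_mat[OF assms(2-4)] minus_mult_distrib_mat[of "W * A" n n "W * B" V n] assms
  by (simp del: assoc_mult_mat)

text \<open>An eigenvector of \<open>B - T\<close> with a negative eigenvalue would violate \<open>T\<^sup>2 \<le> B\<^sup>2\<close>.\<close>

lemma psd_sqrt_mono:
  assumes B: "psd n B" and T: "psd n T" and le: "psd n (B * B - T * T)"
  shows "psd n (B - T)"
proof -
  have Bc[simp]: "B \<in> carrier_mat n n" and Tc[simp]: "T \<in> carrier_mat n n" using B T by auto
  have "adj (B - T) = B - T"
    using psd_hermitian[OF B] psd_hermitian[OF T] carrier_matD[OF Bc] carrier_matD[OF Tc]
    unfolding hermitian_def
    by (intro eq_matI) (auto, metis adj_index)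
  then have "hermitian n (B - T)" by (simp add: hermitian_def)
  from hermitian_fcalc[OF this] obtain V e where V: "unitary n V" and eq: "B - T = fcalc n V e" .
  have Vc[simp]: "V \<in> carrier_mat n n" and VV: "adj V * V = 1\<^sub>m n" using V by (auto simp: unitary_def)
  define B' where "B' = adj V * B * V"
  define T' where "T' = adj V * T * V"
  have B'[simp]: "B' \<in> carrier_mat n n" and T'[simp]: "T' \<in> carrier_mat n n" by (auto simp: B'_def T'_def)
  have "B' - T' = adj V * fcalc n V e * V" unfolding eq[symmetric] B'_def T'_def by (simp add: conj_minus[where n=n])
  also have "\<dots> = (adj V * V) * diagm n e * (adj V * V)"
    by (simp add: fcalc_def assoc_square_mult[where n=n])
  also have "\<dots> = diagm n e" unfolding VV by simp
  finally have BT: "B' - T' = diagm n e" .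
  have T'eq: "T' = B' - diagm n e" unfolding BT[symmetric] using carrier_matD[OF B'] carrier_matD[OF T'] by (intro eq_matI) auto
  have "psd n (adj V * (B * B - T * T) * V)" by (rule psd_congruence[OF le]) simp
  also have "adj V * (B * B - T * T) * V = B' * B' - T' * T'"
    using unitary_conj_mult[OF V, of B B] unitary_conj_mult[OF V, of T T]
    by (simp add: conj_minus[where n=n] B'_def T'_def)
  finally have psd': "psd n (B' * B' - T' * T')" .
  have B'psd: "psd n B'" unfolding B'_def by (rule psd_congruence[OF B]) simp
  have "0 \<le> e i" if i: "i < n" for i
  proof (rule ccontr)
    assume neg: "\<not> 0 \<le> e i"
    have diagm_entry: "diagm n e $$ (i, i) = complex_of_real (e i)" using i by (simp add: diagm_def)
    \<comment> \<open>In the eigenbasis of \<open>B - T\<close> the operator \<open>T'\<close> is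
      \<open>B'\<close> minus a diagonal matrix. The diagonal entry of
      \<open>B' * B' - T' * T'\<close> is therefore \<open>2 e B'_ii - e^2\<close>, negative for
      \<open>e < 0\<close>. Only one entry is inspected, so \<open>B\<close> and \<open>T\<close>
      may fail to commute.\<close>
    have "T' * T' = (B' - diagm n e) * B' - (B' - diagm n e) * diagm n e"
      unfolding T'eq[symmetric] using mult_minus_distrib_mat[OF T' B' diagm_carrier, of e] T'eq by simp
    also have "\<dots> = (B' * B' - diagm n e * B') - (B' * diagm n e - diagm n e * diagm n e)"
      by (simp add: minus_mult_distrib_mat[where nr=n and n=n and nc=n])
    finally have "(B' * B' - T' * T') $$ (i, i) = 2 * complex_of_real (e i) * B' $$ (i, i) - complex_of_real (e i * e i)"
      using i carrier_matD[OF B'] index_mult_diagm[OF B' i i] index_mult_diagm[OF diagm_carrier i i]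
        diagm_entry by (simp del: index_mult_mat(1))
    then have "0 \<le> 2 * complex_of_real (e i) * B' $$ (i, i) - complex_of_real (e i * e i)"
      using psd_diag_nonneg[OF psd' i] by simp
    moreover have "0 \<le> Re (B' $$ (i, i))" using psd_diag_nonneg[OF B'psd i] by (simp add: less_eq_complex_def)
    ultimately have "0 \<le> 2 * e i * Re (B' $$ (i, i)) - e i * e i" by (simp add: less_eq_complex_def)
    moreover have "e i * Re (B' $$ (i, i)) \<le> 0" using neg \<open>0 \<le> Re (B' $$ (i, i))\<close> by (simp add: mult_nonpos_nonneg)
    moreover have "0 < e i * e i" using neg by (simp add: mult_neg_neg)
    ultimately show False by simp
  qed
  then show ?thesis unfolding eq by (rule psd_fcalc[OF V])
qed

text \<open>With the shifts expanded, the identity in \<open>hayashi_nagaoka\<close> is linear in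
  the entries of a few fixed products and can be checked entrywise.\<close>

lemma shifted_congruence:
  fixes Y X :: "complex mat"
  assumes [simp]: "Y \<in> carrier_mat n n" "X \<in> carrier_mat n n"
  shows "(Y - c \<cdot>\<^sub>m 1\<^sub>m n) * X * (Y - c \<cdot>\<^sub>m 1\<^sub>m n)
    = Y * X * Y - c \<cdot>\<^sub>m (Y * X) - (c \<cdot>\<^sub>m (X * Y) - (c * c) \<cdot>\<^sub>m X)"
proof -
  have 1: "(Y - c \<cdot>\<^sub>m 1\<^sub>m n) * X = Y * X - c \<cdot>\<^sub>m X"
    using left_mult_one_mat[of X n n]
    by (simp add: mult_smult_assoc_mat[where nr=n and n=n and nc=n] minus_mult_distrib_mat[where nr=n and n=n and nc=n])
  have "(Y * X - c \<cdot>\<^sub>m X) * (Y - c \<cdot>\<^sub>m 1\<^sub>m n) = (Y * X - c \<cdot>\<^sub>m X) * Y - c \<cdot>\<^sub>m (Y * X - c \<cdot>\<^sub>m X)"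
    using right_mult_one_mat[of "Y * X - c \<cdot>\<^sub>m X" n n]
    by (simp add: mult_minus_distrib_mat[where nr=n and n=n and nc=n] mult_smult_distrib[where nr=n and n=n and nc=n])
  also have "(Y * X - c \<cdot>\<^sub>m X) * Y = Y * X * Y - c \<cdot>\<^sub>m (X * Y)"
    by (simp add: minus_mult_distrib_mat[where nr=n and n=n and nc=n] mult_smult_assoc_mat[where nr=n and n=n and nc=n])
  finally show ?thesis unfolding 1
    using carrier_matD[OF assms(1)] carrier_matD[OF assms(2)]
    by (intro eq_matI) (auto simp: algebra_simps simp del: index_mult_mat(1))
qed

lemma hermitian_shift:
  assumes "hermitian n Y" shows "hermitian n (Y - complex_of_real c \<cdot>\<^sub>m 1\<^sub>m n)"
proof -
  have Y: "Y \<in> carrier_mat n n" "adj Y = Y" using assms by (auto simp: hermitian_def)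
  have "cnj (Y $$ (j, i)) = Y $$ (i, j)" if "i < n" "j < n" for i j
    using Y that by (metis adj_index carrier_matD)
  then show ?thesis using Y carrier_matD[OF Y(1)] unfolding hermitian_def by (auto intro!: eq_matI)
qed

text \<open>
  With \<open>S = T + Z\<close>, \<open>B = \<surd>S\<close>, \<open>Y\<close> the pseudo-inverse of \<open>B\<close> and \<open>P\<close> the
  projection onto the support of \<open>S\<close>, the difference of the two sides is
  \<open>(1 - P) + 4 (B - T) + 2 (Y - 1) T (Y - 1) + (Y - 2) Z (Y - 2)\<close>, where \<open>B \<ge> T\<close> because \<open>S \<ge> T \<ge> T\<^sup>2\<close>.
\<close>

lemma hayashi_nagaoka:
  fixes S :: "complex mat"
  assumes U: "unitary n U" and S: "S = fcalc n U d" and d: "\<And>i. i < n \<Longrightarrow> 0 \<le> d i"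
    and T: "psd n T" and T1: "psd n (1\<^sub>m n - T)" and Z: "psd n (S - T)"
  defines "Y \<equiv> fcalc n U (\<lambda>i. if d i = 0 then 0 else 1 / sqrt (d i))"
  shows "psd n (2 \<cdot>\<^sub>m (1\<^sub>m n - T) + 4 \<cdot>\<^sub>m (S - T) - (1\<^sub>m n - Y * T * Y))"
proof -
  define B where "B = fcalc n U (\<lambda>i. sqrt (d i))"
  define P where "P = fcalc n U (\<lambda>i. if d i = 0 then 0 else 1)"
  have car: "S \<in> carrier_mat n n" "T \<in> carrier_mat n n" "Y \<in> carrier_mat n n" "B \<in> carrier_mat n n" "P \<in> carrier_mat n n"
    using U T by (auto simp: S B_def P_def Y_def)
  note [simp] = car
  have fcong: "fcalc n U f = fcalc n U g" if "\<And>i. i < n \<Longrightarrow> f i = g i" for f g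
  proof -
    have "diagm n f = diagm n g" using that by (intro eq_matI) (auto simp: diagm_def)
    then show ?thesis by (simp add: fcalc_def)
  qed
  have BB: "B * B = S" unfolding B_def S fcalc_mult[OF U] by (rule fcong) (use d in auto)
  have YS: "Y * S = B" unfolding B_def S Y_def fcalc_mult[OF U]
    by (rule fcong) (use d in \<open>auto simp: field_simps\<close>)
  have SY: "S * Y = B" unfolding B_def S Y_def fcalc_mult[OF U]
    by (rule fcong) (use d in \<open>auto simp: field_simps\<close>)
  have BY: "B * Y = P" unfolding B_def P_def Y_def fcalc_mult[OF U] by (rule fcong) (use d in auto)
  have hY: "hermitian n Y" unfolding Y_def by (rule fcalc_hermitian[OF U])
  have psdB: "psd n B" unfolding B_def using d by (intro psd_fcalc[OF U]) auto
  have psdP: "psd n (1\<^sub>m n - P)"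
  proof -
    have "1\<^sub>m n - P = fcalc n U (\<lambda>i. 1 - (if d i = 0 then 0 else 1))"
      unfolding P_def fcalc_minus[OF U, symmetric] by (simp add: fcalc_one[OF U])
    then show ?thesis by (auto intro: psd_fcalc[OF U])
  qed
  have "psd n (B * B - T * T)"
  proof -
    from psd_fcalcE[OF T] obtain V t where V: "unitary n V" and Tt: "T = fcalc n V t"
      and t0: "\<And>i. i < n \<Longrightarrow> 0 \<le> t i" by blast
    have "1\<^sub>m n - T = fcalc n V (\<lambda>i. 1 - t i)"
      unfolding Tt fcalc_minus[OF V, symmetric] by (simp add: fcalc_one[OF V])
    then have t1: "t i \<le> 1" if "i < n" for i
      using psd_fcalcD[OF V _ that, of "\<lambda>i. 1 - t i"] T1 by simp
    have "T - T * T = fcalc n V (\<lambda>i. t i - t i * t i)"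
      unfolding Tt fcalc_mult[OF V] fcalc_minus[OF V] ..
    moreover have "psd n \<dots>"
      using t0 t1 by (intro psd_fcalc[OF V]) (auto simp: mult_left_le)
    ultimately have TT: "psd n (T - T * T)" by simp
    have "B * B - T * T = (S - T) + (T - T * T)" unfolding BB
      using carrier_matD[OF car(1)] carrier_matD[OF car(2)] by (intro eq_matI) (auto simp del: index_mult_mat(1))
    then show ?thesis using psd_add[OF Z TT] by simp
  qed
  then have BT: "psd n (B - T)" by (rule psd_sqrt_mono[OF psdB T])
  have 1: "psd n ((Y - 1 \<cdot>\<^sub>m 1\<^sub>m n) * T * (Y - 1 \<cdot>\<^sub>m 1\<^sub>m n))"
    using psd_congruence_hermitian[OF T hermitian_shift[OF hY, of 1]] by simp
  have 2: "psd n ((Y - 2 \<cdot>\<^sub>m 1\<^sub>m n) * (S - T) * (Y - 2 \<cdot>\<^sub>m 1\<^sub>m n))"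
    using psd_congruence_hermitian[OF Z hermitian_shift[OF hY, of 2]] by simp
  have YZ: "Y * (S - T) = B - Y * T" "(S - T) * Y = B - T * Y"
    using mult_minus_distrib_mat[OF car(3,1,2)] minus_mult_distrib_mat[OF car(1,2,3)] YS SY by simp_all
  have YZY: "Y * (S - T) * Y = P - Y * T * Y"
    unfolding YZ(1) using minus_mult_distrib_mat[of B n n "Y * T" Y n] BY by simp
  have ZZ[simp]: "S - T \<in> carrier_mat n n" using car by auto
  \<comment> \<open>The shifts 1 and 2 with the weights 2 and 1 make the terms \<open>Y * T\<close>
    and \<open>T * Y\<close> cancel. They leave \<open>- 4 B\<close>, because
    \<open>Y * (S - T) = B - Y * T\<close>; the summand \<open>4 (B - T)\<close> compensates this,
    and \<open>1 - P\<close> completes \<open>P\<close> to the identity.\<close>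
  have "2 \<cdot>\<^sub>m (1\<^sub>m n - T) + 4 \<cdot>\<^sub>m (S - T) - (1\<^sub>m n - Y * T * Y)
    = (1\<^sub>m n - P) + 4 \<cdot>\<^sub>m (B - T) + 2 \<cdot>\<^sub>m ((Y - 1 \<cdot>\<^sub>m 1\<^sub>m n) * T * (Y - 1 \<cdot>\<^sub>m 1\<^sub>m n))
      + (Y - 2 \<cdot>\<^sub>m 1\<^sub>m n) * (S - T) * (Y - 2 \<cdot>\<^sub>m 1\<^sub>m n)"
    unfolding shifted_congruence[OF car(3,2)] shifted_congruence[OF car(3) ZZ] unfolding YZY unfolding YZ
    using carrier_matD[OF car(1)] carrier_matD[OF car(2)] carrier_matD[OF car(3)] carrier_matD[OF car(4)] carrier_matD[OF car(5)]
    by (intro eq_matI) (auto simp: algebra_simps simp del: index_mult_mat(1))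
  moreover have "psd n \<dots>"
    by (intro psd_add psd_smult psdP BT 1 2) (auto simp: less_eq_complex_def)
  ultimately show ?thesis by simp
qed

text \<open>The operators \<open>Y * T m * Y\<close> add up to the support projection
  \<open>P\<close> only. The defect \<open>1 - P\<close> is given to outcome 0, which exists since
  \<open>0 < M\<close>; enlarging the operator of an outcome can only lower its error, so the
  Hayashi--Nagaoka bound survives.\<close>

lemma square_root_povm:
  fixes M :: nat
  assumes M: "0 < M" and T: "\<And>m. m < M \<Longrightarrow> psd d (T m)" and T1: "\<And>m. m < M \<Longrightarrow> psd d (1\<^sub>m d - T m)"
  obtains L where "povm d {..<M} L"
    and "\<And>m \<rho>. m < M \<Longrightarrow> psd d \<rho> \<Longrightarrow> Re (mtrace ((1\<^sub>m d - L m) * \<rho>))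
      \<le> 2 * Re (mtrace ((1\<^sub>m d - T m) * \<rho>)) + 4 * (\<Sum>k\<in>{..<M} - {m}. Re (mtrace (T k * \<rho>)))"
proof -
  define S where "S = mat_sum d T {..<M}"
  have psdS: "psd d S" unfolding S_def by (rule psd_mat_sum) (use T in auto)
  from psd_fcalcE[OF psdS] obtain U e where U: "unitary d U" and Se: "S = fcalc d U e"
    and e: "\<And>i. i < d \<Longrightarrow> 0 \<le> e i" by blast
  define Y where "Y = fcalc d U (\<lambda>i. if e i = 0 then 0 else 1 / sqrt (e i))"
  define P where "P = fcalc d U (\<lambda>i. if e i = 0 then 0 else 1)"
  have Y: "Y \<in> carrier_mat d d" and P: "P \<in> carrier_mat d d" using U by (auto simp: Y_def P_def)
  have hY: "hermitian d Y" unfolding Y_def by (rule fcalc_hermitian[OF U])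
  have Tc: "T m \<in> carrier_mat d d" if "m < M" for m using T[OF that] by auto
  have YSY: "Y * S * Y = P"
  proof -
    have "diagm d (\<lambda>i. (if e i = 0 then 0 else 1 / sqrt (e i)) * e i * (if e i = 0 then 0 else 1 / sqrt (e i)))
      = diagm d (\<lambda>i. if e i = 0 then 0 else 1)"
      using e by (intro eq_matI) (auto simp: diagm_def field_simps simp flip: of_real_mult)
    then show ?thesis unfolding Y_def Se P_def fcalc_mult[OF U] by (simp add: fcalc_def)
  qed
  have psdP: "psd d (1\<^sub>m d - P)"
  proof -
    have "1\<^sub>m d - P = fcalc d U (\<lambda>i. 1 - (if e i = 0 then 0 else 1))"
      unfolding P_def fcalc_minus[OF U, symmetric] by (simp add: fcalc_one[OF U])
    then show ?thesis by (auto intro: psd_fcalc[OF U])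
  qed
  define L where "L m = Y * T m * Y + (if m = 0 then 1\<^sub>m d - P else 0\<^sub>m d d)" for m
  have psdYT: "psd d (Y * T m * Y)" if "m < M" for m
    by (rule psd_congruence_hermitian[OF T[OF that] hY])
  have sumYT: "mat_sum d (\<lambda>m. Y * T m * Y) {..<M} = P"
  proof -
    have "Y * S * Y = mat_sum d (\<lambda>m. Y * T m) {..<M} * Y"
      unfolding S_def using Y Tc by (subst mat_sum_mult_right) auto
    also have "\<dots> = mat_sum d (\<lambda>m. Y * T m * Y) {..<M}"
      using Y Tc by (subst mat_sum_mult_left) auto
    finally show ?thesis using YSY by simp
  qed
  have "povm d {..<M} L" unfolding povm_def
  proof
    show "\<forall>m\<in>{..<M}. psd d (L m)"
      unfolding L_def by (auto intro!: psd_add psdYT psdP)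
    show "mat_sum d L {..<M} = 1\<^sub>m d"
    proof (rule eq_matI)
      fix i j assume "i < dim_row (1\<^sub>m d)" "j < dim_col (1\<^sub>m d)"
      then have ij: "i < d" "j < d" by auto
      have "mat_sum d L {..<M} $$ (i, j) = (\<Sum>m<M. (Y * T m * Y) $$ (i, j) + (if m = 0 then (1\<^sub>m d - P) $$ (i, j) else 0))"
        unfolding mat_sum_index[OF ij]
        by (rule sum.cong[OF refl]) (use ij P Y in \<open>auto simp: L_def simp del: index_mult_mat(1)\<close>)
      also have "\<dots> = mat_sum d (\<lambda>m. Y * T m * Y) {..<M} $$ (i, j) + (1\<^sub>m d - P) $$ (i, j)"
        using ij M by (simp add: sum.distrib del: index_mult_mat(1) index_minus_mat(1))
      also have "\<dots> = 1\<^sub>m d $$ (i, j)" unfolding sumYT using ij P by simp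
      finally show "mat_sum d L {..<M} $$ (i, j) = 1\<^sub>m d $$ (i, j)" .
    qed (auto simp: mat_sum_def)
  qed
  moreover have "Re (mtrace ((1\<^sub>m d - L m) * \<rho>))
      \<le> 2 * Re (mtrace ((1\<^sub>m d - T m) * \<rho>)) + 4 * (\<Sum>k\<in>{..<M} - {m}. Re (mtrace (T k * \<rho>)))"
    if m: "m < M" and \<rho>: "psd d \<rho>" for m \<rho>
  proof -
    have \<rho>c: "\<rho> \<in> carrier_mat d d" using \<rho> by auto
    have Tm: "T m \<in> carrier_mat d d" by (rule Tc[OF m])
    have Sc: "S \<in> carrier_mat d d" using psdS by auto
    \<comment> \<open>All competitors of \<open>m\<close> together are the operator
      \<open>S - T m\<close> of \<open>hayashi_nagaoka\<close>; linearity of the trace splits it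
      again into single tests.\<close>
    define Z where "Z = mat_sum d T ({..<M} - {m})"
    have ZS: "S - T m = Z"
      unfolding S_def Z_def using Tm m
      by (intro eq_matI) (auto simp: mat_sum_def sum_diff1)
    have psdZ: "psd d Z" unfolding Z_def by (rule psd_mat_sum) (use T in auto)
    then have Zc: "Z \<in> carrier_mat d d" by auto
    have "psd d (2 \<cdot>\<^sub>m (1\<^sub>m d - T m) + 4 \<cdot>\<^sub>m (S - T m) - (1\<^sub>m d - Y * T m * Y))"
      unfolding Y_def by (rule hayashi_nagaoka[OF U Se e T[OF m] T1[OF m]]) (use psdZ ZS in auto)
    from mtrace_psd_mult_nonneg[OF this \<rho>]
    have hn: "0 \<le> mtrace ((2 \<cdot>\<^sub>m (1\<^sub>m d - T m) + 4 \<cdot>\<^sub>m Z - (1\<^sub>m d - Y * T m * Y)) * \<rho>)"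
      unfolding ZS .
    have YTY: "Y * T m * Y \<in> carrier_mat d d" using Y Tm by auto
    have lin: "mtrace ((2 \<cdot>\<^sub>m (1\<^sub>m d - T m) + 4 \<cdot>\<^sub>m Z - (1\<^sub>m d - Y * T m * Y)) * \<rho>)
      = 2 * mtrace ((1\<^sub>m d - T m) * \<rho>) + 4 * mtrace (Z * \<rho>) - mtrace ((1\<^sub>m d - Y * T m * Y) * \<rho>)"
      using Tm Zc YTY \<rho>c
      by (simp add: minus_mult_distrib_mat[of _ d d _ _ d] add_mult_distrib_mat[of _ d d _ _ d]
          mult_smult_assoc_mat[of _ d d _ d] mtrace_add[of _ d] mtrace_minus[of _ d] mtrace_smult[of _ d]
          del: assoc_mult_mat)
    have Ztr: "mtrace (Z * \<rho>) = (\<Sum>k\<in>{..<M} - {m}. mtrace (T k * \<rho>))"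
      unfolding Z_def using Tc \<rho>c
      by (subst mat_sum_mult_left) (auto intro!: mtrace_mat_sum_carrier)
    have "Re (mtrace ((1\<^sub>m d - L m) * \<rho>)) \<le> Re (mtrace ((1\<^sub>m d - Y * T m * Y) * \<rho>))"
    proof (cases "m = 0")
      case True
      have "1\<^sub>m d - L m = (1\<^sub>m d - Y * T m * Y) - (1\<^sub>m d - P)"
        unfolding L_def using True carrier_matD[OF Y] carrier_matD[OF P] by (intro eq_matI) (auto simp del: index_mult_mat(1))
      then have "mtrace ((1\<^sub>m d - L m) * \<rho>) = mtrace ((1\<^sub>m d - Y * T m * Y) * \<rho>) - mtrace ((1\<^sub>m d - P) * \<rho>)"
        using YTY P \<rho>c minus_mult_distrib_mat[of "1\<^sub>m d - Y * T m * Y" d d "1\<^sub>m d - P" \<rho> d]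
        by (simp add: mtrace_minus[of _ d] del: assoc_mult_mat)
      then show ?thesis using mtrace_psd_mult_nonneg[OF psdP \<rho>] by (simp add: less_eq_complex_def)
    next
      case False
      then have "L m = Y * T m * Y" unfolding L_def using YTY by simp
      then show ?thesis by simp
    qed
    with hn[unfolded lin] Ztr show ?thesis by (simp add: less_eq_complex_def)
  qed
  ultimately show ?thesis using that by blast
qed

section \<open>Random codebooks\<close>

lemma map_Pi_pmf_pair:
  assumes "finite A" "i \<in> A" "j \<in> A" "i \<noteq> j"
  shows "map_pmf (\<lambda>f. (f i, f j)) (Pi_pmf A d p) = pair_pmf (p i) (p j)"
proof -
  have A: "A = insert i (A - {i})" using assms by auto
  have "map_pmf (\<lambda>f. (f i, f j)) (Pi_pmf A d p)
      = map_pmf (\<lambda>(y, f). (y, f j)) (pair_pmf (p i) (Pi_pmf (A - {i}) d p))"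
    using assms by (subst A, subst Pi_pmf_insert) (auto simp: pmf.map_comp o_def case_prod_unfold)
  also have "\<dots> = pair_pmf (p i) (map_pmf (\<lambda>f. f j) (Pi_pmf (A - {i}) d p))"
    using map_pair[of "\<lambda>x. x" "\<lambda>f. f j" "p i" "Pi_pmf (A - {i}) d p"] by (simp add: map_pmf_ident)
  also have "\<dots> = pair_pmf (p i) (p j)"
    using assms by (simp add: Pi_pmf_component)
  finally show ?thesis .
qed

text \<open>The result is again a law of pairs, concentrated on those with second component
  \<open>y\<close>. The conditioning is meaningful only for \<open>y\<close> in the support of the
  second marginal, whence the support assumptions below.\<close>

definition cond2 :: "('a \<times> 'b) pmf \<Rightarrow> 'b \<Rightarrow> ('a \<times> 'b) pmf" where
  "cond2 p y = cond_pmf p {z. snd z = y}"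

lemma set_cond2:
  assumes "y \<in> set_pmf (map_pmf snd p)"
  shows "set_pmf (cond2 p y) = set_pmf p \<inter> {z. snd z = y}"
  unfolding cond2_def using assms by (subst set_cond_pmf) auto

lemma bind_cond2: "bind_pmf (map_pmf snd p) (cond2 p) = p"
  unfolding cond2_def
proof (rule bind_cond_pmf_cancel[where R="\<lambda>y z. snd z = y"])
  fix y z assume "y \<in> set_pmf (map_pmf snd p)" "z \<in> set_pmf p" "snd z = y"
  then show "measure (measure_pmf p) {z. snd z = y} = measure (measure_pmf (map_pmf snd p)) {x. snd z = x}"
    by (auto simp: vimage_def intro!: arg_cong[where f="measure (measure_pmf p)"])
qed auto

text \<open>
  The second component is shared within a row: it is the symbol of the relay, which depends only on the message of
  the previous block.
\<close>

definition row_pmf :: "nat \<Rightarrow> (nat \<times> nat) pmf \<Rightarrow> (nat \<Rightarrow> nat \<times> nat) pmf" where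
  "row_pmf M p = bind_pmf (map_pmf snd p) (\<lambda>y. Pi_pmf {..<M} (0, 0) (\<lambda>_. cond2 p y))"

definition codebook_pmf :: "nat \<Rightarrow> (nat \<times> nat) pmf \<Rightarrow> (nat \<Rightarrow> nat \<Rightarrow> nat \<times> nat) pmf" where
  "codebook_pmf M p = Pi_pmf {..<M} (\<lambda>_. (0, 0)) (\<lambda>_. row_pmf M p)"

lemma map_row_pmf: "m < M \<Longrightarrow> map_pmf (\<lambda>r. r m) (row_pmf M p) = p"
  unfolding row_pmf_def map_bind_pmf by (simp add: Pi_pmf_component bind_cond2)

text \<open>Given the shared symbol the two entries are independent, so the competitor
  \<open>x\<close> may be drawn first and the transmitted pair \<open>z\<close> from the conditional
  law. In this order the mean over \<open>z\<close> is the one that defines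
  \<open>cond_output\<close> for \<open>S = {1}\<close>.\<close>

lemma map_row_pmf_pair:
  assumes "m < M" "k < M" "m \<noteq> k"
  shows "map_pmf (\<lambda>r. (r m, r k)) (row_pmf M p)
    = bind_pmf p (\<lambda>x. map_pmf (\<lambda>z. (z, x)) (cond2 p (snd x)))"
proof -
  have "map_pmf (\<lambda>r. (r m, r k)) (row_pmf M p)
      = bind_pmf (map_pmf snd p) (\<lambda>y. pair_pmf (cond2 p y) (cond2 p y))"
    unfolding row_pmf_def map_bind_pmf using assms by (simp add: map_Pi_pmf_pair)
  also have "\<dots> = bind_pmf (map_pmf snd p) (\<lambda>y. bind_pmf (cond2 p y) (\<lambda>x. map_pmf (\<lambda>z. (z, x)) (cond2 p (snd x))))"
  proof (rule bind_pmf_cong[OF refl])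
    fix y assume y: "y \<in> set_pmf (map_pmf snd p)"
    have "pair_pmf (cond2 p y) (cond2 p y) = bind_pmf (cond2 p y) (\<lambda>x. map_pmf (\<lambda>z. (z, x)) (cond2 p y))"
      unfolding pair_pmf_def map_pmf_def by (rule bind_commute_pmf)
    also have "\<dots> = bind_pmf (cond2 p y) (\<lambda>x. map_pmf (\<lambda>z. (z, x)) (cond2 p (snd x)))"
      by (rule bind_pmf_cong[OF refl]) (use set_cond2[OF y] in auto)
    finally show "pair_pmf (cond2 p y) (cond2 p y) = bind_pmf (cond2 p y) (\<lambda>x. map_pmf (\<lambda>z. (z, x)) (cond2 p (snd x)))" .
  qed
  also have "\<dots> = bind_pmf p (\<lambda>x. map_pmf (\<lambda>z. (z, x)) (cond2 p (snd x)))"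
    unfolding bind_assoc_pmf[symmetric] bind_cond2 ..
  finally show ?thesis .
qed

lemma finite_set_Pi_pmf:
  "finite A \<Longrightarrow> (\<And>x. x \<in> A \<Longrightarrow> finite (set_pmf (p x))) \<Longrightarrow> finite (set_pmf (Pi_pmf A d p))"
  by (simp add: set_Pi_pmf)  (auto intro!: finite_PiE_dflt)

lemma finite_row_pmf: "finite (set_pmf p) \<Longrightarrow> finite (set_pmf (row_pmf M p))"
proof -
  assume fin: "finite (set_pmf p)"
  have "finite (set_pmf (cond2 p y))" if "y \<in> set_pmf (map_pmf snd p)" for y
    using fin by (simp add: set_cond2[OF that])
  then show ?thesis unfolding row_pmf_def set_bind_pmf using fin
    by (intro finite_UN_I finite_set_Pi_pmf) auto
qed

lemma finite_codebook_pmf: "finite (set_pmf p) \<Longrightarrow> finite (set_pmf (codebook_pmf M p))"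
  unfolding codebook_pmf_def by (intro finite_set_Pi_pmf finite_row_pmf) auto

lemma codebook_row:
  assumes "c \<in> set_pmf (codebook_pmf M p)" "i < M"
  shows "c i \<in> set_pmf (row_pmf M p)"
  using assms by (auto simp: codebook_pmf_def set_Pi_pmf PiE_dflt_def)

text \<open>Both properties hold on the whole support, hence for the single codebook that averaging
  selects later.\<close>

lemma codebook_mem:
  assumes "c \<in> set_pmf (codebook_pmf M p)" "i < M" "m < M"
  shows "c i m \<in> set_pmf p" and "k < M \<Longrightarrow> snd (c i k) = snd (c i m)"
proof -
  from codebook_row[OF assms(1,2)] obtain y where y: "y \<in> set_pmf (map_pmf snd p)"
    and ci: "c i \<in> set_pmf (Pi_pmf {..<M} (0, 0) (\<lambda>_. cond2 p y))"
    by (auto simp: row_pmf_def)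
  have "c i k \<in> set_pmf p \<inter> {z. snd z = y}" if "k < M" for k
    using ci that set_cond2[OF y] by (auto simp: set_Pi_pmf PiE_dflt_def)
  then show "c i m \<in> set_pmf p" and "k < M \<Longrightarrow> snd (c i k) = snd (c i m)" using assms by auto
qed

lemma map_codebook_row: "i < M \<Longrightarrow> map_pmf (\<lambda>c. c i) (codebook_pmf M p) = row_pmf M p"
  unfolding codebook_pmf_def by (simp add: Pi_pmf_component)

section \<open>Expected costs under the random codebook\<close>

lemma exp_codebook:
  fixes f :: "nat \<times> nat \<Rightarrow> real"
  assumes X: "finite X" "set_pmf p \<subseteq> X" and "i < M" "m < M"
  shows "measure_pmf.expectation (codebook_pmf M p) (\<lambda>c. f (c i m)) = (\<Sum>x\<in>X. pmf p x * f x)"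
proof -
  have "map_pmf (\<lambda>c. c i m) (codebook_pmf M p) = map_pmf (\<lambda>r. r m) (map_pmf (\<lambda>c. c i) (codebook_pmf M p))"
    by (simp add: pmf.map_comp o_def)
  also have "\<dots> = p" using assms by (simp add: map_codebook_row map_row_pmf)
  finally have "measure_pmf.expectation (codebook_pmf M p) (\<lambda>c. f (c i m)) = measure_pmf.expectation p f"
    by (metis integral_map_pmf)
  also have "\<dots> = (\<Sum>x\<in>X. f x * pmf p x)"
    using X by (intro integral_measure_pmf_real) auto
  finally show ?thesis by (simp add: mult.commute)
qed

lemma exp_codebook_same_row:
  fixes g :: "nat \<times> nat \<Rightarrow> nat \<times> nat \<Rightarrow> real"
  assumes p: "set_pmf p \<subseteq> {..<k1} \<times> {..<k2}" and ik: "i < M" "m < M" "k < M" "m \<noteq> k"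
  shows "measure_pmf.expectation (codebook_pmf M p) (\<lambda>c. g (c i m) (c i k))
    = (\<Sum>x\<in>{..<k1} \<times> {..<k2}. pmf p x *
        (\<Sum>z\<in>fibre k1 k2 {1} x. pmf p z / (\<Sum>w\<in>fibre k1 k2 {1} x. pmf p w) * g z x))"
proof -
  let ?X = "{..<k1} \<times> {..<k2}"
  have fin: "finite (set_pmf p)" using p by (rule finite_subset) simp
  have "map_pmf (\<lambda>c. (c i m, c i k)) (codebook_pmf M p)
      = map_pmf (\<lambda>r. (r m, r k)) (map_pmf (\<lambda>c. c i) (codebook_pmf M p))"
    by (simp add: pmf.map_comp o_def)
  also have "\<dots> = bind_pmf p (\<lambda>x. map_pmf (\<lambda>z. (z, x)) (cond2 p (snd x)))"
    using ik by (simp add: map_codebook_row map_row_pmf_pair)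
  finally have eq: "map_pmf (\<lambda>c. (c i m, c i k)) (codebook_pmf M p)
      = bind_pmf p (\<lambda>x. map_pmf (\<lambda>z. (z, x)) (cond2 p (snd x)))" .
  have "measure_pmf.expectation (codebook_pmf M p) (\<lambda>c. g (c i m) (c i k))
      = measure_pmf.expectation (map_pmf (\<lambda>c. (c i m, c i k)) (codebook_pmf M p)) (\<lambda>(z, x). g z x)"
    by simp
  also have "\<dots> = (\<Sum>x\<in>set_pmf p. pmf p x *\<^sub>R
      measure_pmf.expectation (map_pmf (\<lambda>z. (z, x)) (cond2 p (snd x))) (\<lambda>(z, x). g z x))"
    unfolding eq using fin by (intro pmf_expectation_bind) (auto simp: set_cond2)
  also have "\<dots> = (\<Sum>x\<in>set_pmf p. pmf p x *
        (\<Sum>z\<in>fibre k1 k2 {1} x. pmf p z / (\<Sum>w\<in>fibre k1 k2 {1} x. pmf p w) * g z x))"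
  proof (rule sum.cong[OF refl])
    fix x assume x: "x \<in> set_pmf p"
    then have y: "snd x \<in> set_pmf (map_pmf snd p)" by auto
    have finf: "finite (fibre k1 k2 {1} x)" by (rule finite_subset[of _ ?X]) (auto simp: fibre_def)
    have ne: "set_pmf p \<inter> {z. snd z = snd x} \<noteq> {}" using x by auto
    \<comment> \<open>The event is not confined to the finite alphabet, but \<open>p\<close> is, so
      the mass of the event is the finite sum that \<open>cond_output\<close> divides by.\<close>
    have meas: "measure (measure_pmf p) {z. snd z = snd x} = (\<Sum>w\<in>fibre k1 k2 {1} x. pmf p w)"
    proof -
      have "measure (measure_pmf p) {z. snd z = snd x} = measure (measure_pmf p) (fibre k1 k2 {1} x)"
        by (rule measure_pmf.finite_measure_eq_AE) (use p in \<open>auto simp: fibre_def AE_measure_pmf_iff\<close>)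
      then show ?thesis using finf by (simp add: measure_measure_pmf_finite)
    qed
    have "measure_pmf.expectation (map_pmf (\<lambda>z. (z, x)) (cond2 p (snd x))) (\<lambda>(z, x). g z x)
        = measure_pmf.expectation (cond2 p (snd x)) (\<lambda>z. g z x)" by simp
    also have "\<dots> = (\<Sum>z\<in>fibre k1 k2 {1} x. g z x * pmf (cond2 p (snd x)) z)"
      using finf p by (intro integral_measure_pmf_real) (auto simp: set_cond2[OF y] fibre_def)
    also have "\<dots> = (\<Sum>z\<in>fibre k1 k2 {1} x. pmf p z / (\<Sum>w\<in>fibre k1 k2 {1} x. pmf p w) * g z x)"
      unfolding cond2_def
      by (rule sum.cong[OF refl], subst pmf_cond[OF ne]) (auto simp: meas fibre_def)
    finally show "pmf p x *\<^sub>R measure_pmf.expectation (map_pmf (\<lambda>z. (z, x)) (cond2 p (snd x))) (\<lambda>(z, x). g z x)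
      = pmf p x * (\<Sum>z\<in>fibre k1 k2 {1} x. pmf p z / (\<Sum>w\<in>fibre k1 k2 {1} x. pmf p w) * g z x)" by simp
  qed
  \<comment> \<open>Off the support of \<open>p\<close> the factor \<open>pmf p x\<close> is 0, so a
    vanishing denominator there does no harm.\<close>
  also have "\<dots> = (\<Sum>x\<in>?X. pmf p x *
        (\<Sum>z\<in>fibre k1 k2 {1} x. pmf p z / (\<Sum>w\<in>fibre k1 k2 {1} x. pmf p w) * g z x))"
    by (rule sum.mono_neutral_left) (use p in \<open>auto simp: set_pmf_iff\<close>)
  finally show ?thesis .
qed

text \<open>Rows are drawn independently and each entry has law \<open>p\<close>, so two entries of
  a column in different rows have the law of two independent pairs. This produces the product state
  on the receiver's side.\<close>

lemma exp_codebook_other_row: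
  fixes h :: "nat \<times> nat \<Rightarrow> nat \<times> nat \<Rightarrow> real"
  assumes X: "finite X" "set_pmf p \<subseteq> X" and ik: "i < M" "k < M" "m < M" "i \<noteq> k"
  shows "measure_pmf.expectation (codebook_pmf M p) (\<lambda>c. h (c i m) (c k m))
    = (\<Sum>x\<in>X. pmf p x * (\<Sum>z\<in>X. pmf p z * h z x))"
proof -
  have "map_pmf (\<lambda>c. (c i m, c k m)) (codebook_pmf M p)
      = map_pmf (\<lambda>(a, b). (a m, b m)) (map_pmf (\<lambda>c. (c i, c k)) (codebook_pmf M p))"
    by (simp add: pmf.map_comp o_def)
  also have "\<dots> = pair_pmf p p"
    using ik unfolding codebook_pmf_def by (simp add: map_Pi_pmf_pair map_pair map_row_pmf)
  finally have eq: "map_pmf (\<lambda>c. (c i m, c k m)) (codebook_pmf M p) = pair_pmf p p" .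
  have "measure_pmf.expectation (codebook_pmf M p) (\<lambda>c. h (c i m) (c k m))
      = measure_pmf.expectation (map_pmf (\<lambda>c. (c i m, c k m)) (codebook_pmf M p)) (\<lambda>(z, x). h z x)"
    by simp
  also have "\<dots> = (\<Sum>y\<in>X \<times> X. (case y of (z, x) \<Rightarrow> h z x) * pmf (pair_pmf p p) y)"
    unfolding eq using X by (intro integral_measure_pmf_real) auto
  also have "\<dots> = (\<Sum>z\<in>X. \<Sum>x\<in>X. pmf p x * (pmf p z * h z x))"
    unfolding sum.cartesian_product by (intro sum.cong) (auto simp: pmf_pair)
  also have "\<dots> = (\<Sum>x\<in>X. pmf p x * (\<Sum>z\<in>X. pmf p z * h z x))"
    by (subst sum.swap) (simp add: sum_distrib_left)
  finally show ?thesis .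
qed

text \<open>
  In the application \<open>f\<close> is the error of the test for the transmitted pair, and \<open>g\<close> and \<open>h\<close> are the costs of confusing
  it with another pair of its row (by the relay) or of its column (by the receiver).
\<close>

lemma good_codebook:
  fixes f :: "nat \<times> nat \<Rightarrow> real" and g h :: "nat \<times> nat \<Rightarrow> nat \<times> nat \<Rightarrow> real"
  assumes p: "set_pmf p \<subseteq> {..<k1} \<times> {..<k2}" and M: "0 < M"
    and s: "\<And>t. t \<in> W \<Longrightarrow> s t < M" and r: "\<And>t. t \<in> W \<Longrightarrow> r t < M"
  defines "X \<equiv> {..<k1} \<times> {..<k2}"
  obtains c where "c \<in> set_pmf (codebook_pmf M p)"
    and "(\<Sum>t\<in>W. f (c (s t) (r t)) + (\<Sum>k\<in>{..<M} - {r t}. g (c (s t) (r t)) (c (s t) k))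
          + (\<Sum>k\<in>{..<M} - {s t}. h (c (s t) (r t)) (c k (r t))))
      \<le> real (card W) * ((\<Sum>x\<in>X. pmf p x * f x)
          + (real M - 1) * (\<Sum>x\<in>X. pmf p x *
              (\<Sum>z\<in>fibre k1 k2 {1} x. pmf p z / (\<Sum>w\<in>fibre k1 k2 {1} x. pmf p w) * g z x))
          + (real M - 1) * (\<Sum>x\<in>X. pmf p x * (\<Sum>z\<in>X. pmf p z * h z x)))"
proof -
  have fin: "finite (set_pmf p)" using p by (rule finite_subset) simp
  let ?C = "codebook_pmf M p"
  have finC: "finite (set_pmf ?C)" by (rule finite_codebook_pmf[OF fin])
  have int: "integrable (measure_pmf ?C) F" for F :: "_ \<Rightarrow> real"
    by (rule integrable_measure_pmf_finite[OF finC])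
  define F where "F c = (\<Sum>t\<in>W. f (c (s t) (r t)) + (\<Sum>k\<in>{..<M} - {r t}. g (c (s t) (r t)) (c (s t) k))
          + (\<Sum>k\<in>{..<M} - {s t}. h (c (s t) (r t)) (c k (r t))))" for c
  define B where "B = real (card W) * ((\<Sum>x\<in>X. pmf p x * f x)
          + (real M - 1) * (\<Sum>x\<in>X. pmf p x *
              (\<Sum>z\<in>fibre k1 k2 {1} x. pmf p z / (\<Sum>w\<in>fibre k1 k2 {1} x. pmf p w) * g z x))
          + (real M - 1) * (\<Sum>x\<in>X. pmf p x * (\<Sum>z\<in>X. pmf p z * h z x)))"
  have cardM: "real (card ({..<M} - {i})) = real M - 1" if "i < M" for i
    using that by (simp add: card_Diff_singleton of_nat_diff)
  have "measure_pmf.expectation ?C F = (\<Sum>t\<in>W. measure_pmf.expectation ?C (\<lambda>c. f (c (s t) (r t)))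
      + (\<Sum>k\<in>{..<M} - {r t}. measure_pmf.expectation ?C (\<lambda>c. g (c (s t) (r t)) (c (s t) k)))
      + (\<Sum>k\<in>{..<M} - {s t}. measure_pmf.expectation ?C (\<lambda>c. h (c (s t) (r t)) (c k (r t)))))"
    unfolding F_def by (simp add: int)
  also have "\<dots> = (\<Sum>t\<in>W. (\<Sum>x\<in>X. pmf p x * f x)
      + (\<Sum>k\<in>{..<M} - {r t}. (\<Sum>x\<in>X. pmf p x *
              (\<Sum>z\<in>fibre k1 k2 {1} x. pmf p z / (\<Sum>w\<in>fibre k1 k2 {1} x. pmf p w) * g z x)))
      + (\<Sum>k\<in>{..<M} - {s t}. (\<Sum>x\<in>X. pmf p x * (\<Sum>z\<in>X. pmf p z * h z x))))"
  proof (intro sum.cong[OF refl] arg_cong2[where f="(+)"])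
    fix t assume t: "t \<in> W"
    show "measure_pmf.expectation ?C (\<lambda>c. f (c (s t) (r t))) = (\<Sum>x\<in>X. pmf p x * f x)"
      unfolding X_def by (rule exp_codebook) (use p s[OF t] r[OF t] in auto)
    show "measure_pmf.expectation ?C (\<lambda>c. g (c (s t) (r t)) (c (s t) k)) = (\<Sum>x\<in>X. pmf p x *
              (\<Sum>z\<in>fibre k1 k2 {1} x. pmf p z / (\<Sum>w\<in>fibre k1 k2 {1} x. pmf p w) * g z x))"
      if "k \<in> {..<M} - {r t}" for k
      unfolding X_def by (rule exp_codebook_same_row) (use p s[OF t] r[OF t] that in auto)
    show "measure_pmf.expectation ?C (\<lambda>c. h (c (s t) (r t)) (c k (r t)))
      = (\<Sum>x\<in>X. pmf p x * (\<Sum>z\<in>X. pmf p z * h z x))"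
      if "k \<in> {..<M} - {s t}" for k
      unfolding X_def by (rule exp_codebook_other_row) (use p s[OF t] r[OF t] that in auto)
  qed
  also have "\<dots> = B"
    unfolding B_def using cardM s r M by (simp add: distrib_left mult_ac of_nat_diff Suc_leI)
  finally have EF: "measure_pmf.expectation ?C F = B" .
  \<comment> \<open>If every codebook of positive probability cost more than the mean
    \<open>B\<close>, then so would their finite weighted average.\<close>
  have "\<exists>c\<in>set_pmf ?C. F c \<le> B"
  proof (rule ccontr)
    assume neg: "\<not> (\<exists>c\<in>set_pmf ?C. F c \<le> B)"
    have "0 < measure_pmf.expectation ?C (\<lambda>c. F c - B)"
    proof -
      have "measure_pmf.expectation ?C (\<lambda>c. F c - B) = (\<Sum>c\<in>set_pmf ?C. (F c - B) * pmf ?C c)"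
        by (intro integral_measure_pmf_real finC) auto
      also have "\<dots> > 0"
        using neg by (intro sum_pos finC) (auto simp: set_pmf_not_empty pmf_positive not_le)
      finally show ?thesis .
    qed
    then show False using EF by (simp add: int)
  qed
  then show ?thesis using that unfolding F_def B_def by blast
qed

section \<open>Kronecker products\<close>

text \<open>Each label below \<open>a * c\<close> is \<open>i * c + j\<close> for exactly one pair.
  With the lemmas that follow, calculations in a tensor product are done on pairs of labels instead
  of quotients and remainders.\<close>

lemma sum_prod_index:
  fixes f :: "nat \<Rightarrow> 'a :: comm_monoid_add"
  shows "(\<Sum>i<a * c. f i) = (\<Sum>i<a. \<Sum>j<c. f (i * c + j))"
  unfolding sum.nat_group[symmetric]
  by (rule sum.cong[OF refl], subst sum.atLeastLessThan_shift_0) (simp add: atLeast0LessThan)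

lemma prod_index_less: "i < a \<Longrightarrow> k < c \<Longrightarrow> i * c + k < a * (c :: nat)"
proof -
  assume "i < a" "k < c"
  then have "i * c + k < (i + 1) * c" by simp
  also have "\<dots> \<le> a * c" using \<open>i < a\<close> by (intro mult_right_mono) auto
  finally show ?thesis .
qed

lemma div_prod_index [simp]: "k < c \<Longrightarrow> (i * c + k) div c = (i :: nat)"
  by simp

lemma mod_prod_index [simp]: "k < c \<Longrightarrow> (i * c + k) mod c = (k :: nat)"
  by simp

lemma prod_index_cases:
  assumes "i < a * (c :: nat)" obtains x k where "x < a" "k < c" "i = x * c + k"
proof
  have "0 < c" using assms by (cases c) auto
  then show "i mod c < c" by simp
  show "i div c < a" using assms by (simp add: less_mult_imp_div_less)
  show "i = i div c * c + i mod c" by simp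
qed

lemma prod_index_eq_iff: "k < c \<Longrightarrow> l < c \<Longrightarrow> i * c + k = j * c + l \<longleftrightarrow> i = j \<and> k = (l :: nat)"
  by (metis div_prod_index mod_prod_index)

lemma eq_mat_prodI:
  assumes "A \<in> carrier_mat (a * c) (a' * c')" "B \<in> carrier_mat (a * c) (a' * c')"
    and "\<And>x k y l. x < a \<Longrightarrow> k < c \<Longrightarrow> y < a' \<Longrightarrow> l < c' \<Longrightarrow> A $$ (x * c + k, y * c' + l) = B $$ (x * c + k, y * c' + l)"
  shows "A = B"
proof (rule eq_matI)
  fix i j assume "i < dim_row B" "j < dim_col B"
  then have "i < a * c" "j < a' * c'" using assms by auto
  then show "A $$ (i, j) = B $$ (i, j)" using assms(3) by (metis prod_index_cases)
qed (use assms in auto)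

lemma kron_carrier [simp, intro]:
  "A \<in> carrier_mat a a' \<Longrightarrow> B \<in> carrier_mat c c' \<Longrightarrow> kron A B \<in> carrier_mat (a * c) (a' * c')"
  by (auto simp: kron_def)

lemma kron_index:
  assumes "A \<in> carrier_mat a a'" "B \<in> carrier_mat c c'" "i < a" "k < c" "j < a'" "l < c'"
  shows "kron A B $$ (i * c + k, j * c' + l) = A $$ (i, j) * B $$ (k, l)"
  using assms prod_index_less[of i a k c] prod_index_less[of j a' l c'] by (simp add: kron_def)

lemma adj_kron:
  assumes "A \<in> carrier_mat a a'" "B \<in> carrier_mat c c'"
  shows "adj (kron A B) = kron (adj A) (adj B)"
proof (rule eq_mat_prodI[of _ a' c' a c])
  fix x k y l assume *: "x < a'" "k < c'" "y < a" "l < c"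
  have "adj (kron A B) $$ (x * c' + k, y * c + l) = cnj (kron A B $$ (y * c + l, x * c' + k))"
    using * prod_index_less[of x a' k c'] prod_index_less[of y a l c] carrier_matD[OF kron_carrier[OF assms]] by simp
  then show "adj (kron A B) $$ (x * c' + k, y * c + l) = kron (adj A) (adj B) $$ (x * c' + k, y * c + l)"
    using * assms by (simp add: kron_index[of _ a a' _ c c'] kron_index[of _ a' a _ c' c])
qed (use assms in auto)

lemma kron_mult:
  assumes A: "A \<in> carrier_mat a a'" and B: "B \<in> carrier_mat c c'"
    and C: "C \<in> carrier_mat a' a''" and D: "D \<in> carrier_mat c' c''"
  shows "kron A B * kron C D = kron (A * C) (B * D)"
proof (rule eq_mat_prodI[of _ a c a'' c''])
  show "kron A B * kron C D \<in> carrier_mat (a * c) (a'' * c'')"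
    by (rule mult_carrier_mat[OF kron_carrier[OF A B] kron_carrier[OF C D]])
  show "kron (A * C) (B * D) \<in> carrier_mat (a * c) (a'' * c'')"
    by (rule kron_carrier[OF mult_carrier_mat[OF A C] mult_carrier_mat[OF B D]])
  fix x k y l assume *: "x < a" "k < c" "y < a''" "l < c''"
  have "(kron A B * kron C D) $$ (x * c + k, y * c'' + l)
      = (\<Sum>i<a' * c'. kron A B $$ (x * c + k, i) * kron C D $$ (i, y * c'' + l))"
    by (rule index_mult_sum[OF kron_carrier[OF A B] kron_carrier[OF C D]]) (use * prod_index_less in auto)
  also have "\<dots> = (\<Sum>i<a'. \<Sum>j<c'. (A $$ (x, i) * C $$ (i, y)) * (B $$ (k, j) * D $$ (j, l)))"
    unfolding sum_prod_index
    by (intro sum.cong refl) (use * in \<open>auto simp: kron_index[OF A B] kron_index[OF C D]\<close>)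
  also have "\<dots> = (A * C) $$ (x, y) * (B * D) $$ (k, l)"
    unfolding index_mult_sum[OF A C *(1,3)] index_mult_sum[OF B D *(2,4)] by (simp add: sum_product)
  also have "\<dots> = kron (A * C) (B * D) $$ (x * c + k, y * c'' + l)"
    by (rule kron_index[symmetric]) (use * A B C D in \<open>auto intro!: mult_carrier_mat\<close>)
  finally show "(kron A B * kron C D) $$ (x * c + k, y * c'' + l) = kron (A * C) (B * D) $$ (x * c + k, y * c'' + l)" .
qed

text \<open>The product of Gram factorisations of the factors is a Gram factorisation of the
  Kronecker product.\<close>

lemma psd_kron:
  assumes "psd a A" "psd c B" shows "psd (a * c) (kron A B)"
proof -
  from psd_gram[OF assms(1)] obtain G where G: "G \<in> carrier_mat a a" "A = G * adj G" .
  from psd_gram[OF assms(2)] obtain H where H: "H \<in> carrier_mat c c" "B = H * adj H" .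
  have "kron A B = kron G H * adj (kron G H)"
    unfolding adj_kron[OF G(1) H(1)] G(2) H(2)
    by (rule kron_mult[symmetric]) (use G H in auto)
  then show ?thesis using psd_gram_intro[of "kron G H" "a * c" "a * c"] G H by simp
qed

lemma mtrace_kron:
  assumes "A \<in> carrier_mat a a" "B \<in> carrier_mat c c"
  shows "mtrace (kron A B) = mtrace A * mtrace B"
proof -
  have "mtrace (kron A B) = (\<Sum>i<a * c. kron A B $$ (i, i))"
    using assms by (simp add: mtrace_def kron_def)
  also have "\<dots> = (\<Sum>i<a. \<Sum>j<c. A $$ (i, i) * B $$ (j, j))"
    unfolding sum_prod_index by (intro sum.cong refl) (use assms in \<open>auto simp: kron_index\<close>)
  finally show ?thesis using assms by (simp add: mtrace_def sum_product)
qed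

lemma kron_one: "kron (1\<^sub>m a) (1\<^sub>m c) = 1\<^sub>m (a * c)"
proof (rule eq_mat_prodI[of _ a c a c])
  fix x k y l assume *: "x < a" "k < c" "y < a" "l < c"
  then show "kron (1\<^sub>m a) (1\<^sub>m c) $$ (x * c + k, y * c + l) = 1\<^sub>m (a * c) $$ (x * c + k, y * c + l)"
    using prod_index_less[of x a k c] prod_index_less[of y a l c]
    by (auto simp: kron_index[of _ a a _ c c] prod_index_eq_iff)
qed auto

lemma ketbra_carrier [simp, intro]: "ketbra k x \<in> carrier_mat k k"
  by (simp add: ketbra_def)

lemma psd_ketbra [simp]: "psd k (ketbra k x)"
proof -
  have "ketbra k x = fcalc k (1\<^sub>m k) (\<lambda>i. if i = x then 1 else 0)"
    unfolding fcalc_def by (auto simp: right_mult_one_mat[of _ k k] left_mult_one_mat[of _ k k] diagm_def ketbra_def intro!: eq_matI)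
  moreover have "unitary k (1\<^sub>m k)" by (simp add: unitary_def)
  ultimately show ?thesis by (auto intro!: psd_fcalc)
qed

section \<open>Blocks of operators and classical-quantum states\<close>

text \<open>For a test on a classical register and a quantum system, this is the test on the quantum
  system that applies when the register shows \<open>x\<close>. A classical-quantum state sees only
  these diagonal blocks of the test.\<close>

definition blk :: "nat \<Rightarrow> complex mat \<Rightarrow> nat \<Rightarrow> complex mat" where
  "blk d A x = mat d d (\<lambda>(i, j). A $$ (x * d + i, x * d + j))"

lemma blk_carrier [simp, intro]: "blk d A x \<in> carrier_mat d d"
  by (simp add: blk_def)

lemma qf_prod_index:
  "qf (k * d) A v = (\<Sum>x<k. \<Sum>i<d. \<Sum>y<k. \<Sum>j<d. cnj (v (x * d + i)) * A $$ (x * d + i, y * d + j) * v (y * d + j))"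
  unfolding qf_def sum_prod_index ..

lemma sum_diagonal_block:
  fixes f :: "nat \<Rightarrow> nat \<Rightarrow> complex" and x k :: nat
  assumes "x < k"
  shows "(\<Sum>y<k. \<Sum>i<d. \<Sum>z<k. \<Sum>j<d. if y = x \<and> z = x then f i j else 0) = (\<Sum>i<d. \<Sum>j<d. f i j)"
proof -
  have "(\<Sum>i<d. \<Sum>z<k. \<Sum>j<d. if y = x \<and> z = x then f i j else 0)
      = (if y = x then \<Sum>i<d. \<Sum>j<d. f i j else 0)" for y
  proof (cases "y = x")
    case True
    have "(\<Sum>j<d. if y = x \<and> z = x then f i j else 0) = (if z = x then \<Sum>j<d. f i j else 0)" for i z
      using True by simp
    then show ?thesis using assms True by simp
  qed simp
  then show ?thesis using assms by simp
qed

lemma psd_blk: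
  assumes "psd (k * d) A" "x < k" shows "psd d (blk d A x)"
proof -
  have "qf d (blk d A x) v = qf (k * d) A (\<lambda>i. if i div d = x then v (i mod d) else 0)" for v
  proof -
    have "qf (k * d) A (\<lambda>i. if i div d = x then v (i mod d) else 0)
      = (\<Sum>y<k. \<Sum>i<d. \<Sum>z<k. \<Sum>j<d. if y = x \<and> z = x then cnj (v i) * A $$ (x * d + i, x * d + j) * v j else 0)"
      unfolding qf_prod_index by (intro sum.cong refl) auto
    also have "\<dots> = qf d (blk d A x) v"
      unfolding sum_diagonal_block[OF assms(2)] by (simp add: qf_def blk_def)
    finally show ?thesis by simp
  qed
  then show ?thesis using psd_qf_nonneg[OF assms(1)] by (simp add: psd_iff_qf)
qed

lemma blk_one_minus:
  assumes "A \<in> carrier_mat (k * d) (k * d)" "x < k"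
  shows "blk d (1\<^sub>m (k * d) - A) x = 1\<^sub>m d - blk d A x"
  using assms prod_index_less[of x k _ d] by (intro eq_matI) (auto simp: blk_def)

lemma mtrace_mult_prod_index:
  assumes "A \<in> carrier_mat (k * d) (k * d)" "B \<in> carrier_mat (k * d) (k * d)"
  shows "mtrace (A * B) = (\<Sum>x<k. \<Sum>i<d. \<Sum>y<k. \<Sum>j<d. A $$ (x * d + i, y * d + j) * B $$ (y * d + j, x * d + i))"
  unfolding mtrace_mult[OF assms] sum_prod_index ..

lemma mtrace_mult_kron_ketbra:
  assumes T: "T \<in> carrier_mat (k * d) (k * d)" and \<rho>: "\<rho> \<in> carrier_mat d d" and x: "x < k"
  shows "mtrace (T * kron (ketbra k x) \<rho>) = mtrace (blk d T x * \<rho>)"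
proof -
  have "mtrace (T * kron (ketbra k x) \<rho>)
    = (\<Sum>y<k. \<Sum>i<d. \<Sum>z<k. \<Sum>j<d. if y = x \<and> z = x then T $$ (x * d + i, x * d + j) * \<rho> $$ (j, i) else 0)"
    unfolding mtrace_mult_prod_index[OF T kron_carrier[OF ketbra_carrier \<rho>]]
    using \<rho> by (intro sum.cong refl) (auto simp: kron_index[of _ k k _ d d] ketbra_def)
  also have "\<dots> = mtrace (blk d T x * \<rho>)"
    unfolding mtrace_mult[OF blk_carrier \<rho>] sum_diagonal_block[OF x] by (simp add: blk_def)
  finally show ?thesis .
qed

lemma kron_ketbra:
  assumes "x < a" "y < c"
  shows "kron (ketbra a x) (ketbra c y) = ketbra (a * c) (x * c + y)"
proof (rule eq_mat_prodI[of _ a c a c])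
  fix u k v l assume *: "u < a" "k < c" "v < a" "l < c"
  then show "kron (ketbra a x) (ketbra c y) $$ (u * c + k, v * c + l) = ketbra (a * c) (x * c + y) $$ (u * c + k, v * c + l)"
    using prod_index_less[of u a k c] prod_index_less[of v a l c] assms
    by (auto simp: kron_index[of _ a a _ c c] ketbra_def prod_index_eq_iff)
qed auto

lemma smult_carrier: "A \<in> carrier_mat n m \<Longrightarrow> c \<cdot>\<^sub>m A \<in> carrier_mat n m"
  by simp

text \<open>The two registers are merged into one of size \<open>k1 * k2\<close>, so that the facts
  on a single register apply.\<close>

lemma cq_state_alt:
  "cq_state k1 k2 d p \<rho> = mat_sum (k1 * k2 * d)
     (\<lambda>x. complex_of_real (pmf p x) \<cdot>\<^sub>m kron (ketbra (k1 * k2) (fst x * k2 + snd x)) (\<rho> x)) ({..<k1} \<times> {..<k2})"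
  unfolding cq_state_def mat_sum_def
  by (rule arg_cong[where f="mat _ _"]) (auto simp: fun_eq_iff kron_ketbra intro!: sum.cong)

lemma cq_state_carrier [simp]: "cq_state k1 k2 d p \<rho> \<in> carrier_mat (k1 * k2 * d) (k1 * k2 * d)"
  by (simp add: cq_state_def)

lemma mtrace_mult_cq_state:
  assumes T: "T \<in> carrier_mat (k1 * k2 * d) (k1 * k2 * d)"
    and \<rho>: "\<And>x. x \<in> {..<k1} \<times> {..<k2} \<Longrightarrow> \<rho> x \<in> carrier_mat d d"
  shows "mtrace (T * cq_state k1 k2 d p \<rho>)
    = (\<Sum>x\<in>{..<k1} \<times> {..<k2}. complex_of_real (pmf p x) * mtrace (blk d T (fst x * k2 + snd x) * \<rho> x))"
proof -
  let ?X = "{..<k1} \<times> {..<k2}" and ?n = "k1 * k2 * d"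
  let ?f = "\<lambda>x. kron (ketbra (k1 * k2) (fst x * k2 + snd x)) (\<rho> x)"
  have f: "?f x \<in> carrier_mat ?n ?n" if "x \<in> ?X" for x using \<rho>[OF that] by auto
  have "T * cq_state k1 k2 d p \<rho> = mat_sum ?n (\<lambda>x. T * (complex_of_real (pmf p x) \<cdot>\<^sub>m ?f x)) ?X"
    unfolding cq_state_alt by (rule mat_sum_mult_right[OF T]) (use f in auto)
  also have "mtrace \<dots> = (\<Sum>x\<in>?X. mtrace (T * (complex_of_real (pmf p x) \<cdot>\<^sub>m ?f x)))"
    by (rule mtrace_mat_sum_carrier) (use f T in \<open>auto intro!: square_mult_carrier smult_carrier\<close>)
  also have "\<dots> = (\<Sum>x\<in>?X. complex_of_real (pmf p x) * mtrace (blk d T (fst x * k2 + snd x) * \<rho> x))"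
  proof (rule sum.cong[OF refl])
    fix x assume x: "x \<in> ?X"
    then have "fst x * k2 + snd x < k1 * k2" by (auto intro: prod_index_less)
    then show "mtrace (T * (complex_of_real (pmf p x) \<cdot>\<^sub>m ?f x))
      = complex_of_real (pmf p x) * mtrace (blk d T (fst x * k2 + snd x) * \<rho> x)"
      using mtrace_mult_kron_ketbra[OF T \<rho>[OF x]] mult_smult_distrib[OF T f[OF x]]
        mtrace_smult[OF square_mult_carrier[OF T f[OF x]]] by simp
  qed
  finally show ?thesis .
qed

lemma cq_state_index:
  assumes \<rho>: "\<And>x. x \<in> {..<k1} \<times> {..<k2} \<Longrightarrow> \<rho> x \<in> carrier_mat d d"
    and x: "x < k1 * k2" and y: "y < k1 * k2" and u: "u < d" and v: "v < d"
  shows "cq_state k1 k2 d p \<rho> $$ (x * d + u, y * d + v)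
    = (if x = y then complex_of_real (pmf p (x div k2, x mod k2)) * \<rho> (x div k2, x mod k2) $$ (u, v) else 0)"
proof -
  let ?X = "{..<k1} \<times> {..<k2}"
  from x obtain x1 x2 where x12: "x1 < k1" "x2 < k2" "x = x1 * k2 + x2" by (rule prod_index_cases)
  have "cq_state k1 k2 d p \<rho> $$ (x * d + u, y * d + v)
    = (\<Sum>z\<in>?X. (complex_of_real (pmf p z) \<cdot>\<^sub>m kron (ketbra (k1 * k2) (fst z * k2 + snd z)) (\<rho> z)) $$ (x * d + u, y * d + v))"
    unfolding cq_state_alt using prod_index_less[OF x u] prod_index_less[OF y v] by (rule mat_sum_index)
  also have "\<dots> = (\<Sum>z\<in>?X. if z = (x1, x2) then (if x = y then complex_of_real (pmf p (x1, x2)) * \<rho> (x1, x2) $$ (u, v) else 0) else 0)"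
  proof (rule sum.cong[OF refl])
    fix z assume z: "z \<in> ?X"
    have c: "kron (ketbra (k1 * k2) (fst z * k2 + snd z)) (\<rho> z) \<in> carrier_mat (k1 * k2 * d) (k1 * k2 * d)"
      using \<rho>[OF z] by auto
    have ix: "fst z * k2 + snd z = x \<longleftrightarrow> z = (x1, x2)"
      using z x12 by (auto simp: prod_index_eq_iff)
    have "(complex_of_real (pmf p z) \<cdot>\<^sub>m kron (ketbra (k1 * k2) (fst z * k2 + snd z)) (\<rho> z)) $$ (x * d + u, y * d + v)
      = complex_of_real (pmf p z) * (ketbra (k1 * k2) (fst z * k2 + snd z) $$ (x, y) * \<rho> z $$ (u, v))"
      using carrier_matD[OF c] prod_index_less[OF x u] prod_index_less[OF y v] kron_index[OF ketbra_carrier \<rho>[OF z] x u y v] by simp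
    also have "\<dots> = (if z = (x1, x2) then (if x = y then complex_of_real (pmf p (x1, x2)) * \<rho> (x1, x2) $$ (u, v) else 0) else 0)"
      using x y ix by (auto simp: ketbra_def)
    finally show "(complex_of_real (pmf p z) \<cdot>\<^sub>m kron (ketbra (k1 * k2) (fst z * k2 + snd z)) (\<rho> z)) $$ (x * d + u, y * d + v)
      = (if z = (x1, x2) then (if x = y then complex_of_real (pmf p (x1, x2)) * \<rho> (x1, x2) $$ (u, v) else 0) else 0)" .
  qed
  also have "\<dots> = (if x = y then complex_of_real (pmf p (x1, x2)) * \<rho> (x1, x2) $$ (u, v) else 0)"
    using x12 by simp
  finally have eq: "cq_state k1 k2 d p \<rho> $$ (x * d + u, y * d + v)
    = (if x = y then complex_of_real (pmf p (x1, x2)) * \<rho> (x1, x2) $$ (u, v) else 0)" .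
  have "x div k2 = x1" "x mod k2 = x2" using x12 by simp_all
  then show ?thesis unfolding eq by (simp only:)
qed

text \<open>A linear map sends the vanishing off-diagonal blocks to 0 and acts separately on each
  diagonal one. Applied to the two partial traces, this identifies the reduced states of the theorem
  as classical-quantum states of the reduced outputs.\<close>

lemma id_tensor_cq_state:
  assumes \<rho>: "\<And>x. x \<in> {..<k1} \<times> {..<k2} \<Longrightarrow> \<rho> x \<in> carrier_mat d d"
    and \<Phi>: "\<And>A. A \<in> carrier_mat d d \<Longrightarrow> \<Phi> A \<in> carrier_mat c c"
    and lin: "\<And>A z. A \<in> carrier_mat d d \<Longrightarrow> \<Phi> (z \<cdot>\<^sub>m A) = z \<cdot>\<^sub>m \<Phi> A"
  shows "id_tensor (k1 * k2) d c \<Phi> (cq_state k1 k2 d p \<rho>) = cq_state k1 k2 c p (\<lambda>x. \<Phi> (\<rho> x))"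
proof (rule eq_mat_prodI[of _ "k1 * k2" c "k1 * k2" c])
  fix x u y v assume *: "x < k1 * k2" "u < c" "y < k1 * k2" "v < c"
  have mem: "(x div k2, x mod k2) \<in> {..<k1} \<times> {..<k2}"
    using *(1) by (metis (no_types, lifting) div_prod_index lessThan_iff mem_Sigma_iff mod_prod_index prod_index_cases)
  have z: "\<Phi> (0\<^sub>m d d) = 0\<^sub>m c c"
  proof -
    have "\<Phi> (0 \<cdot>\<^sub>m 0\<^sub>m d d) = 0 \<cdot>\<^sub>m \<Phi> (0\<^sub>m d d)" by (rule lin) simp
    moreover have "0 \<cdot>\<^sub>m 0\<^sub>m d d = (0\<^sub>m d d :: complex mat)" by (rule eq_matI) auto
    moreover have "0 \<cdot>\<^sub>m \<Phi> (0\<^sub>m d d) = 0\<^sub>m c c" using \<Phi>[of "0\<^sub>m d d"] by (intro eq_matI) auto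
    ultimately show ?thesis by simp
  qed
  have "mat d d (\<lambda>(r, s). cq_state k1 k2 d p \<rho> $$ (x * d + r, y * d + s))
    = (if x = y then complex_of_real (pmf p (x div k2, x mod k2)) \<cdot>\<^sub>m \<rho> (x div k2, x mod k2) else 0\<^sub>m d d)"
    using \<rho>[OF mem] cq_state_index[OF \<rho> *(1,3)] by (intro eq_matI) auto
  then have "id_tensor (k1 * k2) d c \<Phi> (cq_state k1 k2 d p \<rho>) $$ (x * c + u, y * c + v)
    = (if x = y then complex_of_real (pmf p (x div k2, x mod k2)) \<cdot>\<^sub>m \<Phi> (\<rho> (x div k2, x mod k2)) else 0\<^sub>m c c) $$ (u, v)"
    using * prod_index_less[OF *(1,2)] prod_index_less[OF *(3,4)] lin[OF \<rho>[OF mem]] z by (auto simp: id_tensor_def)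
  also have "\<dots> = cq_state k1 k2 c p (\<lambda>x. \<Phi> (\<rho> x)) $$ (x * c + u, y * c + v)"
    using * \<Phi>[OF \<rho>[OF mem]] by (subst cq_state_index) (auto intro!: \<Phi> \<rho>)
  finally show "id_tensor (k1 * k2) d c \<Phi> (cq_state k1 k2 d p \<rho>) $$ (x * c + u, y * c + v)
    = cq_state k1 k2 c p (\<lambda>x. \<Phi> (\<rho> x)) $$ (x * c + u, y * c + v)" .
qed (auto simp: id_tensor_def)

section \<open>Partial traces and positivity by duality\<close>

lemma ptrace_carrier [simp, intro]:
  "ptrace_fst a c A \<in> carrier_mat c c" "ptrace_snd a c A \<in> carrier_mat a a"
  by (auto simp: ptrace_fst_def ptrace_snd_def)

lemma ptrace_smult:
  assumes "A \<in> carrier_mat (a * c) (a * c)"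
  shows "ptrace_fst a c (z \<cdot>\<^sub>m A) = z \<cdot>\<^sub>m ptrace_fst a c A"
    and "ptrace_snd a c (z \<cdot>\<^sub>m A) = z \<cdot>\<^sub>m ptrace_snd a c A"
  using assms prod_index_less[of _ a _ c]
  by (auto simp: ptrace_fst_def ptrace_snd_def sum_distrib_left intro!: eq_matI sum.cong)

text \<open>The partial trace is dual to tensoring with the identity. This and its mirror image
  below make reduced states positive and relate local error probabilities to the joint
  state.\<close>

lemma mtrace_mult_ptrace_fst:
  assumes "D \<in> carrier_mat c c" "A \<in> carrier_mat (a * c) (a * c)"
  shows "mtrace (D * ptrace_fst a c A) = mtrace (kron (1\<^sub>m a) D * A)"
proof -
  have "mtrace (kron (1\<^sub>m a) D * A)
    = (\<Sum>x<a. \<Sum>i<c. \<Sum>y<a. \<Sum>j<c. (if x = y then D $$ (i, j) * A $$ (x * c + j, x * c + i) else 0))"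
    unfolding mtrace_mult_prod_index[OF kron_carrier[OF one_carrier_mat assms(1)] assms(2)]
    using assms by (intro sum.cong refl) (auto simp: kron_index[of _ a a _ c c])
  also have "\<dots> = (\<Sum>x<a. \<Sum>i<c. \<Sum>y<a. (if y = x then \<Sum>j<c. D $$ (i, j) * A $$ (x * c + j, x * c + i) else 0))"
    by (rule sum.cong[OF refl], rule sum.cong[OF refl], rule sum.cong[OF refl]) auto
  also have "\<dots> = (\<Sum>x<a. \<Sum>i<c. \<Sum>j<c. D $$ (i, j) * A $$ (x * c + j, x * c + i))"
    by (rule sum.cong[OF refl], rule sum.cong[OF refl]) simp
  also have "\<dots> = (\<Sum>i<c. \<Sum>j<c. \<Sum>x<a. D $$ (i, j) * A $$ (x * c + j, x * c + i))"
    by (subst sum.swap, rule sum.cong[OF refl], rule sum.swap)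
  also have "\<dots> = mtrace (D * ptrace_fst a c A)"
    unfolding mtrace_mult[OF assms(1) ptrace_carrier(1)]
    by (intro sum.cong refl) (simp add: ptrace_fst_def sum_distrib_left)
  finally show ?thesis by simp
qed

lemma mtrace_mult_ptrace_snd:
  assumes "D \<in> carrier_mat a a" "A \<in> carrier_mat (a * c) (a * c)"
  shows "mtrace (D * ptrace_snd a c A) = mtrace (kron D (1\<^sub>m c) * A)"
proof -
  have "mtrace (kron D (1\<^sub>m c) * A)
    = (\<Sum>x<a. \<Sum>i<c. \<Sum>y<a. \<Sum>j<c. (if j = i then D $$ (x, y) * A $$ (y * c + i, x * c + i) else 0))"
    unfolding mtrace_mult_prod_index[OF kron_carrier[OF assms(1) one_carrier_mat] assms(2)]
    using assms by (intro sum.cong refl) (auto simp: kron_index[of _ a a _ c c])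
  also have "\<dots> = (\<Sum>x<a. \<Sum>i<c. \<Sum>y<a. D $$ (x, y) * A $$ (y * c + i, x * c + i))"
    by (intro sum.cong refl) simp
  also have "\<dots> = (\<Sum>x<a. \<Sum>y<a. \<Sum>i<c. D $$ (x, y) * A $$ (y * c + i, x * c + i))"
    by (rule sum.cong[OF refl], rule sum.swap)
  also have "\<dots> = mtrace (D * ptrace_snd a c A)"
    unfolding mtrace_mult[OF assms(1) ptrace_carrier(2)]
    by (intro sum.cong refl) (simp add: ptrace_snd_def sum_distrib_left)
  finally show ?thesis by simp
qed

text \<open>For the rank-one operator of a vector the trace is the quadratic form of
  \<open>A\<close> at that vector.\<close>

lemma psd_of_traces:
  assumes "A \<in> carrier_mat d d" "\<And>B. psd d B \<Longrightarrow> 0 \<le> mtrace (B * A)"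
  shows "psd d A"
proof -
  have "0 \<le> qf d A v" for v
  proof -
    define G where "G = mat d 1 (\<lambda>(i, j). v i)"
    have G: "G \<in> carrier_mat d 1" by (simp add: G_def)
    have "qf d A v = mtrace (G * adj G * A)"
    proof -
      have "mtrace (G * adj G * A) = (\<Sum>i<d. \<Sum>l<d. (G * adj G) $$ (i, l) * A $$ (l, i))"
        using G assms by (intro mtrace_mult) (auto intro!: mult_carrier_mat)
      also have "\<dots> = (\<Sum>i<d. \<Sum>l<d. v i * cnj (v l) * A $$ (l, i))"
        using G by (intro sum.cong refl, subst index_mult_sum[where n=d and m=1 and k=d]) (auto simp: G_def)
      also have "\<dots> = qf d A v" unfolding qf_def by (subst sum.swap) (simp add: mult_ac)
      finally show ?thesis by simp
    qed
    then show ?thesis using assms(2)[OF psd_gram_intro[OF G]] by simp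
  qed
  then show ?thesis using assms(1) by (simp add: psd_iff_qf)
qed

lemma density_ptrace:
  assumes "density (a * c) A"
  shows "density c (ptrace_fst a c A)" "density a (ptrace_snd a c A)"
proof -
  have A: "psd (a * c) A" "mtrace A = 1" using assms by (auto simp: density_def)
  have Ac: "A \<in> carrier_mat (a * c) (a * c)" using A by auto
  have "psd c (ptrace_fst a c A)"
    using Ac A by (intro psd_of_traces) (auto simp: mtrace_mult_ptrace_fst psd_carrier intro!: mtrace_psd_mult_nonneg psd_kron)
  moreover have "mtrace (ptrace_fst a c A) = 1"
    using mtrace_mult_ptrace_fst[of "1\<^sub>m c" c A a] Ac A left_mult_one_mat[OF ptrace_carrier(1)]
    by (simp add: kron_one left_mult_one_mat[of A "a * c" "a * c"])
  ultimately show "density c (ptrace_fst a c A)" by (simp add: density_def)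
  have "psd a (ptrace_snd a c A)"
    using Ac A by (intro psd_of_traces) (auto simp: mtrace_mult_ptrace_snd psd_carrier intro!: mtrace_psd_mult_nonneg psd_kron)
  moreover have "mtrace (ptrace_snd a c A) = 1"
    using mtrace_mult_ptrace_snd[of "1\<^sub>m a" a A c] Ac A left_mult_one_mat[OF ptrace_carrier(2)]
    by (simp add: kron_one left_mult_one_mat[of A "a * c" "a * c"])
  ultimately show "density a (ptrace_snd a c A)" by (simp add: density_def)
qed

lemma psd_cq_state:
  assumes "\<And>x. x \<in> {..<k1} \<times> {..<k2} \<Longrightarrow> psd d (\<rho> x)"
  shows "psd (k1 * k2 * d) (cq_state k1 k2 d p \<rho>)"
  unfolding cq_state_alt using assms
  by (intro psd_mat_sum psd_smult psd_kron) (auto simp: less_eq_complex_def)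

lemma psd_cond_output:
  assumes "\<And>x. x \<in> {..<k1} \<times> {..<k2} \<Longrightarrow> psd d (\<rho> x)"
  shows "psd d (cond_output k1 k2 d p \<rho> S x)"
  unfolding cond_output_def using assms
  by (intro psd_mat_sum psd_smult) (auto simp: less_eq_complex_def fibre_def intro!: divide_nonneg_nonneg sum_nonneg)

lemma mtrace_mult_cond_output:
  assumes T: "T \<in> carrier_mat d d" and \<rho>: "\<And>x. x \<in> {..<k1} \<times> {..<k2} \<Longrightarrow> \<rho> x \<in> carrier_mat d d"
  shows "mtrace (T * cond_output k1 k2 d p \<rho> S x)
    = (\<Sum>z\<in>fibre k1 k2 S x. complex_of_real (pmf p z / (\<Sum>w\<in>fibre k1 k2 S x. pmf p w)) * mtrace (T * \<rho> z))"
proof -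
  have \<rho>': "\<rho> z \<in> carrier_mat d d" if "z \<in> fibre k1 k2 S x" for z using \<rho> that by (auto simp: fibre_def)
  have "T * cond_output k1 k2 d p \<rho> S x = mat_sum d (\<lambda>z. T * (complex_of_real (pmf p z / (\<Sum>w\<in>fibre k1 k2 S x. pmf p w)) \<cdot>\<^sub>m \<rho> z)) (fibre k1 k2 S x)"
    unfolding cond_output_def by (rule mat_sum_mult_right[OF T]) (use \<rho>' in auto)
  also have "mtrace \<dots> = (\<Sum>z\<in>fibre k1 k2 S x. mtrace (T * (complex_of_real (pmf p z / (\<Sum>w\<in>fibre k1 k2 S x. pmf p w)) \<cdot>\<^sub>m \<rho> z)))"
    by (rule mtrace_mat_sum_carrier) (use \<rho>' T in \<open>auto intro!: square_mult_carrier smult_carrier\<close>)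
  also have "\<dots> = (\<Sum>z\<in>fibre k1 k2 S x. complex_of_real (pmf p z / (\<Sum>w\<in>fibre k1 k2 S x. pmf p w)) * mtrace (T * \<rho> z))"
    by (intro sum.cong refl) (use \<rho>' mult_smult_distrib[OF T \<rho>'] mtrace_smult[OF square_mult_carrier[OF T \<rho>']] in simp)
  finally show ?thesis .
qed

section \<open>Tests from the hypothesis-testing relative entropy\<close>

text \<open>The slack \<open>\<eta>\<close> provides a real number strictly below the supremum, and
  some feasible test exceeds it. It also keeps the logarithm defined when \<open>e = 0\<close>,
  which is the case of an infinite \<open>D_H\<close>.\<close>

lemma D_H_test:
  assumes \<sigma>: "psd d \<sigma>" and e: "exp2 (ereal R - D_H d \<epsilon> \<rho> \<sigma>) = ereal e" and e0: "0 \<le> e" and \<eta>: "0 < \<eta>"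
  obtains T where "psd d T" "psd d (1\<^sub>m d - T)" "1 - \<epsilon> \<le> Re (mtrace (T * \<rho>))"
    "2 powr R * Re (mtrace (T * \<sigma>)) \<le> e + \<eta>"
proof -
  let ?D = "D_H d \<epsilon> \<rho> \<sigma>"
  \<comment> \<open>Chosen so that \<open>2 powr (R - K)\<close> is \<open>e + \<eta>\<close>, just
    above the value \<open>e\<close> that belongs to \<open>D_H\<close>.\<close>
  define K where "K = R - log 2 (e + \<eta>)"
  have "ereal K < ?D"
  proof (cases ?D)
    case (real r)
    then have "e = 2 powr (R - r)" using e by (simp add: exp2_def)
    moreover have "e + \<eta> = 2 powr (R - K)" using e0 \<eta> by (simp add: K_def)
    ultimately have "(2::real) powr (R - r) < 2 powr (R - K)" using \<eta> by linarith
    then have "R - r < R - K" by (subst (asm) powr_less_cancel_iff) simp_all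
    then show ?thesis using real by simp
  next
    case MInf
    then show ?thesis using e by (simp add: exp2_def)
  qed simp
  then obtain T where T: "psd d T" "psd d (1\<^sub>m d - T)" "1 - \<epsilon> \<le> Re (mtrace (T * \<rho>))"
    and K: "ereal K < neg_log2 (Re (mtrace (T * \<sigma>)))"
    unfolding D_H_def less_SUP_iff by auto
  define t where "t = Re (mtrace (T * \<sigma>))"
  have t0: "0 \<le> t" unfolding t_def using mtrace_psd_mult_nonneg[OF T(1) \<sigma>] by (simp add: less_eq_complex_def)
  have "2 powr R * t \<le> e + \<eta>"
  proof (cases "t = 0")
    case False
    then have "K < - log 2 t" using K by (simp add: neg_log2_def t_def)
    then have "R + log 2 t < log 2 (e + \<eta>)" by (simp add: K_def)
    then have "2 powr (R + log 2 t) < 2 powr (log 2 (e + \<eta>))" by simp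
    then show ?thesis using t0 False e0 \<eta> by (simp add: powr_add)
  qed (use e0 \<eta> in simp)
  then show ?thesis using that T unfolding t_def by blast
qed

section \<open>Measure-and-prepare channels\<close>

text \<open>The outcome of the measurement \<open>F\<close> is written as a basis state. With
  outcomes labelled \<open>x * M + m\<close> the relay obtains its next symbol \<open>x\<close> and
  its new memory \<open>m\<close> in one operation, both classical.\<close>

definition measure_prepare :: "nat \<Rightarrow> (nat \<Rightarrow> complex mat) \<Rightarrow> complex mat \<Rightarrow> complex mat" where
  "measure_prepare c F A = mat c c (\<lambda>(i, j). if i = j then mtrace (F i * A) else 0)"

lemma povmD:
  assumes "povm d M Q"
  shows "\<And>m. m \<in> M \<Longrightarrow> psd d (Q m)" "mat_sum d Q M = 1\<^sub>m d" "\<And>m. m \<in> M \<Longrightarrow> Q m \<in> carrier_mat d d"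
  using assms by (auto simp: povm_def)

lemma povm_sum_mtrace:
  assumes "povm d M Q" "A \<in> carrier_mat d d"
  shows "(\<Sum>m\<in>M. mtrace (Q m * A)) = mtrace A"
proof -
  have "(\<Sum>m\<in>M. mtrace (Q m * A)) = mtrace (mat_sum d (\<lambda>m. Q m * A) M)"
    by (rule mtrace_mat_sum_carrier[symmetric]) (use povmD[OF assms(1)] assms in auto)
  also have "mat_sum d (\<lambda>m. Q m * A) M = 1\<^sub>m d * A"
    unfolding povmD(2)[OF assms(1), symmetric] by (rule mat_sum_mult_left[symmetric]) (use povmD[OF assms(1)] assms in auto)
  finally show ?thesis using assms by simp
qed

lemma povm_complement:
  assumes "povm d M Q" "m \<in> M" "finite M"
  shows "psd d (1\<^sub>m d - Q m)"
proof -
  have "1\<^sub>m d - Q m = mat_sum d Q (M - {m})"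
    unfolding povmD(2)[OF assms(1), symmetric]
    using assms povmD(3)[OF assms(1,2)] by (intro eq_matI) (auto simp: mat_sum_def sum_diff1)
  then show ?thesis using povmD[OF assms(1)] by (auto intro!: psd_mat_sum)
qed

text \<open>Complete positivity: the output has no entries between different outcomes, so its form
  at \<open>v\<close> is a sum over outcomes \<open>i\<close>. Each term is the trace of
  \<open>A\<close> against \<open>kron V (F i)\<close>, where \<open>V\<close> is the rank-one
  operator built from the part of \<open>v\<close> with label \<open>i\<close>.\<close>

lemma psd_id_tensor_measure_prepare:
  assumes A: "psd (k * a) A" and F: "\<And>i. i < c \<Longrightarrow> psd a (F i)"
  shows "psd (k * c) (id_tensor k a c (measure_prepare c F) A)" (is "psd _ ?B")
proof -
  have "0 \<le> qf (k * c) ?B v" for v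
  proof -
    define b where "b x y = mat a a (\<lambda>(r, s). A $$ (x * a + r, y * a + s))" for x y
    have ent: "?B $$ (x * c + i, y * c + j) = (if i = j then mtrace (F i * b x y) else 0)"
      if "x < k" "i < c" "y < k" "j < c" for x i y j
      using that prod_index_less[of x k i c] prod_index_less[of y k j c]
      by (simp add: id_tensor_def measure_prepare_def b_def)
    have "qf (k * c) ?B v = (\<Sum>x<k. \<Sum>i<c. \<Sum>y<k. \<Sum>j<c.
        if j = i then cnj (v (x * c + i)) * mtrace (F i * b x y) * v (y * c + i) else 0)"
      unfolding qf_prod_index
      by (rule sum.cong[OF refl], rule sum.cong[OF refl], rule sum.cong[OF refl], rule sum.cong[OF refl])
        (auto simp: ent)
    also have "\<dots> = (\<Sum>x<k. \<Sum>i<c. \<Sum>y<k. cnj (v (x * c + i)) * mtrace (F i * b x y) * v (y * c + i))"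
      by (rule sum.cong[OF refl], rule sum.cong[OF refl]) simp
    also have "\<dots> = (\<Sum>i<c. \<Sum>x<k. \<Sum>y<k. cnj (v (x * c + i)) * mtrace (F i * b x y) * v (y * c + i))"
      by (rule sum.swap)
    also have "0 \<le> \<dots>"
    proof (rule sum_nonneg)
      fix i assume "i \<in> {..<c}"
      then have i: "i < c" by simp
      define V where "V = mat k k (\<lambda>(y, x). v (y * c + i) * cnj (v (x * c + i)))"
      have V: "psd k V"
      proof -
        define G where "G = mat k 1 (\<lambda>(y, x). v (y * c + i))"
        have G: "G \<in> carrier_mat k 1" by (simp add: G_def)
        have "V = G * adj G"
        proof (rule eq_matI)
          fix y x assume "y < dim_row (G * adj G)" "x < dim_col (G * adj G)"
          then have yx: "y < k" "x < k" using G by auto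
          have "(G * adj G) $$ (y, x) = (\<Sum>l<1. G $$ (y, l) * adj G $$ (l, x))"
            by (rule index_mult_sum) (use G yx in auto)
          then show "V $$ (y, x) = (G * adj G) $$ (y, x)" using yx G by (simp add: V_def G_def)
        qed (use G in \<open>auto simp: V_def\<close>)
        then show ?thesis using psd_gram_intro[OF G] by simp
      qed
      have Vc: "V \<in> carrier_mat k k" and Fc: "F i \<in> carrier_mat a a" and Ac: "A \<in> carrier_mat (k * a) (k * a)"
        using V F[OF i] A by auto
      have "mtrace (kron V (F i) * A) = (\<Sum>y<k. \<Sum>r<a. \<Sum>x<k. \<Sum>s<a.
          (v (y * c + i) * cnj (v (x * c + i)) * F i $$ (r, s)) * A $$ (x * a + s, y * a + r))"
        unfolding mtrace_mult_prod_index[OF kron_carrier[OF Vc Fc] Ac]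
        by (rule sum.cong[OF refl], rule sum.cong[OF refl], rule sum.cong[OF refl], rule sum.cong[OF refl])
          (simp add: kron_index[OF Vc Fc], simp add: V_def)
      also have "\<dots> = (\<Sum>y<k. \<Sum>x<k. \<Sum>r<a. \<Sum>s<a.
          (v (y * c + i) * cnj (v (x * c + i)) * F i $$ (r, s)) * A $$ (x * a + s, y * a + r))"
        by (rule sum.cong[OF refl], rule sum.swap)
      also have "\<dots> = (\<Sum>y<k. \<Sum>x<k. cnj (v (x * c + i)) * mtrace (F i * b x y) * v (y * c + i))"
        by (rule sum.cong[OF refl], rule sum.cong[OF refl], subst mtrace_mult[OF Fc])
          (auto simp: b_def sum_distrib_left sum_distrib_right mult_ac)
      also have "\<dots> = (\<Sum>x<k. \<Sum>y<k. cnj (v (x * c + i)) * mtrace (F i * b x y) * v (y * c + i))"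
        by (rule sum.swap)
      finally show "0 \<le> (\<Sum>x<k. \<Sum>y<k. cnj (v (x * c + i)) * mtrace (F i * b x y) * v (y * c + i))"
        using mtrace_psd_mult_nonneg[OF psd_kron[OF V F[OF i]] A] by simp
    qed
    finally show ?thesis .
  qed
  then show ?thesis by (simp add: psd_iff_qf id_tensor_def)
qed

lemma quantum_channel_measure_prepare:
  assumes F: "povm a {..<c} F"
  shows "quantum_channel a c (measure_prepare c F)"
  unfolding quantum_channel_def
proof (intro conjI ballI allI impI)
  note Fc = povmD(3)[OF F]
  fix A :: "complex mat" assume A: "A \<in> carrier_mat a a"
  show "measure_prepare c F A \<in> carrier_mat c c" by (simp add: measure_prepare_def)
  show "measure_prepare c F (A + B) = measure_prepare c F A + measure_prepare c F B" if B: "B \<in> carrier_mat a a" for B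
    using A B Fc by (intro eq_matI)
      (auto simp: measure_prepare_def mult_add_distrib_mat[of _ a a _ a] mtrace_add[of _ a])
  show "measure_prepare c F (z \<cdot>\<^sub>m A) = z \<cdot>\<^sub>m measure_prepare c F A" for z
    using A Fc by (intro eq_matI)
      (auto simp: measure_prepare_def mult_smult_distrib[of _ a a _ a] mtrace_smult[where d=a])
  have "mtrace (measure_prepare c F A) = (\<Sum>i<c. mtrace (F i * A))"
    by (simp add: mtrace_def[of "measure_prepare c F A"]) (simp add: measure_prepare_def)
  then show "mtrace (measure_prepare c F A) = mtrace A" using povm_sum_mtrace[OF F A] by simp
next
  fix k A assume "psd (k * a) A"
  then show "psd (k * c) (id_tensor k a c (measure_prepare c F) A)"
    by (rule psd_id_tensor_measure_prepare) (use povmD(1)[OF F] in auto)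
qed

lemma classical_measure_prepare: "classical_fst k q (measure_prepare (k * q) F A)"
  by (auto simp: classical_fst_def measure_prepare_def)

section \<open>Partial evaluation of a bipartite state\<close>

text \<open>\<open>slice a c A \<rho>\<close> is the partial trace over the first factor of \<open>(A \<otimes> 1) \<rho>\<close>.\<close>

definition slice :: "nat \<Rightarrow> nat \<Rightarrow> complex mat \<Rightarrow> complex mat \<Rightarrow> complex mat" where
  "slice a c A \<rho> = mat c c (\<lambda>(u, v). \<Sum>s<a. \<Sum>r<a. A $$ (s, r) * \<rho> $$ (r * c + u, s * c + v))"

lemma slice_carrier [simp, intro]: "slice a c A \<rho> \<in> carrier_mat c c"
  by (simp add: slice_def)

text \<open>For measurement operators \<open>A\<close> of the relay and \<open>D\<close> of the
  receiver this is the joint probability of their outcomes in one block.\<close>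

lemma mtrace_mult_slice:
  assumes A: "A \<in> carrier_mat a a" and D: "D \<in> carrier_mat c c" and \<rho>: "\<rho> \<in> carrier_mat (a * c) (a * c)"
  shows "mtrace (D * slice a c A \<rho>) = mtrace (kron A D * \<rho>)"
proof -
  have "mtrace (kron A D * \<rho>) = (\<Sum>s<a. \<Sum>i<c. \<Sum>r<a. \<Sum>j<c. A $$ (s, r) * D $$ (i, j) * \<rho> $$ (r * c + j, s * c + i))"
    unfolding mtrace_mult_prod_index[OF kron_carrier[OF A D] \<rho>]
    by (rule sum.cong[OF refl], rule sum.cong[OF refl], rule sum.cong[OF refl], rule sum.cong[OF refl])
      (simp add: kron_index[OF A D])
  also have "\<dots> = (\<Sum>i<c. \<Sum>s<a. \<Sum>r<a. \<Sum>j<c. A $$ (s, r) * D $$ (i, j) * \<rho> $$ (r * c + j, s * c + i))"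
    by (rule sum.swap)
  also have "\<dots> = (\<Sum>i<c. \<Sum>s<a. \<Sum>j<c. \<Sum>r<a. A $$ (s, r) * D $$ (i, j) * \<rho> $$ (r * c + j, s * c + i))"
    by (rule sum.cong[OF refl], rule sum.cong[OF refl], rule sum.swap)
  also have "\<dots> = (\<Sum>i<c. \<Sum>j<c. \<Sum>s<a. \<Sum>r<a. A $$ (s, r) * D $$ (i, j) * \<rho> $$ (r * c + j, s * c + i))"
    by (rule sum.cong[OF refl], rule sum.swap)
  also have "\<dots> = mtrace (D * slice a c A \<rho>)"
    unfolding mtrace_mult[OF D slice_carrier]
    by (rule sum.cong[OF refl], rule sum.cong[OF refl]) (simp add: slice_def sum_distrib_left mult_ac)
  finally show ?thesis by simp
qed

text \<open>The operator \<open>kron (1 - A) (1 - D)\<close> is positive, and expanding it bounds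
  \<open>kron A D\<close> from below by the identity minus the two local complements. As the
  measurements act on different factors, the errors add linearly.\<close>

lemma mtrace_kron_union_bound:
  assumes A: "psd a A" "psd a (1\<^sub>m a - A)" and D: "psd c D" "psd c (1\<^sub>m c - D)"
    and \<rho>: "density (a * c) \<rho>"
  shows "1 - Re (mtrace ((1\<^sub>m a - A) * ptrace_snd a c \<rho>)) - Re (mtrace ((1\<^sub>m c - D) * ptrace_fst a c \<rho>))
    \<le> Re (mtrace (kron A D * \<rho>))"
proof -
  have Ac: "A \<in> carrier_mat a a" and Dc: "D \<in> carrier_mat c c" and \<rho>c: "\<rho> \<in> carrier_mat (a * c) (a * c)"
    using A D \<rho> by (auto simp: density_def)
  let ?n = "a * c"
  have A': "1\<^sub>m a - A \<in> carrier_mat a a" and D': "1\<^sub>m c - D \<in> carrier_mat c c" using Ac Dc by auto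
  have c: "kron (1\<^sub>m a - A) (1\<^sub>m c) \<in> carrier_mat ?n ?n" "kron (1\<^sub>m a) (1\<^sub>m c - D) \<in> carrier_mat ?n ?n"
    "kron (1\<^sub>m a - A) (1\<^sub>m c - D) \<in> carrier_mat ?n ?n"
    using A' D' by auto
  have "kron A D = 1\<^sub>m ?n - kron (1\<^sub>m a - A) (1\<^sub>m c) - kron (1\<^sub>m a) (1\<^sub>m c - D) + kron (1\<^sub>m a - A) (1\<^sub>m c - D)"
  proof (rule eq_mat_prodI[of _ a c a c])
    show "1\<^sub>m ?n - kron (1\<^sub>m a - A) (1\<^sub>m c) - kron (1\<^sub>m a) (1\<^sub>m c - D) + kron (1\<^sub>m a - A) (1\<^sub>m c - D)
      \<in> carrier_mat ?n ?n" using c by auto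
    fix x k y l assume *: "x < a" "k < c" "y < a" "l < c"
    note lt = prod_index_less[OF *(1,2)] prod_index_less[OF *(3,4)]
    have one: "1\<^sub>m ?n $$ (x * c + k, y * c + l) = (if x = y \<and> k = l then 1 else (0 :: complex))"
      using lt * by (auto simp: prod_index_eq_iff)
    have "(1\<^sub>m ?n - kron (1\<^sub>m a - A) (1\<^sub>m c) - kron (1\<^sub>m a) (1\<^sub>m c - D) + kron (1\<^sub>m a - A) (1\<^sub>m c - D)) $$ (x * c + k, y * c + l)
      = 1\<^sub>m ?n $$ (x * c + k, y * c + l) - kron (1\<^sub>m a - A) (1\<^sub>m c) $$ (x * c + k, y * c + l)
        - kron (1\<^sub>m a) (1\<^sub>m c - D) $$ (x * c + k, y * c + l) + kron (1\<^sub>m a - A) (1\<^sub>m c - D) $$ (x * c + k, y * c + l)"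
      using lt c[THEN carrier_matD(1)] c[THEN carrier_matD(2)] by simp
    also have "\<dots> = A $$ (x, y) * D $$ (k, l)"
      unfolding one kron_index[OF A' one_carrier_mat *(1,2,3,4)] kron_index[OF one_carrier_mat D' *(1,2,3,4)]
        kron_index[OF A' D' *(1,2,3,4)]
      using * carrier_matD[OF Ac] carrier_matD[OF Dc] by (simp add: algebra_simps)
    finally show "kron A D $$ (x * c + k, y * c + l)
      = (1\<^sub>m ?n - kron (1\<^sub>m a - A) (1\<^sub>m c) - kron (1\<^sub>m a) (1\<^sub>m c - D) + kron (1\<^sub>m a - A) (1\<^sub>m c - D)) $$ (x * c + k, y * c + l)"
      unfolding kron_index[OF Ac Dc *(1,2,3,4)] by simp
  qed (use Ac Dc in auto)
  then have "mtrace (kron A D * \<rho>) = mtrace \<rho> - mtrace (kron (1\<^sub>m a - A) (1\<^sub>m c) * \<rho>)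
      - mtrace (kron (1\<^sub>m a) (1\<^sub>m c - D) * \<rho>) + mtrace (kron (1\<^sub>m a - A) (1\<^sub>m c - D) * \<rho>)"
    using c \<rho>c left_mult_one_mat[OF \<rho>c]
    by (simp add: add_mult_distrib_mat[of _ ?n ?n _ _ ?n] minus_mult_distrib_mat[of _ ?n ?n _ _ ?n]
        mtrace_add[of _ ?n] mtrace_minus[of _ ?n])
  moreover have "0 \<le> mtrace (kron (1\<^sub>m a - A) (1\<^sub>m c - D) * \<rho>)"
    using \<rho> by (intro mtrace_psd_mult_nonneg[of "a * c"] psd_kron A D) (simp add: density_def)
  moreover have "mtrace \<rho> = 1" using \<rho> by (simp add: density_def)
  ultimately show ?thesis
    unfolding mtrace_mult_ptrace_snd[OF A' \<rho>c] mtrace_mult_ptrace_fst[OF D' \<rho>c] by (simp add: less_eq_complex_def)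
qed

section \<open>The decode-forward code of a codebook\<close>

text \<open>
  The message of block \<open>j\<close> of \<open>w < M ^ (b - 1)\<close> is a base-\<open>M\<close> digit of \<open>w\<close>, so that the fictitious messages of
  the blocks \<open>0\<close> and \<open>b\<close> are \<open>0\<close>.
\<close>

definition base_digit :: "nat \<Rightarrow> nat \<Rightarrow> nat \<Rightarrow> nat" where
  "base_digit M w j = (if j = 0 then 0 else (w div M ^ (j - 1)) mod M)"

lemma base_digit_0 [simp]: "base_digit M w 0 = 0"
  by (simp add: base_digit_def)

lemma base_digit_less: "0 < M \<Longrightarrow> base_digit M w j < M"
  by (simp add: base_digit_def)

lemma base_digit_top: "m < M \<Longrightarrow> w < M ^ j \<Longrightarrow> base_digit M (m * M ^ j + w) (Suc j) = m"
  by (simp add: base_digit_def)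

lemma base_digit_low:
  assumes "0 < M" "i \<le> j" shows "base_digit M (m * M ^ j + w) i = base_digit M w i"
proof (cases i)
  case (Suc k)
  \<comment> \<open>The digit \<open>Suc k\<close> is read after division by \<open>M ^ k\<close>;
    since \<open>k < j\<close>, the leading summand is still a multiple of \<open>M\<close>
    then.\<close>
  then obtain l where l: "j = Suc k + l" using assms le_Suc_ex by blast
  have "m * M ^ j + w = m * M ^ Suc l * M ^ k + w" by (simp add: l power_add)
  then have "(m * M ^ j + w) div M ^ k = m * M ^ Suc l + w div M ^ k"
    using assms by (simp only: ) (simp add: div_mult_self3)
  moreover have "(m * M ^ Suc l + w div M ^ k) mod M = w div M ^ k mod M"
    by (simp add: mult.assoc[symmetric] mult.commute[of m]) (metis mod_mult_self3 mult.assoc mult.commute)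
  ultimately show ?thesis by (simp add: base_digit_def Suc)
qed simp

text \<open>
  The rows of the codebook \<open>c\<close> are indexed by the message of the previous block: \<open>c m' m\<close> is the pair of the
  symbols sent when the relay has decoded \<open>m'\<close> and the new message is \<open>m\<close>.  Knowing \<open>m'\<close>, the relay decodes \<open>m\<close>
  by \<open>L2 m'\<close>; knowing \<open>m\<close>, the receiver decodes \<open>m'\<close> by \<open>L3 m\<close>, going through the blocks backwards.
\<close>

locale relay_codebook =
  fixes k1 k2 d2 d3 M :: nat and N :: "nat \<times> nat \<Rightarrow> complex mat"
    and c :: "nat \<Rightarrow> nat \<Rightarrow> nat \<times> nat" and L2 L3 :: "nat \<Rightarrow> nat \<Rightarrow> complex mat"
  assumes channel: "cq_relay_channel k1 k2 d2 d3 N" and M: "0 < M"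
    and c_mem: "\<And>i m. i < M \<Longrightarrow> m < M \<Longrightarrow> c i m \<in> {..<k1} \<times> {..<k2}"
    and c_snd: "\<And>i m. i < M \<Longrightarrow> m < M \<Longrightarrow> snd (c i m) = snd (c i 0)"
    and L2: "\<And>i. i < M \<Longrightarrow> povm d2 {..<M} (L2 i)"
    and L3: "\<And>m. m < M \<Longrightarrow> povm d3 {..<M} (L3 m)"
begin

abbreviation digit :: "nat \<Rightarrow> nat \<Rightarrow> nat" where "digit \<equiv> base_digit M"

lemmas digit_less [simp] = base_digit_less[OF M]

text \<open>The measurement at the start of round \<open>j\<close> decodes block
  \<open>j - 1\<close>. For \<open>j = 1\<close> the relay holds a one-dimensional system and the
  outcome is surely 0, the fictitious message. Later the second factor is the memory, whose content
  \<open>i\<close> selects the measurement \<open>L2 i\<close> of the channel output.\<close>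

definition relay_povm :: "nat \<Rightarrow> nat \<Rightarrow> complex mat" where
  "relay_povm j m = (if j = 1 then (if m = 0 then 1\<^sub>m 1 else 0\<^sub>m 1 1)
     else mat_sum (d2 * M) (\<lambda>i. kron (L2 i m) (ketbra M i)) {..<M})"

text \<open>The label \<open>i\<close> stands for the symbol \<open>i div M\<close> and the estimate
  \<open>i mod M\<close>. Labels whose symbol is not the one assigned to the estimate get the
  operator 0, so the symbol is a function of the estimate.\<close>

definition relay_test :: "nat \<Rightarrow> nat \<Rightarrow> complex mat" where
  "relay_test j i = (if i div M = snd (c (i mod M) 0) then relay_povm j (i mod M)
     else 0\<^sub>m (if j = 1 then 1 else d2 * M) (if j = 1 then 1 else d2 * M))"

text \<open>This acts on the output of round \<open>j + 1\<close> and tests the message of block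
  \<open>j\<close>, given that of block \<open>j + 1\<close>. For \<open>j = 0\<close> that message
  is the known 0, hence the identity.\<close>

definition receiver_povm :: "nat \<Rightarrow> nat \<Rightarrow> complex mat" where
  "receiver_povm w j = (if j = 0 then 1\<^sub>m d3 else L3 (digit w (Suc j)) (digit w j))"

text \<open>Decoding runs backwards and each measurement depends on the later outcome, but for a
  fixed \<open>w\<close> all outcomes are prescribed, so the operator is a tensor product.\<close>

primrec receiver_dec :: "nat \<Rightarrow> nat \<Rightarrow> complex mat" where
  "receiver_dec w 0 = 1\<^sub>m 1"
| "receiver_dec w (Suc j) = kron (receiver_dec w j) (receiver_povm w j)"

definition code :: "nat \<Rightarrow> relay_code" where
  "code b = \<lparr>msgs = {..<M ^ (b - 1)},
     sender = (\<lambda>w j. fst (c (digit w (j - 1)) (digit w j))),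
     mem_dim = (\<lambda>_. M),
     relay_op = (\<lambda>j. measure_prepare (k2 * M) (relay_test j)),
     decoder = (\<lambda>w. receiver_dec w b)\<rparr>"

lemma code_simps [simp]:
  "msgs (code b) = {..<M ^ (b - 1)}" "sender (code b) w j = fst (c (digit w (j - 1)) (digit w j))"
  "mem_dim (code b) j = M" "relay_op (code b) j = measure_prepare (k2 * M) (relay_test j)"
  "decoder (code b) w = receiver_dec w b"
  by (simp_all add: code_def)

lemma relay_dim_code: "relay_dim d2 (code b) j = (if j = 0 then 1 else d2 * M)"
  by (simp add: relay_dim_def)

lemma povm_relay_povm:
  "povm (if j = 1 then 1 else d2 * M) {..<M} (relay_povm j)"
proof (cases "j = 1")
  case True
  have "mat_sum 1 (relay_povm j) {..<M} = 1\<^sub>m 1"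
  proof (rule eq_matI)
    fix i k assume ik: "i < dim_row (1\<^sub>m 1)" "k < dim_col (1\<^sub>m 1)"
    have "mat_sum 1 (relay_povm j) {..<M} $$ (i, k) = (\<Sum>m<M. relay_povm j m $$ (i, k))"
      by (rule mat_sum_index) (use ik in auto)
    also have "\<dots> = (\<Sum>m<M. if m = 0 then 1\<^sub>m 1 $$ (i, k) else 0)"
      by (rule sum.cong[OF refl]) (use ik True in \<open>auto simp: relay_povm_def\<close>)
    finally show "mat_sum 1 (relay_povm j) {..<M} $$ (i, k) = 1\<^sub>m 1 $$ (i, k)" using ik M by simp
  qed (auto simp: mat_sum_def)
  moreover have "psd 1 (relay_povm j m)" for m using True by (simp add: relay_povm_def)
  ultimately show ?thesis using True by (simp add: povm_def)
next
  case False
  have psd: "psd (d2 * M) (relay_povm j m)" if "m < M" for m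
    using False povmD(1)[OF L2] that by (auto simp: relay_povm_def intro!: psd_mat_sum psd_kron)
  have "mat_sum (d2 * M) (relay_povm j) {..<M} = 1\<^sub>m (d2 * M)"
  proof (rule eq_mat_prodI[of _ d2 M d2 M])
    fix x k y l assume *: "x < d2" "k < M" "y < d2" "l < M"
    note lt = prod_index_less[OF *(1,2)] prod_index_less[OF *(3,4)]
    have "mat_sum (d2 * M) (relay_povm j) {..<M} $$ (x * M + k, y * M + l)
      = (\<Sum>m<M. \<Sum>i<M. kron (L2 i m) (ketbra M i) $$ (x * M + k, y * M + l))"
      using False lt by (simp add: relay_povm_def)
    also have "\<dots> = (\<Sum>m<M. \<Sum>i<M. L2 i m $$ (x, y) * ketbra M i $$ (k, l))"
      by (rule sum.cong[OF refl], rule sum.cong[OF refl])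
        (use * povmD(3)[OF L2] in \<open>auto simp: kron_index[of _ d2 d2 _ M M]\<close>)
    also have "\<dots> = (\<Sum>i<M. (\<Sum>m<M. L2 i m $$ (x, y)) * ketbra M i $$ (k, l))"
      by (subst sum.swap) (simp add: sum_distrib_right)
    also have "\<dots> = (\<Sum>i<M. 1\<^sub>m d2 $$ (x, y) * ketbra M i $$ (k, l))"
    proof (rule sum.cong[OF refl])
      fix i assume "i \<in> {..<M}"
      then have "mat_sum d2 (L2 i) {..<M} $$ (x, y) = 1\<^sub>m d2 $$ (x, y)" using povmD(2)[OF L2] by simp
      then show "(\<Sum>m<M. L2 i m $$ (x, y)) * ketbra M i $$ (k, l) = 1\<^sub>m d2 $$ (x, y) * ketbra M i $$ (k, l)"
        using * by simp
    qed
    also have "\<dots> = (\<Sum>i<M. if i = k then (if x = y \<and> k = l then 1 else 0) else 0)"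
      by (rule sum.cong[OF refl]) (use * in \<open>auto simp: ketbra_def\<close>)
    also have "\<dots> = 1\<^sub>m (d2 * M) $$ (x * M + k, y * M + l)"
      using * lt by (auto simp: prod_index_eq_iff)
    finally show "mat_sum (d2 * M) (relay_povm j) {..<M} $$ (x * M + k, y * M + l)
      = 1\<^sub>m (d2 * M) $$ (x * M + k, y * M + l)" .
  qed auto
  then show ?thesis using False psd by (simp add: povm_def)
qed

text \<open>Every estimate \<open>m\<close> contributes through exactly one label
  \<open>x * M + m\<close>, that of its own symbol, so the sum over labels collapses to the sum over
  estimates.\<close>

lemma povm_relay_test:
  "povm (if j = 1 then 1 else d2 * M) {..<k2 * M} (relay_test j)"
proof -
  let ?a = "if j = 1 then 1 else d2 * M"
  note P = povm_relay_povm[of j]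
  have "psd ?a (relay_test j i)" if "i < k2 * M" for i
    using povmD(1)[OF P, of "i mod M"] M by (auto simp: relay_test_def)
  moreover have "mat_sum ?a (relay_test j) {..<k2 * M} = mat_sum ?a (relay_povm j) {..<M}"
  proof (rule eq_matI)
    fix r s assume rs: "r < dim_row (mat_sum ?a (relay_povm j) {..<M})" "s < dim_col (mat_sum ?a (relay_povm j) {..<M})"
    then have rs: "r < ?a" "s < ?a" by (auto simp: mat_sum_def)
    have "mat_sum ?a (relay_test j) {..<k2 * M} $$ (r, s) = (\<Sum>x<k2. \<Sum>m<M. relay_test j (x * M + m) $$ (r, s))"
      unfolding mat_sum_index[OF rs] sum_prod_index ..
    also have "\<dots> = (\<Sum>x<k2. \<Sum>m<M. if x = snd (c m 0) then relay_povm j m $$ (r, s) else 0)"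
      by (rule sum.cong[OF refl], rule sum.cong[OF refl]) (use rs in \<open>auto simp: relay_test_def\<close>)
    also have "\<dots> = (\<Sum>m<M. \<Sum>x<k2. if x = snd (c m 0) then relay_povm j m $$ (r, s) else 0)"
      by (rule sum.swap)
    also have "\<dots> = (\<Sum>m<M. relay_povm j m $$ (r, s))"
      by (rule sum.cong[OF refl]) (use c_mem M in \<open>auto simp: mem_Times_iff\<close>)
    finally show "mat_sum ?a (relay_test j) {..<k2 * M} $$ (r, s) = mat_sum ?a (relay_povm j) {..<M} $$ (r, s)"
      unfolding mat_sum_index[OF rs] .
  qed (auto simp: mat_sum_def)
  ultimately show ?thesis using povmD(2)[OF P] by (simp add: povm_def)
qed

lemma psd_receiver_povm: "psd d3 (receiver_povm w j)"
  unfolding receiver_povm_def using povmD(1)[OF L3[OF digit_less]] by auto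

lemma psd_receiver_dec: "psd (d3 ^ j) (receiver_dec w j)"
proof (induction j)
  case (Suc j)
  then show ?case using psd_kron[OF Suc.IH psd_receiver_povm, of w j] by (simp add: mult.commute)
qed simp

lemma receiver_dec_carrier [simp]: "receiver_dec w j \<in> carrier_mat (d3 ^ j) (d3 ^ j)"
  using psd_receiver_dec by auto

text \<open>The first \<open>Suc i\<close> factors read only digits up to
  \<open>Suc i \<le> j\<close>, which a leading digit above position \<open>j\<close> does not
  affect.\<close>

lemma receiver_dec_low:
  "receiver_dec (m * M ^ j + w) (Suc i) = receiver_dec w (Suc i)" if "Suc i \<le> j"
  using that
proof (induction i)
  case (Suc i)
  then show ?case by (simp add: receiver_povm_def base_digit_low[OF M] del: receiver_dec.simps(2)) (simp add: receiver_povm_def base_digit_low[OF M])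
qed (simp add: receiver_povm_def)

text \<open>Completeness of the backward decoder needs the last digit \<open>m\<close> as a
  parameter: for each value \<open>i\<close> of the next lower digit, summing over the remaining
  ones gives the identity by induction, and then \<open>L3 m\<close> is complete in
  \<open>i\<close>. The case \<open>m = 0\<close> is the decoder of the code.\<close>

lemma sum_receiver_dec:
  assumes "m < M" "u < d3 ^ Suc j" "v < d3 ^ Suc j"
  shows "(\<Sum>w<M ^ j. receiver_dec (m * M ^ j + w) (Suc j) $$ (u, v)) = 1\<^sub>m (d3 ^ Suc j) $$ (u, v)"
  using assms
proof (induction j arbitrary: m u v)
  case 0
  have "kron (1\<^sub>m 1) (1\<^sub>m d3) = (1\<^sub>m d3 :: complex mat)" using kron_one[of 1 d3] by simp
  then show ?case by (simp add: receiver_povm_def)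
next
  case (Suc j)
  let ?n = "d3 ^ Suc j"
  have "u < ?n * d3" "v < ?n * d3" using Suc.prems by (auto simp: mult.commute)
  then obtain U s V t where uv: "U < ?n" "s < d3" "u = U * d3 + s" "V < ?n" "t < d3" "v = V * d3 + t"
    by (metis prod_index_cases)
  have "(\<Sum>w<M ^ Suc j. receiver_dec (m * M ^ Suc j + w) (Suc (Suc j)) $$ (u, v))
    = (\<Sum>i<M. \<Sum>w<M ^ j. receiver_dec (m * M ^ Suc j + (i * M ^ j + w)) (Suc (Suc j)) $$ (u, v))"
    using sum_prod_index[of "\<lambda>w. receiver_dec (m * M ^ Suc j + w) (Suc (Suc j)) $$ (u, v)" M "M ^ j"]
    by (simp only: power_Suc)
  also have "\<dots> = (\<Sum>i<M. \<Sum>w<M ^ j. receiver_dec (i * M ^ j + w) (Suc j) $$ (U, V) * L3 m i $$ (s, t))"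
  proof (rule sum.cong[OF refl], rule sum.cong[OF refl])
    fix i w assume "i \<in> {..<M}" "w \<in> {..<M ^ j}"
    then have iw: "i < M" "w < M ^ j" by auto
    have lt: "i * M ^ j + w < M ^ Suc j" using prod_index_less[OF iw] by simp
    have "receiver_dec (m * M ^ Suc j + (i * M ^ j + w)) (Suc (Suc j))
      = kron (receiver_dec (i * M ^ j + w) (Suc j)) (L3 m i)"
      unfolding receiver_dec.simps(2)[of _ "Suc j"] receiver_dec_low[OF order_refl] receiver_povm_def
      using base_digit_top[OF Suc.prems(1) lt] base_digit_low[OF M, of "Suc j" "Suc j" m "i * M ^ j + w"] base_digit_top[OF iw] by simp
    then show "receiver_dec (m * M ^ Suc j + (i * M ^ j + w)) (Suc (Suc j)) $$ (u, v)
      = receiver_dec (i * M ^ j + w) (Suc j) $$ (U, V) * L3 m i $$ (s, t)"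
      using kron_index[OF receiver_dec_carrier povmD(3)[OF L3[OF Suc.prems(1)]], of i U "Suc j" s V t] iw uv by simp
  qed
  also have "\<dots> = (\<Sum>i<M. 1\<^sub>m ?n $$ (U, V) * L3 m i $$ (s, t))"
    by (rule sum.cong[OF refl]) (use Suc.IH uv in \<open>simp add: sum_distrib_right[symmetric]\<close>)
  also have "\<dots> = 1\<^sub>m ?n $$ (U, V) * mat_sum d3 (L3 m) {..<M} $$ (s, t)"
    using uv by (simp add: sum_distrib_left)
  also have "\<dots> = 1\<^sub>m ?n $$ (U, V) * 1\<^sub>m d3 $$ (s, t)"
    unfolding povmD(2)[OF L3[OF Suc.prems(1)]] ..
  also have "\<dots> = 1\<^sub>m (?n * d3) $$ (u, v)"
    using uv prod_index_less[OF uv(1,2)] prod_index_less[OF uv(4,5)] by (auto simp: prod_index_eq_iff)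
  finally show ?case by (simp add: mult.commute)
qed

lemma povm_receiver_dec: "povm (d3 ^ Suc n) {..<M ^ n} (\<lambda>w. receiver_dec w (Suc n))"
  unfolding povm_def
proof
  show "\<forall>m\<in>{..<M ^ n}. psd (d3 ^ Suc n) (receiver_dec m (Suc n))" using psd_receiver_dec by blast
  show "mat_sum (d3 ^ Suc n) (\<lambda>w. receiver_dec w (Suc n)) {..<M ^ n} = 1\<^sub>m (d3 ^ Suc n)"
    using sum_receiver_dec[OF M, of _ n]
    by (intro eq_matI) (auto simp: mat_sum_def simp del: receiver_dec.simps(2) power_Suc)
qed

text \<open>The rate is solved from the requirement that the \<open>M ^ n\<close> messages number
  exactly \<open>2 powr\<close> (rounds times rate).\<close>

lemma is_relay_code:
  "is_relay_code k1 k2 d2 d3 (Suc n) (real n * log 2 (real M) / real (Suc n)) (code (Suc n))"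
proof -
  have "real (card {..<M ^ n}) = 2 powr (real n * log 2 (real M))"
    using M by (simp add: powr_powr[symmetric] mult.commute[of "real n"] powr_realpow)
  moreover have "fst (c (digit m (j - 1)) (digit m j)) < k1" for m j
    using c_mem[OF digit_less digit_less] by (auto simp: mem_Times_iff)
  moreover have "quantum_channel (if j - 1 = 0 then 1 else d2 * M) (k2 * M) (measure_prepare (k2 * M) (relay_test j))"
    if "j \<in> {1..Suc n}" for j
    using quantum_channel_measure_prepare[OF povm_relay_test[of j]] that by (cases "j = 1") auto
  ultimately show ?thesis
    unfolding is_relay_code_def relay_dim_code code_simps
    using povm_receiver_dec[of n] M
    by (auto simp: classical_measure_prepare code_def simp del: receiver_dec.simps(2) power_Suc)
qed

end

section \<open>Evolution of the joint state\<close>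

lemma id_tensor_index:
  assumes "U < k" "V < k" "p < c" "q < c"
  shows "id_tensor k a c \<Phi> A $$ (U * c + p, V * c + q)
    = \<Phi> (mat a a (\<lambda>(r, s). A $$ (U * a + r, V * a + s))) $$ (p, q)"
  using assms prod_index_less[of U k p c] prod_index_less[of V k q c] by (simp add: id_tensor_def)

lemma split4_index:
  assumes "u < d3" "s < d2" "a < q"
  shows "split4 d3 d2 q (((U * d3 + u) * d2 + s) * q + a) = (U, u, s, a)"
proof -
  let ?i = "((U * d3 + u) * d2 + s) * q + a"
  have 1: "?i div q = (U * d3 + u) * d2 + s" using assms by simp
  have 2: "?i div (d2 * q) = U * d3 + u"
    using assms 1 by (metis div_mult2_eq div_prod_index mult.commute)
  have 3: "?i div (d3 * d2 * q) = U"
    using assms 2 by (metis div_mult2_eq div_prod_index mult.assoc mult.commute)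
  show ?thesis unfolding split4_def 1 2 3 using assms by simp
qed

lemma channel_use_index:
  assumes "U < e" "V < e" "u < d3" "v < d3" "s < d2" "t < d2" "a < q" "b < q"
  shows "channel_use e k2 d2 d3 q \<rho> \<sigma> $$ (((U * d3 + u) * d2 + s) * q + a, ((V * d3 + v) * d2 + t) * q + b)
    = (\<Sum>x<k2. \<sigma> $$ (U * (k2 * q) + x * q + a, V * (k2 * q) + x * q + b) * \<rho> x $$ (s * d3 + u, t * d3 + v))"
proof -
  have "((U * d3 + u) * d2 + s) * q + a < e * d3 * d2 * q" "((V * d3 + v) * d2 + t) * q + b < e * d3 * d2 * q"
    using assms by (intro prod_index_less; simp)+
  then show ?thesis unfolding channel_use_def
    by (simp add: split4_index[OF assms(3,5,7)] split4_index[OF assms(4,6,8)])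
qed

context relay_codebook
begin

abbreviation relay_sym :: "nat \<Rightarrow> nat" where "relay_sym m \<equiv> snd (c m 0)"

abbreviation sender_sym :: "nat \<Rightarrow> nat \<Rightarrow> nat" where
  "sender_sym w j \<equiv> fst (c (digit w (j - 1)) (digit w j))"

lemma relay_sym_less: "m < M \<Longrightarrow> relay_sym m < k2"
  using c_mem[of m 0] M by (auto simp: mem_Times_iff)

lemma output_density: "m < M \<Longrightarrow> density (d2 * d3) (N (sender_sym w j, relay_sym m))"
  using channel relay_sym_less[of m] c_mem[OF digit_less digit_less, of w "j - 1" w j]
  by (auto simp: cq_relay_channel_def mem_Times_iff)

lemma output_carrier: "m < M \<Longrightarrow> N (sender_sym w j, relay_sym m) \<in> carrier_mat (d2 * d3) (d2 * d3)"
  using output_density by (auto simp: density_def)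

text \<open>When the relay's estimate is right, its symbol, read off column 0 of the row, is that of
  the codeword, because a row shares its relay symbol.\<close>

lemma output_codeword: "N (sender_sym w (Suc j), relay_sym (digit w j)) = N (c (digit w j) (digit w (Suc j)))"
  using c_snd[OF digit_less digit_less, of w j w "Suc j"] by (simp add: prod_eq_iff) (metis prod.collapse)

text \<open>
  After \<open>j + 1\<close> rounds, \<open>branch w j m\<close> is the unnormalised state of the receiver's systems of the first \<open>j\<close> rounds
  on the event that the relay's memory holds \<open>m\<close>.
\<close>

primrec branch :: "nat \<Rightarrow> nat \<Rightarrow> nat \<Rightarrow> complex mat" where
  "branch w 0 m = (if m = 0 then 1\<^sub>m 1 else 0\<^sub>m 1 1)"
| "branch w (Suc j) m = mat_sum (d3 ^ Suc j)
     (\<lambda>i. kron (branch w j i) (slice d2 d3 (L2 i m) (N (sender_sym w (Suc j), relay_sym i)))) {..<M}"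

lemma branch_carrier [simp]: "branch w j m \<in> carrier_mat (d3 ^ j) (d3 ^ j)"
  by (cases j) auto

abbreviation state :: "nat \<Rightarrow> nat \<Rightarrow> nat \<Rightarrow> complex mat" where
  "state n w j \<equiv> joint_state k2 d2 d3 N (code n) w j"

text \<open>The memory is written classically, which removes the entries with
  \<open>a \<noteq> b\<close>; and only the label carrying the symbol of \<open>a\<close> has a
  nonzero operator, which removes the sum over channel inputs.\<close>

lemma state_step:
  fixes n :: nat
  assumes "U < d3 ^ j" "V < d3 ^ j" "u < d3" "v < d3" "s < d2" "t < d2" "a < M" "b < M"
  defines "r \<equiv> relay_dim d2 (code n) j"
  shows "state n w (Suc j) $$ (((U * d3 + u) * d2 + s) * M + a, ((V * d3 + v) * d2 + t) * M + b)
    = (if a = b then mtrace (relay_povm (Suc j) a * mat r r (\<lambda>(p, q). state n w j $$ (U * r + p, V * r + q)))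
         * N (sender_sym w (Suc j), relay_sym a) $$ (s * d3 + u, t * d3 + v) else 0)"
proof -
  let ?A = "mat r r (\<lambda>(p, q). state n w j $$ (U * r + p, V * r + q))"
  have r: "r = (if Suc j = 1 then 1 else d2 * M)" unfolding r_def by (simp add: relay_dim_code)
  have zero: "mtrace (0\<^sub>m r r * ?A) = 0" by (subst left_mult_zero_mat[of _ r r]) (auto simp: mtrace_def)
  have tst: "relay_test (Suc j) (x * M + a) = (if x = relay_sym a then relay_povm (Suc j) a else 0\<^sub>m r r)" for x
    using assms(7) unfolding relay_test_def r by simp
  have "state n w (Suc j) $$ (((U * d3 + u) * d2 + s) * M + a, ((V * d3 + v) * d2 + t) * M + b)
    = (\<Sum>x<k2. id_tensor (d3 ^ j) r (k2 * M) (measure_prepare (k2 * M) (relay_test (Suc j))) (state n w j)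
          $$ (U * (k2 * M) + x * M + a, V * (k2 * M) + x * M + b)
        * N (sender_sym w (Suc j), x) $$ (s * d3 + u, t * d3 + v))"
    unfolding joint_state.simps code_simps r_def[symmetric]
    by (subst channel_use_index[OF assms(1-8)]) simp
  also have "\<dots> = (\<Sum>x<k2. if x = relay_sym a then (if a = b then mtrace (relay_povm (Suc j) a * ?A)
      * N (sender_sym w (Suc j), relay_sym a) $$ (s * d3 + u, t * d3 + v) else 0) else 0)"
  proof (rule sum.cong[OF refl])
    fix x assume "x \<in> {..<k2}"
    then have p: "x * M + a < k2 * M" "x * M + b < k2 * M" using assms by (auto intro: prod_index_less)
    have "id_tensor (d3 ^ j) r (k2 * M) (measure_prepare (k2 * M) (relay_test (Suc j))) (state n w j)
          $$ (U * (k2 * M) + x * M + a, V * (k2 * M) + x * M + b)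
      = (if a = b then mtrace (relay_test (Suc j) (x * M + a) * ?A) else 0)"
      unfolding add.assoc id_tensor_index[OF assms(1,2) p] using p by (simp add: measure_prepare_def)
    then show "id_tensor (d3 ^ j) r (k2 * M) (measure_prepare (k2 * M) (relay_test (Suc j))) (state n w j)
          $$ (U * (k2 * M) + x * M + a, V * (k2 * M) + x * M + b)
        * N (sender_sym w (Suc j), x) $$ (s * d3 + u, t * d3 + v)
      = (if x = relay_sym a then (if a = b then mtrace (relay_povm (Suc j) a * ?A)
      * N (sender_sym w (Suc j), relay_sym a) $$ (s * d3 + u, t * d3 + v) else 0) else 0)"
      using zero tst[of x] by (cases "a = b") simp_all
  qed
  also have "\<dots> = (if a = b then mtrace (relay_povm (Suc j) a * ?A)
         * N (sender_sym w (Suc j), relay_sym a) $$ (s * d3 + u, t * d3 + v) else 0)"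
    using relay_sym_less[OF assms(7)] by simp
  finally show ?thesis .
qed

text \<open>The previous output and memory of the relay are consumed by its measurement, and the
  next output is prepared from the classical label \<open>a\<close> alone. Given the memory content,
  the receiver's past is therefore in product with the newest output.\<close>

lemma state_index:
  assumes "U < d3 ^ j" "V < d3 ^ j" "u < d3" "v < d3" "s < d2" "t < d2" "a < M" "b < M"
  shows "state n w (Suc j) $$ (((U * d3 + u) * d2 + s) * M + a, ((V * d3 + v) * d2 + t) * M + b)
    = (if a = b then branch w j a $$ (U, V) * N (sender_sym w (Suc j), relay_sym a) $$ (s * d3 + u, t * d3 + v) else 0)"
  using assms
proof (induction j arbitrary: U V u v s t a b)
  case 0
  have "mtrace (relay_povm 1 a * mat 1 1 (\<lambda>(p, q). state n w 0 $$ (p, q))) = branch w 0 a $$ (0, 0)"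
    by (simp add: mtrace_def relay_povm_def scalar_prod_def)
  moreover have "U = 0" "V = 0" using 0 by auto
  ultimately show ?case unfolding state_step[OF 0]
    by (cases "a = b") (simp_all add: relay_dim_def del: joint_state.simps branch.simps)
next
  case (Suc j)
  let ?r = "d2 * M"
  have "U < d3 ^ j * d3" "V < d3 ^ j * d3" using Suc.prems by (auto simp: mult.commute)
  then obtain U' u' V' v' where UV: "U' < d3 ^ j" "u' < d3" "U = U' * d3 + u'" "V' < d3 ^ j" "v' < d3" "V = V' * d3 + v'"
    by (metis prod_index_cases)
  let ?A = "mat ?r ?r (\<lambda>(p, q). state n w (Suc j) $$ (U * ?r + p, V * ?r + q))"
  let ?N = "\<lambda>i. N (sender_sym w (Suc j), relay_sym i)"
  have A: "?A $$ (x * M + k, y * M + l) = (if k = l then branch w j k $$ (U', V') * ?N k $$ (x * d3 + u', y * d3 + v') else 0)"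
    if "x < d2" "k < M" "y < d2" "l < M" for x k y l
  proof -
    have "?A $$ (x * M + k, y * M + l) = state n w (Suc j) $$ (U * ?r + (x * M + k), V * ?r + (y * M + l))"
      using that prod_index_less by simp
    also have "\<dots> = state n w (Suc j) $$ (((U' * d3 + u') * d2 + x) * M + k, ((V' * d3 + v') * d2 + y) * M + l)"
      by (simp add: UV algebra_simps)
    also have "\<dots> = (if k = l then branch w j k $$ (U', V') * ?N k $$ (x * d3 + u', y * d3 + v') else 0)"
      using UV that by (intro Suc.IH)
    finally show ?thesis .
  qed
  have "mtrace (relay_povm (Suc (Suc j)) a * ?A)
    = (\<Sum>x<d2. \<Sum>k<M. \<Sum>y<d2. \<Sum>l<M. relay_povm (Suc (Suc j)) a $$ (x * M + k, y * M + l) * ?A $$ (y * M + l, x * M + k))"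
    by (rule mtrace_mult_prod_index) (use povmD(3)[OF povm_relay_povm[of "Suc (Suc j)"], of a] Suc.prems in auto)
  also have "\<dots> = (\<Sum>x<d2. \<Sum>k<M. \<Sum>y<d2. \<Sum>l<M. if l = k then L2 k a $$ (x, y)
      * (branch w j k $$ (U', V') * ?N k $$ (y * d3 + u', x * d3 + v')) else 0)"
  proof (rule sum.cong[OF refl], rule sum.cong[OF refl], rule sum.cong[OF refl], rule sum.cong[OF refl])
    fix x k y l assume "x \<in> {..<d2}" "k \<in> {..<M}" "y \<in> {..<d2}" "l \<in> {..<M}"
    then have *: "x < d2" "k < M" "y < d2" "l < M" by auto
    have "relay_povm (Suc (Suc j)) a $$ (x * M + k, y * M + l) = L2 k a $$ (x, y)" if "k = l"
    proof -
      have "relay_povm (Suc (Suc j)) a $$ (x * M + k, y * M + l)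
        = (\<Sum>i<M. kron (L2 i a) (ketbra M i) $$ (x * M + k, y * M + l))"
        using prod_index_less * by (simp add: relay_povm_def)
      also have "\<dots> = (\<Sum>i<M. if i = k then L2 k a $$ (x, y) else 0)"
        by (rule sum.cong[OF refl]) (use * Suc.prems that povmD(3)[OF L2] in \<open>auto simp: kron_index[of _ d2 d2 _ M M] ketbra_def\<close>)
      finally show ?thesis using * by simp
    qed
    then show "relay_povm (Suc (Suc j)) a $$ (x * M + k, y * M + l) * ?A $$ (y * M + l, x * M + k)
      = (if l = k then L2 k a $$ (x, y) * (branch w j k $$ (U', V') * ?N k $$ (y * d3 + u', x * d3 + v')) else 0)"
      unfolding A[OF *(3,4,1,2)] by auto
  qed
  also have "\<dots> = (\<Sum>x<d2. \<Sum>k<M. \<Sum>y<d2. L2 k a $$ (x, y) * (branch w j k $$ (U', V') * ?N k $$ (y * d3 + u', x * d3 + v')))"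
    by (rule sum.cong[OF refl], rule sum.cong[OF refl], rule sum.cong[OF refl]) simp
  also have "\<dots> = (\<Sum>k<M. \<Sum>x<d2. \<Sum>y<d2. L2 k a $$ (x, y) * (branch w j k $$ (U', V') * ?N k $$ (y * d3 + u', x * d3 + v')))"
    by (rule sum.swap)
  also have "\<dots> = (\<Sum>k<M. branch w j k $$ (U', V') * slice d2 d3 (L2 k a) (?N k) $$ (u', v'))"
    using UV by (simp add: slice_def sum_distrib_left mult_ac)
  also have "\<dots> = (\<Sum>k<M. kron (branch w j k) (slice d2 d3 (L2 k a) (?N k)) $$ (U' * d3 + u', V' * d3 + v'))"
    using UV kron_index[OF branch_carrier slice_carrier] by simp
  also have "\<dots> = branch w (Suc j) a $$ (U, V)"
    using UV prod_index_less[OF UV(1,2)] prod_index_less[OF UV(4,5)] by (simp add: mult.commute[of d3])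
  finally have tr: "mtrace (relay_povm (Suc (Suc j)) a * ?A) = branch w (Suc j) a $$ (U, V)" .
  have "relay_dim d2 (code n) (Suc j) = ?r" by (simp add: relay_dim_code)
  then show ?case unfolding state_step[OF Suc.prems] using tr by (simp only:)
qed

text \<open>Tracing out the memory sums the branches, and tracing out the relay's last output leaves
  the receiver's half of the newest channel output.\<close>

lemma receiver_state_eq:
  "receiver_state k2 d2 d3 N (code n) (Suc j) w = mat_sum (d3 ^ Suc j)
     (\<lambda>a. kron (branch w j a) (ptrace_fst d2 d3 (N (sender_sym w (Suc j), relay_sym a)))) {..<M}"
proof (rule eq_mat_prodI[of _ "d3 ^ j" d3 "d3 ^ j" d3])
  let ?N = "\<lambda>i. N (sender_sym w (Suc j), relay_sym i)"
  fix U u V v assume *: "U < d3 ^ j" "u < d3" "V < d3 ^ j" "v < d3"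
  have lt: "U * d3 + u < d3 ^ Suc j" "V * d3 + v < d3 ^ Suc j"
    using prod_index_less[OF *(1,2)] prod_index_less[OF *(3,4)] by (auto simp: mult.commute)
  have "receiver_state k2 d2 d3 N (code n) (Suc j) w $$ (U * d3 + u, V * d3 + v)
    = (\<Sum>i<d2 * M. state n w (Suc j) $$ ((U * d3 + u) * (d2 * M) + i, (V * d3 + v) * (d2 * M) + i))"
    using lt by (simp add: receiver_state_def ptrace_snd_def relay_dim_code del: joint_state.simps)
  also have "\<dots> = (\<Sum>s<d2. \<Sum>a<M. branch w j a $$ (U, V) * ?N a $$ (s * d3 + u, s * d3 + v))"
    unfolding sum_prod_index
  proof (rule sum.cong[OF refl], rule sum.cong[OF refl])
    fix s a assume "s \<in> {..<d2}" "a \<in> {..<M}"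
    then have sa: "s < d2" "a < M" by auto
    have "(X * (d2 * M) + (s * M + a)) = (X * d2 + s) * M + a" for X by (simp add: algebra_simps)
    then show "state n w (Suc j) $$ ((U * d3 + u) * (d2 * M) + (s * M + a), (V * d3 + v) * (d2 * M) + (s * M + a))
      = branch w j a $$ (U, V) * ?N a $$ (s * d3 + u, s * d3 + v)"
      using state_index[OF *(1,3,2,4) sa(1) sa(1) sa(2) sa(2)] by (simp only: simp_thms if_True)
  qed
  also have "\<dots> = (\<Sum>a<M. branch w j a $$ (U, V) * ptrace_fst d2 d3 (?N a) $$ (u, v))"
    using * by (subst sum.swap) (simp add: ptrace_fst_def sum_distrib_left)
  also have "\<dots> = (\<Sum>a<M. kron (branch w j a) (ptrace_fst d2 d3 (?N a)) $$ (U * d3 + u, V * d3 + v))"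
    using * kron_index[OF branch_carrier ptrace_carrier(1)] by simp
  also have "\<dots> = mat_sum (d3 ^ Suc j) (\<lambda>a. kron (branch w j a) (ptrace_fst d2 d3 (?N a))) {..<M} $$ (U * d3 + u, V * d3 + v)"
    using lt by (intro mat_sum_index[symmetric])
  finally show "receiver_state k2 d2 d3 N (code n) (Suc j) w $$ (U * d3 + u, V * d3 + v)
    = mat_sum (d3 ^ Suc j) (\<lambda>a. kron (branch w j a) (ptrace_fst d2 d3 (?N a))) {..<M} $$ (U * d3 + u, V * d3 + v)" .
qed (auto simp: receiver_state_def ptrace_snd_def mat_sum_def mult.commute)

end

section \<open>Error analysis\<close>

lemma mtrace_kron_mult_mat_sum:
  assumes R: "R \<in> carrier_mat a a" and P: "P \<in> carrier_mat c c"
    and B: "\<And>i. i \<in> I \<Longrightarrow> B i \<in> carrier_mat a a" and S: "\<And>i. i \<in> I \<Longrightarrow> S i \<in> carrier_mat c c"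
  shows "mtrace (kron R P * mat_sum (a * c) (\<lambda>i. kron (B i) (S i)) I) = (\<Sum>i\<in>I. mtrace (R * B i) * mtrace (P * S i))"
proof -
  have "mtrace (kron R P * mat_sum (a * c) (\<lambda>i. kron (B i) (S i)) I)
    = (\<Sum>i\<in>I. mtrace (kron R P * kron (B i) (S i)))"
    using R P B S by (subst mat_sum_mult_right) (auto intro!: mtrace_mat_sum_carrier)
  also have "\<dots> = (\<Sum>i\<in>I. mtrace (R * B i) * mtrace (P * S i))"
    using R P B S by (intro sum.cong refl) (auto simp: kron_mult[of _ a a _ c c _ a _ c] mtrace_kron[of _ a _ c])
  finally show ?thesis .
qed

lemma Re_mult_nonneg:
  assumes "0 \<le> z" "0 \<le> w"
  shows "Re (z * w) = Re z * Re w" "0 \<le> Re (z * w)"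
  using assms by (simp_all add: less_eq_complex_def)

text \<open>For errors at most 1 this is the expansion of \<open>(1 - E) * (1 - e)\<close>. Larger
  errors are separated, since a product of two negative numbers is no lower bound; there the left
  side is at most 0.\<close>

lemma union_bound_step:
  fixes s q E e :: real
  assumes "1 - E \<le> s" "1 - e \<le> q" "0 \<le> s" "0 \<le> q" "0 \<le> E" "0 \<le> e"
  shows "1 - (E + e) \<le> s * q"
proof (cases "e \<le> 1")
  case True
  show ?thesis
  proof (cases "E \<le> 1")
    case E: True
    have "(1 - E) * (1 - e) \<le> s * q" using assms True E by (intro mult_mono) auto
    moreover have "1 - (E + e) \<le> (1 - E) * (1 - e)" using assms by (simp add: algebra_simps)
    ultimately show ?thesis by linarith
  next
    case False
    moreover have "0 \<le> s * q" using assms by simp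
    ultimately show ?thesis using assms by linarith
  qed
next
  case False
  moreover have "0 \<le> s * q" using assms by simp
  ultimately show ?thesis using assms by linarith
qed

context relay_codebook
begin

definition block_error :: "nat \<Rightarrow> nat \<Rightarrow> real" where
  "block_error i m = Re (mtrace ((1\<^sub>m d2 - L2 i m) * ptrace_snd d2 d3 (N (c i m))))
    + Re (mtrace ((1\<^sub>m d3 - L3 m i) * ptrace_fst d2 d3 (N (c i m))))"

lemma codeword_density: "i < M \<Longrightarrow> m < M \<Longrightarrow> density (d2 * d3) (N (c i m))"
  using channel c_mem unfolding cq_relay_channel_def by blast

lemma block_error_parts_nonneg:
  assumes "i < M" "m < M"
  shows "0 \<le> Re (mtrace ((1\<^sub>m d2 - L2 i m) * ptrace_snd d2 d3 (N (c i m))))"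
    and "0 \<le> Re (mtrace ((1\<^sub>m d3 - L3 m i) * ptrace_fst d2 d3 (N (c i m))))"
proof -
  note d = density_ptrace[OF codeword_density[OF assms]]
  have "psd d2 (1\<^sub>m d2 - L2 i m)" "psd d3 (1\<^sub>m d3 - L3 m i)"
    using povm_complement[OF L2[OF assms(1)]] povm_complement[OF L3[OF assms(2)]] assms by auto
  then show "0 \<le> Re (mtrace ((1\<^sub>m d2 - L2 i m) * ptrace_snd d2 d3 (N (c i m))))"
    and "0 \<le> Re (mtrace ((1\<^sub>m d3 - L3 m i) * ptrace_fst d2 d3 (N (c i m))))"
    using mtrace_psd_mult_nonneg[of d2] mtrace_psd_mult_nonneg[of d3] d
    by (simp_all add: density_def less_eq_complex_def)
qed

lemma block_error_nonneg: "i < M \<Longrightarrow> m < M \<Longrightarrow> 0 \<le> block_error i m"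
  using block_error_parts_nonneg[of i m] by (simp add: block_error_def)

lemma receiver_povm_carrier: "receiver_povm w j \<in> carrier_mat d3 d3"
  using psd_receiver_povm by auto

lemma psd_receiver_povm_complement: "psd d3 (1\<^sub>m d3 - receiver_povm w j)"
proof (cases "j = 0")
  case True
  have "1\<^sub>m d3 - receiver_povm w j = 0\<^sub>m d3 d3" using True by (intro eq_matI) (auto simp: receiver_povm_def)
  then show ?thesis by simp
qed (use povm_complement[OF L3[OF digit_less]] in \<open>auto simp: receiver_povm_def\<close>)

text \<open>In the first block the identity never errs. Charging it with the error of
  \<open>L3\<close> all the same gives every block one and the same bound.\<close>

lemma receiver_povm_error:
  "Re (mtrace ((1\<^sub>m d3 - receiver_povm w j) * ptrace_fst d2 d3 (N (c (digit w j) (digit w (Suc j))))))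
    \<le> Re (mtrace ((1\<^sub>m d3 - L3 (digit w (Suc j)) (digit w j)) * ptrace_fst d2 d3 (N (c (digit w j) (digit w (Suc j))))))"
proof (cases "j = 0")
  case True
  have "1\<^sub>m d3 - receiver_povm w j = 0\<^sub>m d3 d3" using True by (intro eq_matI) (auto simp: receiver_povm_def)
  then have "mtrace ((1\<^sub>m d3 - receiver_povm w j) * ptrace_fst d2 d3 (N (c (digit w j) (digit w (Suc j))))) = 0"
    by (simp only: left_mult_zero_mat[OF ptrace_carrier(1)]) (simp add: mtrace_def)
  then show ?thesis using block_error_parts_nonneg(2)[OF digit_less digit_less] by simp
qed (simp add: receiver_povm_def)

text \<open>The joint probability that the memory holds \<open>m\<close> after \<open>j + 1\<close>
  rounds and that the receiver accepts \<open>w\<close> on its first \<open>j\<close>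
  outputs.\<close>

definition branch_prob :: "nat \<Rightarrow> nat \<Rightarrow> nat \<Rightarrow> complex" where
  "branch_prob w j m = mtrace (receiver_dec w j * branch w j m)"

lemma branch_prob_0: "branch_prob w 0 m = (if m = 0 then 1 else 0)"
  by (simp add: branch_prob_def mtrace_def)

text \<open>The branches are sums of product operators and the decoder is a product, so the traces
  factorise. The memory content evolves like a Markov chain whose weights also require the receiver
  to accept.\<close>

lemma branch_prob_Suc:
  assumes "m < M"
  shows "branch_prob w (Suc j) m = (\<Sum>i<M. branch_prob w j i
    * mtrace (kron (L2 i m) (receiver_povm w j) * N (sender_sym w (Suc j), relay_sym i)))"
proof -
  have "branch_prob w (Suc j) m = (\<Sum>i<M. branch_prob w j i
    * mtrace (receiver_povm w j * slice d2 d3 (L2 i m) (N (sender_sym w (Suc j), relay_sym i))))"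
    unfolding branch_prob_def receiver_dec.simps branch.simps power_Suc mult.commute[of d3]
    by (rule mtrace_kron_mult_mat_sum) (use receiver_povm_carrier in auto)
  also have "\<dots> = (\<Sum>i<M. branch_prob w j i
    * mtrace (kron (L2 i m) (receiver_povm w j) * N (sender_sym w (Suc j), relay_sym i)))"
    by (rule sum.cong[OF refl], subst mtrace_mult_slice)
      (use povmD(3)[OF L2] assms receiver_povm_carrier output_carrier[of _ w "Suc j"] in auto)
  finally show ?thesis .
qed

lemma branch_factor_nonneg:
  assumes "i < M" "m < M"
  shows "0 \<le> mtrace (kron (L2 i m) (receiver_povm w j) * N (sender_sym w (Suc j), relay_sym i))"
  by (rule mtrace_psd_mult_nonneg[OF psd_kron[OF _ psd_receiver_povm]])
    (use povmD(1)[OF L2] assms output_density[of i w "Suc j"] in \<open>auto simp: density_def\<close>)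

lemma branch_prob_nonneg: "m < M \<Longrightarrow> 0 \<le> branch_prob w j m"
proof (induction j arbitrary: m)
  case (Suc j)
  then show ?case unfolding branch_prob_Suc[OF Suc.prems]
    by (intro sum_nonneg mult_nonneg_nonneg branch_factor_nonneg) auto
qed (simp add: branch_prob_0 less_eq_complex_def)

text \<open>Only the term of the correct predecessor is kept, all others being nonnegative. Its
  factor is a joint success probability for a true codeword, to which the union bound
  applies.\<close>

lemma branch_prob_lower:
  "1 - (\<Sum>i<j. block_error (digit w i) (digit w (Suc i))) \<le> Re (branch_prob w j (digit w j))"
proof (induction j)
  case (Suc j)
  let ?i = "digit w j" and ?m = "digit w (Suc j)"
  define q where "q i = mtrace (kron (L2 i ?m) (receiver_povm w j) * N (sender_sym w (Suc j), relay_sym i))" for i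
  have q: "0 \<le> q i" if "i < M" for i unfolding q_def using that digit_less by (rule branch_factor_nonneg)
  have A: "psd d2 (L2 ?i ?m)" "psd d2 (1\<^sub>m d2 - L2 ?i ?m)"
    using povmD(1)[OF L2[OF digit_less]] povm_complement[OF L2[OF digit_less]] by auto
  have "1 - Re (mtrace ((1\<^sub>m d2 - L2 ?i ?m) * ptrace_snd d2 d3 (N (c ?i ?m))))
      - Re (mtrace ((1\<^sub>m d3 - receiver_povm w j) * ptrace_fst d2 d3 (N (c ?i ?m)))) \<le> Re (q ?i)"
    unfolding q_def output_codeword
    by (rule mtrace_kron_union_bound[OF A psd_receiver_povm psd_receiver_povm_complement
        codeword_density[OF digit_less digit_less]])
  then have "1 - block_error ?i ?m \<le> Re (q ?i)"
    using receiver_povm_error[of w j] unfolding block_error_def by linarith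
  then have "1 - ((\<Sum>i<j. block_error (digit w i) (digit w (Suc i))) + block_error ?i ?m)
    \<le> Re (branch_prob w j ?i) * Re (q ?i)"
    using Suc.IH branch_prob_nonneg[of ?i w j] q[of ?i]
    by (intro union_bound_step) (auto simp: less_eq_complex_def intro!: sum_nonneg block_error_nonneg)
  also have "\<dots> = Re (branch_prob w j ?i * q ?i)"
    by (rule Re_mult_nonneg(1)[symmetric]) (auto intro!: branch_prob_nonneg q)
  also have "\<dots> \<le> (\<Sum>i<M. Re (branch_prob w j i * q i))"
    by (rule member_le_sum) (auto intro!: Re_mult_nonneg(2) branch_prob_nonneg q simp del: times_complex.sel)
  also have "\<dots> = Re (branch_prob w (Suc j) ?m)" by (simp add: branch_prob_Suc q_def)
  finally show ?case by simp
qed (simp add: branch_prob_0)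

text \<open>Each \<open>L2 i\<close> is complete, so no weight is lost from round to round. The
  receiver's state thus has trace 1, which turns the bound on success into one on the error.\<close>

lemma sum_mtrace_branch: "(\<Sum>m<M. mtrace (branch w j m)) = 1"
proof (induction j)
  case 0
  have "mtrace (branch w 0 m) = (if m = 0 then 1 else 0)" for m by (simp add: mtrace_def)
  then show ?case using M by (simp del: branch.simps)
next
  case (Suc j)
  let ?N = "\<lambda>i. N (sender_sym w (Suc j), relay_sym i)"
  have "(\<Sum>m<M. mtrace (branch w (Suc j) m)) = (\<Sum>m<M. \<Sum>i<M. mtrace (branch w j i) * mtrace (slice d2 d3 (L2 i m) (?N i)))"
    unfolding branch.simps by (rule sum.cong[OF refl], subst mtrace_mat_sum_carrier)
      (auto simp: mtrace_kron[OF branch_carrier slice_carrier] mult.commute[of d3])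
  also have "\<dots> = (\<Sum>i<M. mtrace (branch w j i) * (\<Sum>m<M. mtrace (slice d2 d3 (L2 i m) (?N i))))"
    by (subst sum.swap) (simp add: sum_distrib_left)
  also have "\<dots> = (\<Sum>i<M. mtrace (branch w j i) * 1)"
  proof (rule sum.cong[OF refl])
    fix i assume "i \<in> {..<M}"
    then have i: "i < M" by simp
    have "(\<Sum>m<M. mtrace (slice d2 d3 (L2 i m) (?N i))) = (\<Sum>m<M. mtrace (L2 i m * ptrace_snd d2 d3 (?N i)))"
      using povmD(3)[OF L2[OF i]] output_carrier[OF i, of w "Suc j"] left_mult_one_mat[OF slice_carrier] mtrace_mult_slice[of _ d2 "1\<^sub>m d3" d3 "?N i"]
      by (intro sum.cong refl) (simp add: mtrace_mult_ptrace_snd)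
    also have "\<dots> = mtrace (ptrace_snd d2 d3 (?N i))" by (rule povm_sum_mtrace[OF L2[OF i]]) auto
    also have "\<dots> = 1" using density_ptrace(2)[OF output_density[OF i, of w "Suc j"]] by (simp add: density_def)
    finally show "mtrace (branch w j i) * (\<Sum>m<M. mtrace (slice d2 d3 (L2 i m) (?N i))) = mtrace (branch w j i) * 1" by simp
  qed
  finally show ?case using Suc.IH by simp
qed

lemma mtrace_receiver_state: "mtrace (receiver_state k2 d2 d3 N (code n) (Suc j) w) = 1"
proof -
  have "mtrace (receiver_state k2 d2 d3 N (code n) (Suc j) w) = (\<Sum>m<M. mtrace (branch w j m)
      * mtrace (ptrace_fst d2 d3 (N (sender_sym w (Suc j), relay_sym m))))"
    unfolding receiver_state_eq by (subst mtrace_mat_sum_carrier)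
      (auto simp: mtrace_kron[OF branch_carrier ptrace_carrier(1)] mult.commute[of d3])
  also have "\<dots> = (\<Sum>m<M. mtrace (branch w j m))"
    using density_ptrace(1)[OF output_density, of _ w "Suc j"] by (intro sum.cong refl) (simp add: density_def)
  finally show ?thesis using sum_mtrace_branch by simp
qed

text \<open>One more step as in \<open>branch_prob_lower\<close>, except that the relay's output of
  the last round is traced out and not measured.\<close>

lemma success_prob:
  "1 - (\<Sum>i<Suc n. block_error (digit w i) (digit w (Suc i)))
    \<le> Re (mtrace (receiver_dec w (Suc n) * receiver_state k2 d2 d3 N (code b) (Suc n) w))"
proof -
  let ?i = "digit w n"
  define q where "q i = mtrace (receiver_povm w n * ptrace_fst d2 d3 (N (sender_sym w (Suc n), relay_sym i)))" for i
  have q: "0 \<le> q i" if "i < M" for i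
    unfolding q_def
    using density_ptrace(1)[OF output_density[OF that, of w "Suc n"]]
    by (intro mtrace_psd_mult_nonneg[of d3] psd_receiver_povm) (simp add: density_def)
  let ?\<rho> = "ptrace_fst d2 d3 (N (c ?i (digit w (Suc n))))"
  have "mtrace ((1\<^sub>m d3 - receiver_povm w n) * ?\<rho>) = mtrace ?\<rho> - mtrace (receiver_povm w n * ?\<rho>)"
    using minus_mult_distrib_mat[OF one_carrier_mat receiver_povm_carrier ptrace_carrier(1)]
      mtrace_minus[OF ptrace_carrier(1) square_mult_carrier[OF receiver_povm_carrier ptrace_carrier(1)]]
      left_mult_one_mat[OF ptrace_carrier(1)] by simp
  moreover have "mtrace ?\<rho> = 1"
    using density_ptrace(1)[OF codeword_density[OF digit_less digit_less]] by (simp add: density_def)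
  \<comment> \<open>The nonnegative relay part of the block error is added here, although the relay
    makes no measurement, so that the last block has the same bound as the others.\<close>
  ultimately have "1 - block_error ?i (digit w (Suc n)) \<le> Re (q ?i)"
    using receiver_povm_error[of w n] block_error_parts_nonneg(1)[of ?i "digit w (Suc n)"]
    unfolding q_def output_codeword block_error_def by simp
  then have "1 - ((\<Sum>i<n. block_error (digit w i) (digit w (Suc i))) + block_error ?i (digit w (Suc n)))
    \<le> Re (branch_prob w n ?i) * Re (q ?i)"
    using branch_prob_lower[of w n] branch_prob_nonneg[of ?i w n] q[of ?i]
    by (intro union_bound_step) (auto simp: less_eq_complex_def intro!: sum_nonneg block_error_nonneg)
  also have "\<dots> = Re (branch_prob w n ?i * q ?i)"
    by (rule Re_mult_nonneg(1)[symmetric]) (auto intro!: branch_prob_nonneg q)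
  also have "\<dots> \<le> (\<Sum>i<M. Re (branch_prob w n i * q i))"
    by (rule member_le_sum) (auto intro!: Re_mult_nonneg(2) branch_prob_nonneg q simp del: times_complex.sel)
  also have "\<dots> = Re (mtrace (receiver_dec w (Suc n) * receiver_state k2 d2 d3 N (code b) (Suc n) w))"
  proof -
    have "mtrace (receiver_dec w (Suc n) * receiver_state k2 d2 d3 N (code b) (Suc n) w)
      = (\<Sum>i<M. branch_prob w n i * q i)"
      unfolding q_def receiver_state_eq branch_prob_def receiver_dec.simps power_Suc mult.commute[of d3]
      by (rule mtrace_kron_mult_mat_sum) (use receiver_povm_carrier in auto)
    then show ?thesis by simp
  qed
  finally show ?thesis by simp
qed

lemma avg_error_code:
  "avg_error k2 d2 d3 N (code (Suc n)) (Suc n)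
    \<le> (\<Sum>w<M ^ n. \<Sum>i<Suc n. block_error (digit w i) (digit w (Suc i))) / real (M ^ n)"
proof -
  have "Re (mtrace ((1\<^sub>m (d3 ^ Suc n) - receiver_dec w (Suc n)) * receiver_state k2 d2 d3 N (code (Suc n)) (Suc n) w))
    \<le> (\<Sum>i<Suc n. block_error (digit w i) (digit w (Suc i)))" for w
  proof -
    let ?S = "receiver_state k2 d2 d3 N (code (Suc n)) (Suc n) w"
    have S: "?S \<in> carrier_mat (d3 ^ Suc n) (d3 ^ Suc n)" by (simp add: receiver_state_def)
    have "mtrace ((1\<^sub>m (d3 ^ Suc n) - receiver_dec w (Suc n)) * ?S) = mtrace ?S - mtrace (receiver_dec w (Suc n) * ?S)"
      using minus_mult_distrib_mat[OF one_carrier_mat receiver_dec_carrier S] left_mult_one_mat[OF S]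
        mtrace_minus[OF S square_mult_carrier[OF receiver_dec_carrier S]] by simp
    then show ?thesis using success_prob[of w n "Suc n"] mtrace_receiver_state[of "Suc n" n w] by simp
  qed
  then have "(\<Sum>w<M ^ n. Re (mtrace ((1\<^sub>m (d3 ^ Suc n) - receiver_dec w (Suc n)) * receiver_state k2 d2 d3 N (code (Suc n)) (Suc n) w)))
    \<le> (\<Sum>w<M ^ n. \<Sum>i<Suc n. block_error (digit w i) (digit w (Suc i)))" by (intro sum_mono)
  then show ?thesis unfolding avg_error_def code_simps
    using M by (simp add: divide_right_mono del: sum.lessThan_Suc receiver_dec.simps power_Suc)
qed

end

section \<open>Codebook averages as traces of tests, and the final bound\<close>

lemma fibre_all: "fibre k1 k2 {1, 2} x = {..<k1} \<times> {..<k2}"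
  by (auto simp: fibre_def)

text \<open>The right side has the shape of the codebook averages: \<open>S = {1}\<close> matches
  two pairs of a row, and \<open>S = {1, 2}\<close>, where the fibre has total mass 1, two pairs of
  different rows.\<close>

lemma Re_mtrace_cond_prod_state:
  assumes T: "T \<in> carrier_mat (k1 * k2 * d) (k1 * k2 * d)"
    and \<rho>: "\<And>x. x \<in> {..<k1} \<times> {..<k2} \<Longrightarrow> \<rho> x \<in> carrier_mat d d"
  shows "Re (mtrace (T * cond_prod_state k1 k2 d p \<rho> S)) = (\<Sum>x\<in>{..<k1} \<times> {..<k2}. pmf p x *
    (\<Sum>z\<in>fibre k1 k2 S x. pmf p z / (\<Sum>w\<in>fibre k1 k2 S x. pmf p w)
      * Re (mtrace (blk d T (fst x * k2 + snd x) * \<rho> z))))"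
proof -
  have co: "cond_output k1 k2 d p \<rho> S x \<in> carrier_mat d d" for x by (simp add: cond_output_def)
  show ?thesis
    unfolding cond_prod_state_def by (simp add: mtrace_mult_cq_state T co mtrace_mult_cond_output \<rho>)
qed

lemma Re_mtrace_cq_state:
  assumes T: "T \<in> carrier_mat (k1 * k2 * d) (k1 * k2 * d)"
    and \<rho>: "\<And>x. x \<in> {..<k1} \<times> {..<k2} \<Longrightarrow> \<rho> x \<in> carrier_mat d d"
  shows "Re (mtrace (T * cq_state k1 k2 d p \<rho>))
    = (\<Sum>x\<in>{..<k1} \<times> {..<k2}. pmf p x * Re (mtrace (blk d T (fst x * k2 + snd x) * \<rho> x)))"
  by (simp add: mtrace_mult_cq_state T \<rho>)

lemma psd_cond_prod_state:
  assumes "\<And>x. x \<in> {..<k1} \<times> {..<k2} \<Longrightarrow> psd d (\<rho> x)"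
  shows "psd (k1 * k2 * d) (cond_prod_state k1 k2 d p \<rho> S)"
  unfolding cond_prod_state_def by (intro psd_cq_state psd_cond_output assms)

lemma exp2_nonneg: "0 \<le> exp2 t"
  by (simp add: exp2_def)

text \<open>On the unit interval the cube root dominates the identity, and the last summand of the
  coefficient is already at least 4.\<close>

lemma universal_f_ge:
  assumes "0 < \<epsilon>" "\<epsilon> < 1"
  shows "4 * \<epsilon> \<le> universal_f k \<epsilon>"
proof -
  have "\<epsilon> \<le> \<epsilon> powr (1 / 3)"
    using powr_mono'[of "1/3" 1 \<epsilon>] assms by simp
  moreover have "4 \<le> 1 + 6 * 2 powr ((real k + 1) / 2) + 4 * 2 ^ (2 ^ (k + 5) + k\<^sup>2 + 2 * k)"
  proof -
    have "(1::real) \<le> 2 ^ (2 ^ (k + 5) + k\<^sup>2 + 2 * k)" by (rule one_le_power) simp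
    moreover have "0 \<le> (6::real) * 2 powr ((real k + 1) / 2)" by simp
    ultimately show ?thesis by linarith
  qed
  ultimately show ?thesis unfolding universal_f_def using assms by (intro mult_mono) auto
qed

lemma Re_mtrace_complement:
  assumes "T \<in> carrier_mat d d" "density d \<rho>"
  shows "Re (mtrace ((1\<^sub>m d - T) * \<rho>)) = 1 - Re (mtrace (T * \<rho>))"
proof -
  have \<rho>: "\<rho> \<in> carrier_mat d d" "mtrace \<rho> = 1" using assms by (auto simp: density_def)
  have "(1\<^sub>m d - T) * \<rho> = \<rho> - T * \<rho>"
    using minus_mult_distrib_mat[OF one_carrier_mat assms(1) \<rho>(1)] left_mult_one_mat[OF \<rho>(1)] by simp
  then show ?thesis using mtrace_minus[OF \<rho>(1) square_mult_carrier[OF assms(1) \<rho>(1)]] \<rho>(2) by simp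
qed

text \<open>The codebook is selected before the measurements are built, since its cost is expressed
  by the blocks of the tests alone. The square-root measurements for the selected codebook then err
  by no more than this cost.\<close>

theorem decode_forward:
  fixes N :: "nat \<times> nat \<Rightarrow> complex mat" and p :: "(nat \<times> nat) pmf"
  assumes channel: "cq_relay_channel k1 k2 d2 d3 N" and p: "set_pmf p \<subseteq> {..<k1} \<times> {..<k2}" and R: "0 \<le> R"
    and T2: "psd (k1 * k2 * d2) T2" "psd (k1 * k2 * d2) (1\<^sub>m (k1 * k2 * d2) - T2)"
    and T3: "psd (k1 * k2 * d3) T3" "psd (k1 * k2 * d3) (1\<^sub>m (k1 * k2 * d3) - T3)"
  defines "\<rho>2 \<equiv> \<lambda>x. ptrace_snd d2 d3 (N x)" and "\<rho>3 \<equiv> \<lambda>x. ptrace_fst d2 d3 (N x)"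
  shows "achievable k1 k2 d2 d3 N (real n / real (Suc n) * R) (Suc n) (real (Suc n) *
    (2 * (1 - Re (mtrace (T2 * cq_state k1 k2 d2 p \<rho>2))) + 2 * (1 - Re (mtrace (T3 * cq_state k1 k2 d3 p \<rho>3)))
      + 4 * (2 powr R * Re (mtrace (T2 * cond_prod_state k1 k2 d2 p \<rho>2 {1})))
      + 4 * (2 powr R * Re (mtrace (T3 * cond_prod_state k1 k2 d3 p \<rho>3 {1, 2})))))"
proof -
  let ?X = "{..<k1} \<times> {..<k2}"
  define ix where "ix x = fst x * k2 + snd x" for x :: "nat \<times> nat"
  have ix: "ix x < k1 * k2" if "x \<in> ?X" for x
    using that unfolding ix_def by (auto intro: prod_index_less)
  have \<rho>2: "density d2 (\<rho>2 x)" and \<rho>3: "density d3 (\<rho>3 x)" if "x \<in> ?X" for x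
    using channel that density_ptrace[of d2 d3 "N x"] unfolding \<rho>2_def \<rho>3_def cq_relay_channel_def by blast+
  have \<rho>2c: "\<rho>2 x \<in> carrier_mat d2 d2" and \<rho>3c: "\<rho>3 x \<in> carrier_mat d3 d3" for x
    by (auto simp: \<rho>2_def \<rho>3_def)
  note T2c = psd_carrier[OF T2(1)] and T3c = psd_carrier[OF T3(1)]
  define B2 where "B2 x = blk d2 T2 (ix x)" for x
  define B3 where "B3 x = blk d3 T3 (ix x)" for x
  have B2c: "B2 x \<in> carrier_mat d2 d2" and B3c: "B3 x \<in> carrier_mat d3 d3" for x by (auto simp: B2_def B3_def)
  have B2: "psd d2 (B2 x)" "psd d2 (1\<^sub>m d2 - B2 x)" if "x \<in> ?X" for x
    using psd_blk[OF T2(1) ix[OF that]] psd_blk[OF T2(2) ix[OF that]] blk_one_minus[OF T2c ix[OF that]]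
    by (simp_all add: B2_def)
  have B3: "psd d3 (B3 x)" "psd d3 (1\<^sub>m d3 - B3 x)" if "x \<in> ?X" for x
    using psd_blk[OF T3(1) ix[OF that]] psd_blk[OF T3(2) ix[OF that]] blk_one_minus[OF T3c ix[OF that]]
    by (simp_all add: B3_def)
  define M where "M = nat \<lceil>2 powr R\<rceil>"
  have M_ge: "2 powr R \<le> real M" unfolding M_def by linarith
  have M_le: "real M - 1 \<le> 2 powr R" unfolding M_def using powr_gt_zero[of 2 R] by linarith
  have M: "0 < M" using M_ge powr_gt_zero[of 2 R] by (intro Nat.gr0I) simp
  \<comment> \<open>All pairs of a message and a block are averaged together, so the selected
    codebook is good for the mean over messages.\<close>
  define W where "W = {..<M ^ n} \<times> {..<Suc n}"
  \<comment> \<open>The weights 2 here and 4 below are those of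
    \<open>square_root_povm\<close>.\<close>
  define f where "f x = 2 * (1 - Re (mtrace (B2 x * \<rho>2 x))) + 2 * (1 - Re (mtrace (B3 x * \<rho>3 x)))" for x
  define g where "g z x = 4 * Re (mtrace (B2 x * \<rho>2 z))" for z x
  define h where "h z x = 4 * Re (mtrace (B3 x * \<rho>3 z))" for z x
  define s where "s t = base_digit M (fst t) (snd t)" for t
  define r where "r t = base_digit M (fst t) (Suc (snd t))" for t
  have sr: "s t < M" "r t < M" for t by (simp_all add: s_def r_def base_digit_less[OF M])
  obtain c where c: "c \<in> set_pmf (codebook_pmf M p)"
    and cost: "(\<Sum>t\<in>W. f (c (s t) (r t)) + (\<Sum>k\<in>{..<M} - {r t}. g (c (s t) (r t)) (c (s t) k))
          + (\<Sum>k\<in>{..<M} - {s t}. h (c (s t) (r t)) (c k (r t))))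
      \<le> real (card W) * ((\<Sum>x\<in>?X. pmf p x * f x)
          + (real M - 1) * (\<Sum>x\<in>?X. pmf p x *
              (\<Sum>z\<in>fibre k1 k2 {1} x. pmf p z / (\<Sum>w\<in>fibre k1 k2 {1} x. pmf p w) * g z x))
          + (real M - 1) * (\<Sum>x\<in>?X. pmf p x * (\<Sum>z\<in>?X. pmf p z * h z x)))"
    by (rule good_codebook[of p k1 k2 M W s r f g h, OF p M sr(1) sr(2)])
  have c_mem: "c i m \<in> ?X" if "i < M" "m < M" for i m
    using codebook_mem(1)[OF c that] p by blast
  have "\<forall>i\<in>{..<M}. \<exists>L. povm d2 {..<M} L \<and> (\<forall>m \<rho>. m < M \<longrightarrow> psd d2 \<rho> \<longrightarrow> Re (mtrace ((1\<^sub>m d2 - L m) * \<rho>))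
      \<le> 2 * Re (mtrace ((1\<^sub>m d2 - B2 (c i m)) * \<rho>)) + 4 * (\<Sum>k\<in>{..<M} - {m}. Re (mtrace (B2 (c i k) * \<rho>))))"
  proof
    fix i assume "i \<in> {..<M}"
    then have i: "i < M" by simp
    show "\<exists>L. povm d2 {..<M} L \<and> (\<forall>m \<rho>. m < M \<longrightarrow> psd d2 \<rho> \<longrightarrow> Re (mtrace ((1\<^sub>m d2 - L m) * \<rho>))
      \<le> 2 * Re (mtrace ((1\<^sub>m d2 - B2 (c i m)) * \<rho>)) + 4 * (\<Sum>k\<in>{..<M} - {m}. Re (mtrace (B2 (c i k) * \<rho>))))"
      by (rule square_root_povm[where T="\<lambda>m. B2 (c i m)", OF M B2(1)[OF c_mem[OF i]] B2(2)[OF c_mem[OF i]]]) (assumption, assumption, rule exI, rule conjI, assumption, intro allI impI, assumption)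
  qed
  from bchoice[OF this] obtain L2 where L2: "\<And>i. i < M \<Longrightarrow> povm d2 {..<M} (L2 i)"
    and L2e: "\<And>i m \<rho>. i < M \<Longrightarrow> m < M \<Longrightarrow> psd d2 \<rho> \<Longrightarrow> Re (mtrace ((1\<^sub>m d2 - L2 i m) * \<rho>))
      \<le> 2 * Re (mtrace ((1\<^sub>m d2 - B2 (c i m)) * \<rho>)) + 4 * (\<Sum>k\<in>{..<M} - {m}. Re (mtrace (B2 (c i k) * \<rho>)))"
    by blast
  \<comment> \<open>The same construction along a column: the new message \<open>m\<close> is fixed
    and the row index is decoded.\<close>
  have "\<forall>m\<in>{..<M}. \<exists>L. povm d3 {..<M} L \<and> (\<forall>i \<rho>. i < M \<longrightarrow> psd d3 \<rho> \<longrightarrow> Re (mtrace ((1\<^sub>m d3 - L i) * \<rho>))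
      \<le> 2 * Re (mtrace ((1\<^sub>m d3 - B3 (c i m)) * \<rho>)) + 4 * (\<Sum>k\<in>{..<M} - {i}. Re (mtrace (B3 (c k m) * \<rho>))))"
  proof
    fix m assume "m \<in> {..<M}"
    then have m: "m < M" by simp
    show "\<exists>L. povm d3 {..<M} L \<and> (\<forall>i \<rho>. i < M \<longrightarrow> psd d3 \<rho> \<longrightarrow> Re (mtrace ((1\<^sub>m d3 - L i) * \<rho>))
      \<le> 2 * Re (mtrace ((1\<^sub>m d3 - B3 (c i m)) * \<rho>)) + 4 * (\<Sum>k\<in>{..<M} - {i}. Re (mtrace (B3 (c k m) * \<rho>))))"
      by (rule square_root_povm[where T="\<lambda>i. B3 (c i m)", OF M B3(1)[OF c_mem[OF _ m]] B3(2)[OF c_mem[OF _ m]]]) (assumption, assumption, rule exI, rule conjI, assumption, intro allI impI, assumption)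
  qed
  from bchoice[OF this] obtain L3 where L3: "\<And>m. m < M \<Longrightarrow> povm d3 {..<M} (L3 m)"
    and L3e: "\<And>i m \<rho>. m < M \<Longrightarrow> i < M \<Longrightarrow> psd d3 \<rho> \<Longrightarrow> Re (mtrace ((1\<^sub>m d3 - L3 m i) * \<rho>))
      \<le> 2 * Re (mtrace ((1\<^sub>m d3 - B3 (c i m)) * \<rho>)) + 4 * (\<Sum>k\<in>{..<M} - {i}. Re (mtrace (B3 (c k m) * \<rho>)))"
    by blast
  interpret relay_codebook k1 k2 d2 d3 M N c L2 L3
  proof
    show "snd (c i m) = snd (c i 0)" if "i < M" "m < M" for i m
      by (rule codebook_mem(2)[OF c that(1) M that(2)])
  qed (fact channel M c_mem L2 L3)+
  have err: "block_error i m \<le> f (c i m) + (\<Sum>k\<in>{..<M} - {m}. g (c i m) (c i k)) + (\<Sum>k\<in>{..<M} - {i}. h (c i m) (c k m))"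
    if "i < M" "m < M" for i m
  proof -
    have x: "c i m \<in> ?X" by (rule c_mem[OF that])
    have psd: "psd d2 (\<rho>2 (c i m))" "psd d3 (\<rho>3 (c i m))" using \<rho>2[OF x] \<rho>3[OF x] by (simp_all add: density_def)
    have "block_error i m = Re (mtrace ((1\<^sub>m d2 - L2 i m) * \<rho>2 (c i m))) + Re (mtrace ((1\<^sub>m d3 - L3 m i) * \<rho>3 (c i m)))"
      by (simp add: block_error_def \<rho>2_def \<rho>3_def)
    also have "\<dots> \<le> f (c i m) + (\<Sum>k\<in>{..<M} - {m}. g (c i m) (c i k)) + (\<Sum>k\<in>{..<M} - {i}. h (c i m) (c k m))"
      using L2e[OF that psd(1)] L3e[OF that(2,1) psd(2)]
      unfolding f_def g_def h_def Re_mtrace_complement[OF B2c \<rho>2[OF x]] Re_mtrace_complement[OF B3c \<rho>3[OF x]]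
        sum_distrib_left[symmetric] by linarith
    finally show ?thesis .
  qed
  define t2 where "t2 = Re (mtrace (T2 * cond_prod_state k1 k2 d2 p \<rho>2 {1}))"
  define t3 where "t3 = Re (mtrace (T3 * cond_prod_state k1 k2 d3 p \<rho>3 {1, 2}))"
  define F where "F = 2 * (1 - Re (mtrace (T2 * cq_state k1 k2 d2 p \<rho>2))) + 2 * (1 - Re (mtrace (T3 * cq_state k1 k2 d3 p \<rho>3)))"
  have t23: "0 \<le> t2" "0 \<le> t3"
    using mtrace_psd_mult_nonneg[OF T2(1) psd_cond_prod_state, of \<rho>2 p "{1}"] \<rho>2
      mtrace_psd_mult_nonneg[OF T3(1) psd_cond_prod_state, of \<rho>3 p "{1, 2}"] \<rho>3
    unfolding t2_def t3_def by (simp_all add: density_def less_eq_complex_def)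
  have sum1: "(\<Sum>x\<in>?X. pmf p x) = 1" using p by (intro sum_pmf_eq_1) auto
  have Feq: "(\<Sum>x\<in>?X. pmf p x * f x) = F"
  proof -
    have "(\<Sum>x\<in>?X. pmf p x * f x) = (\<Sum>x\<in>?X. 4 * pmf p x
        - 2 * (pmf p x * Re (mtrace (B2 x * \<rho>2 x))) - 2 * (pmf p x * Re (mtrace (B3 x * \<rho>3 x))))"
      by (rule sum.cong[OF refl]) (simp add: f_def algebra_simps)
    also have "\<dots> = 4 * (\<Sum>x\<in>?X. pmf p x) - 2 * (\<Sum>x\<in>?X. pmf p x * Re (mtrace (B2 x * \<rho>2 x)))
        - 2 * (\<Sum>x\<in>?X. pmf p x * Re (mtrace (B3 x * \<rho>3 x)))"
      unfolding sum_distrib_left sum_subtractf ..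
    also have "\<dots> = F"
      unfolding F_def Re_mtrace_cq_state[OF T2c \<rho>2c] Re_mtrace_cq_state[OF T3c \<rho>3c] sum1
      by (simp add: B2_def B3_def ix_def)
    finally show ?thesis .
  qed
  have Geq: "(\<Sum>x\<in>?X. pmf p x * (\<Sum>z\<in>fibre k1 k2 {1} x. pmf p z / (\<Sum>w\<in>fibre k1 k2 {1} x. pmf p w) * g z x)) = 4 * t2"
    unfolding t2_def Re_mtrace_cond_prod_state[OF T2c \<rho>2c] g_def B2_def ix_def
    by (simp add: sum_distrib_left mult_ac)
  have Heq: "(\<Sum>x\<in>?X. pmf p x * (\<Sum>z\<in>?X. pmf p z * h z x)) = 4 * t3"
    unfolding t3_def Re_mtrace_cond_prod_state[OF T3c \<rho>3c] fibre_all sum1 h_def B3_def ix_def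
    by (simp add: sum_distrib_left mult_ac)
  have "(\<Sum>w<M ^ n. \<Sum>i<Suc n. block_error (digit w i) (digit w (Suc i))) = (\<Sum>t\<in>W. block_error (s t) (r t))"
    unfolding W_def s_def r_def sum.cartesian_product by (simp add: case_prod_unfold)
  also have "\<dots> \<le> (\<Sum>t\<in>W. f (c (s t) (r t)) + (\<Sum>k\<in>{..<M} - {r t}. g (c (s t) (r t)) (c (s t) k))
          + (\<Sum>k\<in>{..<M} - {s t}. h (c (s t) (r t)) (c k (r t))))"
    by (rule sum_mono) (rule err[OF sr])
  also have "\<dots> \<le> real (card W) * (F + (real M - 1) * (4 * t2) + (real M - 1) * (4 * t3))"
    using cost unfolding Feq Geq Heq .
  also have "\<dots> \<le> real (card W) * (F + 2 powr R * (4 * t2) + 2 powr R * (4 * t3))"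
    using M_le t23 by (intro mult_left_mono add_mono mult_right_mono) auto
  also have "real (card W) = real (M ^ n) * real (Suc n)" by (simp add: W_def card_cartesian_product algebra_simps)
  finally have "(\<Sum>w<M ^ n. \<Sum>i<Suc n. block_error (digit w i) (digit w (Suc i))) / real (M ^ n)
    \<le> real (Suc n) * (F + 2 powr R * (4 * t2) + 2 powr R * (4 * t3))"
    using M by (simp add: divide_le_eq mult_ac del: sum.lessThan_Suc of_nat_Suc)
  then have "avg_error k2 d2 d3 N (code (Suc n)) (Suc n)
    \<le> real (Suc n) * (F + 4 * (2 powr R * t2) + 4 * (2 powr R * t3))"
    using avg_error_code[of n] by (simp add: mult_ac)
  moreover have "real n / real (Suc n) * R \<le> real n * log 2 (real M) / real (Suc n)"
  proof -
    have "log 2 (2 powr R) \<le> log 2 (real M)" by (intro log_mono M_ge) auto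
    then have "real n * R / real (Suc n) \<le> real n * log 2 (real M) / real (Suc n)"
      by (intro divide_right_mono mult_left_mono) auto
    then show ?thesis by simp
  qed
  ultimately show ?thesis
    unfolding achievable_def t2_def[symmetric] t3_def[symmetric] F_def[symmetric] using is_relay_code[of n] by blast
qed

theorem proposition7:
  fixes k1 k2 d2 d3 b :: nat
    and N :: "nat \<times> nat \<Rightarrow> complex mat"
    and p :: "(nat \<times> nat) pmf"
    and R \<epsilon> \<delta> :: real
    and \<rho> \<rho>3 \<rho>2 :: "complex mat"
  assumes "cq_relay_channel k1 k2 d2 d3 N"
    and "set_pmf p \<subseteq> {..<k1} \<times> {..<k2}"
    and "R \<ge> 0" and "0 < \<epsilon>" and "\<epsilon> < 1" and "b \<ge> 1"
    and "\<rho> = cq_state k1 k2 (d2 * d3) p N"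
    and "\<rho>3 = id_tensor (k1 * k2) (d2 * d3) d3 (ptrace_fst d2 d3) \<rho>"
    and "\<rho>2 = id_tensor (k1 * k2) (d2 * d3) d2 (ptrace_snd d2 d3) \<rho>"
    and "ereal \<delta> = ereal (real b) * (ereal (2 * universal_f 2 \<epsilon>) + 4 *
           (exp2 (ereal R - D_H (k1 * k2 * d3) \<epsilon> \<rho>3
                    (cond_prod_state k1 k2 d3 p (\<lambda>x. ptrace_fst d2 d3 (N x)) {1, 2}))
          + exp2 (ereal R - D_H (k1 * k2 * d2) \<epsilon> \<rho>2
                    (cond_prod_state k1 k2 d2 p (\<lambda>x. ptrace_snd d2 d3 (N x)) {1}))))"
    and "0 \<le> \<delta>" and "\<delta> \<le> 1"
  shows "achievable k1 k2 d2 d3 N ((real b - 1) / real b * R) b \<delta>"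
proof -
  let ?X = "{..<k1} \<times> {..<k2}"
  let ?s3 = "cond_prod_state k1 k2 d3 p (\<lambda>x. ptrace_fst d2 d3 (N x)) {1, 2}"
  let ?s2 = "cond_prod_state k1 k2 d2 p (\<lambda>x. ptrace_snd d2 d3 (N x)) {1}"
  obtain n where b: "b = Suc n" using \<open>b \<ge> 1\<close> by (cases b) auto
  have N: "density (d2 * d3) (N x)" if "x \<in> ?X" for x
    using assms(1) that unfolding cq_relay_channel_def by blast
  have Nc: "N x \<in> carrier_mat (d2 * d3) (d2 * d3)" if "x \<in> ?X" for x
    using N[OF that] by (auto simp: density_def)
  have \<rho>3: "\<rho>3 = cq_state k1 k2 d3 p (\<lambda>x. ptrace_fst d2 d3 (N x))"
    unfolding assms(7,8) by (rule id_tensor_cq_state) (auto simp: Nc ptrace_smult)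
  have \<rho>2: "\<rho>2 = cq_state k1 k2 d2 p (\<lambda>x. ptrace_snd d2 d3 (N x))"
    unfolding assms(7,9) by (rule id_tensor_cq_state) (auto simp: Nc ptrace_smult)
  define E3 where "E3 = exp2 (ereal R - D_H (k1 * k2 * d3) \<epsilon> \<rho>3 ?s3)"
  define E2 where "E2 = exp2 (ereal R - D_H (k1 * k2 * d2) \<epsilon> \<rho>2 ?s2)"
  have E: "ereal \<delta> = ereal (real b) * (ereal (2 * universal_f 2 \<epsilon>) + 4 * (E3 + E2))"
    using assms(10) unfolding E3_def E2_def .
  have E0: "0 \<le> E3" "0 \<le> E2" unfolding E3_def E2_def by (rule exp2_nonneg)+
  \<comment> \<open>Since \<open>\<delta>\<close> is real and \<open>b\<close> is positive, neither
    exponential can be infinite.\<close>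
  obtain e3 e2 where e: "E3 = ereal e3" "E2 = ereal e2"
    using E E0 b by (cases E3; cases E2) (auto simp: ereal_mult_infty)
  have e0: "0 \<le> e3" "0 \<le> e2" using E0 e by auto
  have \<delta>: "\<delta> = real b * (2 * universal_f 2 \<epsilon> + 4 * (e3 + e2))"
    using E unfolding e by simp
  have s3: "psd (k1 * k2 * d3) ?s3"
    using density_ptrace(1)[OF N] by (intro psd_cond_prod_state) (simp add: density_def)
  have s2: "psd (k1 * k2 * d2) ?s2"
    using density_ptrace(2)[OF N] by (intro psd_cond_prod_state) (simp add: density_def)
  \<comment> \<open>The tests contribute \<open>2 \<epsilon>\<close> each for missing the true state
    and their slack \<open>4 * (\<epsilon> / 2)\<close> each; the total \<open>8 \<epsilon>\<close>
    is covered by \<open>2 * universal_f 2 \<epsilon>\<close>.\<close>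
  have \<eta>: "0 < \<epsilon> / 2" using \<open>0 < \<epsilon>\<close> by simp
  obtain T3 where T3: "psd (k1 * k2 * d3) T3" "psd (k1 * k2 * d3) (1\<^sub>m (k1 * k2 * d3) - T3)"
    "1 - \<epsilon> \<le> Re (mtrace (T3 * \<rho>3))" "2 powr R * Re (mtrace (T3 * ?s3)) \<le> e3 + \<epsilon> / 2"
    using D_H_test[OF s3 e(1)[unfolded E3_def] e0(1) \<eta>] .
  obtain T2 where T2: "psd (k1 * k2 * d2) T2" "psd (k1 * k2 * d2) (1\<^sub>m (k1 * k2 * d2) - T2)"
    "1 - \<epsilon> \<le> Re (mtrace (T2 * \<rho>2))" "2 powr R * Re (mtrace (T2 * ?s2)) \<le> e2 + \<epsilon> / 2"
    using D_H_test[OF s2 e(2)[unfolded E2_def] e0(2) \<eta>] .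
  have "2 * (1 - Re (mtrace (T2 * \<rho>2))) + 2 * (1 - Re (mtrace (T3 * \<rho>3)))
      + 4 * (2 powr R * Re (mtrace (T2 * ?s2))) + 4 * (2 powr R * Re (mtrace (T3 * ?s3)))
    \<le> 2 * universal_f 2 \<epsilon> + 4 * (e3 + e2)"
    using T2(3,4) T3(3,4) universal_f_ge[OF assms(4,5), of 2] by argo
  then have "real b * (2 * (1 - Re (mtrace (T2 * \<rho>2))) + 2 * (1 - Re (mtrace (T3 * \<rho>3)))
      + 4 * (2 powr R * Re (mtrace (T2 * ?s2))) + 4 * (2 powr R * Re (mtrace (T3 * ?s3)))) \<le> \<delta>"
    unfolding \<delta> by (rule mult_left_mono) simp
  then show ?thesis
    using decode_forward[OF assms(1-3) T2(1,2) T3(1,2), of n] unfolding achievable_def \<rho>2 \<rho>3 b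
    by (auto intro: order_trans)
qed

end
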